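(* Let $\mathcal S$ be the support of a simple pseudoline arrangement with $n$ pseudolines and $m$ intersection points, and let $\chi$ be a cut of $\mathcal S$ given by a filter $F$. Then the directed graph $G_\chi(\mathcal S)$ of $\chi$-increasing flips on pseudoline arrangements supported by $\mathcal S$ has a unique source $\Gamma$. Moreover, for any sweep $F=F_m\supset F_{m-1}\supset\dots\supset F_0=\tau(F)$ (with the associated vertices $v_i$, indices $i^\square$ and permutations $\sigma_i^\Lambda$ defined below), $\Gamma$ is characterized among the arrangements supported by $\mathcal S$ by the property that, for all $0\le i<m$, the permutation $\sigma_{i+1}^\Gamma$ is obtained from $\sigma_i^\Gamma$ by sorting its $i^\square$th and $(i^\square+1)$th entries (i.e. replacing them by their minimum and maximum, in this order).
   Context: Möbius strip: $\tau:\mathbb R^2\to\mathbb R^2$, $\tau(x,y)=(x+\pi,-y)$; $\mathcal M=\mathbb R^2/\tau$ with projection $\pi:\mathbb R^2\to\mathcal M$. A pseudoline is the image under $\pi$ of the graph of a continuous function $f:\mathbb R\to\mathbb R$ with $f(x+\pi)=-f(x)$ for all $x$. Two pseudolines are assumed to meet in finitely many points, each a crossing point or a contact point (touching without crossing). A pseudoline arrangement (with contact points) is a finite set of pseudolines any two of which have exactly one crossing point and possibly some contact points; all arrangements are simple (no three pseudolines through a common point). Its support is the union of its pseudolines, regarded as a graph whose vertices are the intersection points; an arrangement is determined by its support and its set of contact points; "$\Lambda$ is supported by $\mathcal S$" means its support is $\mathcal S$. Flip: if $v$ is a contact point of two pseudolines $\lambda,\mu$ of $\Lambda$ and $w$ is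 their crossing point, there is a unique arrangement $\Lambda'$ supported by the same support whose set of contact points is $(V\setminus\{v\})\cup\{w\}$ ($V$ the contact points of $\Lambda$); $\Lambda'$ is obtained by flipping $v$. Cuts: let $\bar{\mathcal S}=\pi^{-1}(\mathcal S)$, with edges oriented by increasing abscissa, and let $\preceq$ be the induced partial order on its vertices ($z\preceq z'$ iff there is an oriented path from $z$ to $z'$). A filter is a nonempty proper set $F$ of vertices of $\bar{\mathcal S}$ with $z\in F,\ z\preceq z'\Rightarrow z'\in F$; it determines a cut $\chi$ (the projection of a vertical curve separating $F$ from its complement). Each vertex $v$ of $\mathcal S$ has a unique preimage $\bar v\in F\setminus\tau(F)$; set $v\preceq_\chi w$ iff $\bar v\preceq\bar w$. A flip of a contact point $v$ with corresponding crossing point $w$ is $\chi$-increasing if $v\prec_\chi w$. $G_\chi(\mathcal S)$ is the directed graph whose vertices are the arrangements supported by $\mathcal S$ and whose arcs are $\chi$-increasing flips. Sweeps: a sweep is a chain of filters $F=F_m\supset\dots\supset F_0=\tau(F)$ with $F_{i+1}\setminus F_i=\{\bar v_i\}$ a single vertex; $v_i=\pi(\bar v_i)$. Let $e_i^1,\dots,e_i^n$ be the edges of $\bar{\mathcal S}$ with exactly one endpoint in $F_i$, ordered from top to bottom, and $i^\square$ the index such that $\bar v_i$ is the common endpoint of $e_i^{i^\square}$ and $e_i^{i^\square+1}$. For an arrangement $\Lambda=\{\lambda_1,\dots,\lambda_n\}$ supported by $\mathcal S$, $\sigma_i^\Lambda$ is the permutation with $\sigma_i^\Lambda(j)$ the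 index of the pseudoline containing $\pi(e_i^j)$, the pseudolines being indexed so that $\sigma_0^\Lambda=[n,n-1,\dots,1]$. *)

theory Defs
  imports "HOL-Analysis.Analysis" "Graph_Theory.Pair_Digraph"
begin

definition tau :: "real \<times> real \<Rightarrow> real \<times> real" where
  "tau p = (fst p + pi, - snd p)"

text \<open>Points of the Moebius strip are represented by the orbits of \<^const>\<open>tau\<close> (under
  positive and negative iterates).\<close>

type_synonym mpoint = "(real \<times> real) set"

definition mproj :: "real \<times> real \<Rightarrow> mpoint" where
  "mproj p = {q. \<exists>k::nat. q = (tau ^^ k) p \<or> p = (tau ^^ k) q}"

definition pseudoline_fun :: "(real \<Rightarrow> real) \<Rightarrow> bool" where
  "pseudoline_fun f \<longleftrightarrow> continuous_on UNIV f \<and> (\<forall>x. f (x + pi) = - f x)"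

definition pseudoline_of :: "(real \<Rightarrow> real) \<Rightarrow> mpoint set" where
  "pseudoline_of f = mproj ` {(x, f x) | x. True}"

definition pseudoline :: "mpoint set \<Rightarrow> bool" where
  "pseudoline \<kappa> \<longleftrightarrow> (\<exists>f. pseudoline_fun f \<and> \<kappa> = pseudoline_of f)"

text \<open>At a crossing point the difference of the two functions changes sign. When two pseudolines
  meet in finitely many points, every other common point is one where they touch.\<close>

definition crossing_point :: "mpoint set \<Rightarrow> mpoint set \<Rightarrow> mpoint \<Rightarrow> bool" where
  "crossing_point \<kappa> \<mu> p \<longleftrightarrow>
     (\<exists>f g x. pseudoline_fun f \<and> pseudoline_fun g \<and> \<kappa> = pseudoline_of f \<and> \<mu> = pseudoline_of g \<and>
        f x = g x \<and> p = mproj (x, f x) \<and>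
        (\<exists>\<epsilon>>0. \<forall>s\<in>{x-\<epsilon><..<x}. \<forall>t\<in>{x<..<x+\<epsilon>}. (f s - g s) * (f t - g t) < 0))"

definition contact_point :: "mpoint set \<Rightarrow> mpoint set \<Rightarrow> mpoint \<Rightarrow> bool" where
  "contact_point \<kappa> \<mu> p \<longleftrightarrow> p \<in> \<kappa> \<inter> \<mu> \<and> \<not> crossing_point \<kappa> \<mu> p"

text \<open>Simple pseudoline arrangements with contact points.\<close>

definition arrangement :: "mpoint set set \<Rightarrow> bool" where
  "arrangement \<Lambda> \<longleftrightarrow>
     finite \<Lambda> \<and> (\<forall>\<kappa>\<in>\<Lambda>. pseudoline \<kappa>) \<and>
     (\<forall>\<kappa>\<in>\<Lambda>. \<forall>\<mu>\<in>\<Lambda>. \<kappa> \<noteq> \<mu> \<longrightarrow> finite (\<kappa> \<inter> \<mu>) \<and> (\<exists>!p. crossing_point \<kappa> \<mu> p)) \<and>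
     (\<forall>p. card {\<kappa>\<in>\<Lambda>. p \<in> \<kappa>} \<le> 2)"

definition intersection_points :: "mpoint set set \<Rightarrow> mpoint set" where
  "intersection_points \<Lambda> = {p. \<exists>\<kappa>\<in>\<Lambda>. \<exists>\<mu>\<in>\<Lambda>. \<kappa> \<noteq> \<mu> \<and> p \<in> \<kappa> \<inter> \<mu>}"

definition contact_points :: "mpoint set set \<Rightarrow> mpoint set" where
  "contact_points \<Lambda> = {p. \<exists>\<kappa>\<in>\<Lambda>. \<exists>\<mu>\<in>\<Lambda>. \<kappa> \<noteq> \<mu> \<and> contact_point \<kappa> \<mu> p}"

text \<open>The support of an arrangement \<open>\<Lambda>\<close> is the union \<open>\<Union>\<Lambda>\<close>.\<close>

definition supported_by :: "mpoint set set \<Rightarrow> mpoint set \<Rightarrow> bool" where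
  "supported_by \<Lambda> S \<longleftrightarrow> arrangement \<Lambda> \<and> \<Union>\<Lambda> = S"

text \<open>All arrangements supported by \<open>S\<close> have the same intersection points, namely the points
  at which \<open>S\<close> is not locally a simple arc; hence the union below is the intersection
  point set of any one of them.\<close>

definition support_vertices :: "mpoint set \<Rightarrow> mpoint set" where
  "support_vertices S = \<Union> (intersection_points ` {\<Lambda>. supported_by \<Lambda> S})"

definition flip :: "mpoint set set \<Rightarrow> mpoint \<Rightarrow> mpoint \<Rightarrow> mpoint set set \<Rightarrow> bool" where
  "flip \<Lambda> v w \<Lambda>' \<longleftrightarrow>
     (\<exists>\<kappa>\<in>\<Lambda>. \<exists>\<mu>\<in>\<Lambda>. \<kappa> \<noteq> \<mu> \<and> contact_point \<kappa> \<mu> v \<and> crossing_point \<kappa> \<mu> w) \<and>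
     supported_by \<Lambda>' (\<Union>\<Lambda>) \<and>
     contact_points \<Lambda>' = (contact_points \<Lambda> - {v}) \<union> {w}"

definition cover :: "mpoint set \<Rightarrow> (real \<times> real) set" where
  "cover S = mproj -` S"

definition cover_vertices :: "mpoint set \<Rightarrow> (real \<times> real) set" where
  "cover_vertices S = mproj -` support_vertices S"

text \<open>An edge is represented by its relative interior, the open arc between two consecutive
  vertices. Parallel edges are therefore distinct sets.\<close>

definition cover_edges :: "mpoint set \<Rightarrow> (real \<times> real) set set" where
  "cover_edges S = components (cover S - cover_vertices S)"

definition edge_ends :: "mpoint set \<Rightarrow> (real \<times> real) set \<Rightarrow> (real \<times> real) set" where
  "edge_ends S e = closure e \<inter> cover_vertices S"

definition cover_arcs :: "mpoint set \<Rightarrow> (real \<times> real) rel" where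
  "cover_arcs S =
     {(z, z'). \<exists>e\<in>cover_edges S. z \<in> edge_ends S e \<and> z' \<in> edge_ends S e \<and> fst z < fst z'}"

definition cover_le :: "mpoint set \<Rightarrow> real \<times> real \<Rightarrow> real \<times> real \<Rightarrow> bool" where
  "cover_le S z z' \<longleftrightarrow> (z, z') \<in> (cover_arcs S)\<^sup>*"

definition vertex_filter :: "mpoint set \<Rightarrow> (real \<times> real) set \<Rightarrow> bool" where
  "vertex_filter S F \<longleftrightarrow>
     F \<noteq> {} \<and> F \<subset> cover_vertices S \<and>
     (\<forall>z\<in>F. \<forall>z'\<in>cover_vertices S. cover_le S z z' \<longrightarrow> z' \<in> F)"

text \<open>A cut is given by its filter \<open>F\<close>; all notions attached to the cut depend on it only
  through \<open>F\<close>.\<close>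

definition cut_lift :: "(real \<times> real) set \<Rightarrow> mpoint \<Rightarrow> real \<times> real" where
  "cut_lift F v = (THE z. z \<in> F - tau ` F \<and> mproj z = v)"

definition cut_le :: "mpoint set \<Rightarrow> (real \<times> real) set \<Rightarrow> mpoint \<Rightarrow> mpoint \<Rightarrow> bool" where
  "cut_le S F v w \<longleftrightarrow> cover_le S (cut_lift F v) (cut_lift F w)"

definition flip_graph ::
    "mpoint set \<Rightarrow> (real \<times> real) set \<Rightarrow> (mpoint set set) pair_pre_digraph" where
  "flip_graph S F =
     \<lparr> pverts = {\<Lambda>. supported_by \<Lambda> S},
       parcs = {(\<Lambda>, \<Lambda>'). supported_by \<Lambda> S \<and>
                  (\<exists>v w. flip \<Lambda> v w \<Lambda>' \<and> cut_le S F v w \<and> v \<noteq> w)} \<rparr>"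

definition is_source :: "'a pair_pre_digraph \<Rightarrow> 'a \<Rightarrow> bool" where
  "is_source G v \<longleftrightarrow> v \<in> pverts G \<and> in_arcs (with_proj G) v = {}"

text \<open>\<open>z i\<close> is the vertex added in step \<open>i\<close>.\<close>

definition sweep ::
    "mpoint set \<Rightarrow> (real \<times> real) set \<Rightarrow> nat \<Rightarrow> (nat \<Rightarrow> (real \<times> real) set) \<Rightarrow>
     (nat \<Rightarrow> real \<times> real) \<Rightarrow> bool" where
  "sweep S F m Fs z \<longleftrightarrow>
     Fs m = F \<and> Fs 0 = tau ` F \<and> (\<forall>i\<le>m. vertex_filter S (Fs i)) \<and>
     (\<forall>i<m. Fs i \<subset> Fs (Suc i) \<and> Fs (Suc i) - Fs i = {z i})"

definition cut_edges :: "mpoint set \<Rightarrow> (real \<times> real) set \<Rightarrow> (real \<times> real) set set" where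
  "cut_edges S F = {e \<in> cover_edges S. \<exists>!z. z \<in> edge_ends S e \<and> z \<in> F}"

text \<open>The edges met by a cut need not lie over a common abscissa, so their order from top to
  bottom cannot be read off their heights. A curve separating \<open>F\<close> from its complement, followed
  downwards, passes through exactly one edge of each level, in the order of the levels. The level
  of an edge is one more than the number of strands above it; it is counted on a vertical line
  that contains no vertex, since a vertex above the edge would count once instead of twice.\<close>

definition edge_level :: "mpoint set \<Rightarrow> (real \<times> real) set \<Rightarrow> nat" where
  "edge_level S e =
     (THE k. \<exists>x y. (x, y) \<in> e \<and> (\<forall>y'. (x, y') \<notin> cover_vertices S) \<and>
                   k = Suc (card {y'. y < y' \<and> (x, y') \<in> cover S}))"

definition cut_edge :: "mpoint set \<Rightarrow> (real \<times> real) set \<Rightarrow> nat \<Rightarrow> (real \<times> real) set" where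
  "cut_edge S F j = (THE e. e \<in> cut_edges S F \<and> edge_level S e = j)"

definition sweep_index ::
    "nat \<Rightarrow> mpoint set \<Rightarrow> (nat \<Rightarrow> (real \<times> real) set) \<Rightarrow> (nat \<Rightarrow> real \<times> real) \<Rightarrow> nat \<Rightarrow> nat" where
  "sweep_index n S Fs z i =
     (THE k. k \<in> {1..<n} \<and>
             z i \<in> edge_ends S (cut_edge S (Fs i) k) \<inter> edge_ends S (cut_edge S (Fs i) (k + 1)))"

definition pseudoline_at ::
    "mpoint set \<Rightarrow> mpoint set set \<Rightarrow> (real \<times> real) set \<Rightarrow> nat \<Rightarrow> mpoint set" where
  "pseudoline_at S \<Lambda> F j = (THE \<kappa>. \<kappa> \<in> \<Lambda> \<and> mproj ` cut_edge S F j \<subseteq> \<kappa>)"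

text \<open>The \<open>k\<close>-th pseudoline is the one at position \<open>n + 1 - k\<close> of the initial cut, so that the
  permutation at the initial cut is \<open>[n, n - 1, \<dots>, 1]\<close>.\<close>

definition indexed_pseudoline ::
    "nat \<Rightarrow> mpoint set \<Rightarrow> mpoint set set \<Rightarrow> (nat \<Rightarrow> (real \<times> real) set) \<Rightarrow> nat \<Rightarrow> mpoint set" where
  "indexed_pseudoline n S \<Lambda> Fs k = pseudoline_at S \<Lambda> (Fs 0) (n + 1 - k)"

definition sweep_perm ::
    "nat \<Rightarrow> mpoint set \<Rightarrow> mpoint set set \<Rightarrow> (nat \<Rightarrow> (real \<times> real) set) \<Rightarrow> nat \<Rightarrow> nat \<Rightarrow> nat" where
  "sweep_perm n S \<Lambda> Fs i j =
     (THE k. k \<in> {1..n} \<and> mproj ` cut_edge S (Fs i) j \<subseteq> indexed_pseudoline n S \<Lambda> Fs k)"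

definition sort_entries :: "nat \<Rightarrow> (nat \<Rightarrow> nat) \<Rightarrow> nat \<Rightarrow> nat" where
  "sort_entries k s = s(k := min (s k) (s (k + 1)), k + 1 := max (s k) (s (k + 1)))"

end

theory Submission
  imports Defs
begin

text \<open>
  Each arrangement supported by \<open>S\<close> is handled through the set \<open>\<Phi>\<close> of its antiperiodic functions. The
  vertices and the edges of the cover are the same for all of them, and every filter meets each
  function in exactly one edge; the levels of these edges form a permutation of \<open>{1..n}\<close>.

  A source exists, since an increasing flip strictly increases the sum of the abscissae of the lifted
  contact points and there are only finitely many sets of contact points. Along a sweep, adding a
  vertex exchanges two adjacent levels if the vertex is a crossing and changes nothing if it is a
  contact. Hence two pseudolines are in reversed order exactly until their crossing is swept. If some
  contact is swept while its two pseudolines are still in reversed order, then exchanging the two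
  pseudolines between the crossing and the contact gives an arrangement from which an increasing flip
  leads back, so the arrangement is not a source. A source therefore sorts at each step, and sorting
  at each step determines all permutations and thereby the arrangement.
\<close>

subsection \<open>Pseudolines as antiperiodic functions\<close>

text \<open>A sweep runs leftwards: a filter must contain the right neighbours of a vertex before
  the vertex itself. Positions count from the top and indices are reversed initial positions, so at
  the initial cut every pair of pseudolines has decreasing indices. Sorting then amounts to one
  condition on each pair: among its common vertices in F - tau(F), the rightmost is the crossing. In
  this form (\<open>contacts_first\<close>) the condition no longer mentions the sweep, which is why
  one source serves all sweeps. A contact violating it lies less than \<open>pi\<close> to the right
  of the crossing, so the two functions can be exchanged between these abscissae in every period
  without overlap. The obstacle is that the exchanged functions must again cross every third
  pseudoline exactly once. The two old orbits of crossings are shared out between the two new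
  functions, and antiperiodicity forces a sign change on each of them, so each receives exactly one
  orbit. The given notions speak of the support alone (components, closures, heights), whereas the
  argument compares functions; hence the translation of vertices, edges and levels that comes before
  it.\<close>

lemma tau_funpow: "(tau ^^ k) p = (fst p + real k * pi, (-1) ^ k * snd p)"
  by (induction k) (auto simp: tau_def algebra_simps)

lemma pseudoline_fun_continuous: "pseudoline_fun f \<Longrightarrow> continuous_on A f"
  unfolding pseudoline_fun_def by (metis continuous_on_subset subset_UNIV)

lemma pseudoline_fun_isCont: "pseudoline_fun f \<Longrightarrow> isCont f x"
  using pseudoline_fun_continuous[of f UNIV] by (simp add: continuous_on_eq_continuous_at)

lemma pseudoline_fun_shift_nat:
  assumes "pseudoline_fun f"
  shows "f (x + real k * pi) = (-1) ^ k * f x"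
proof (induction k)
  case (Suc k)
  have "f (x + real (Suc k) * pi) = f ((x + real k * pi) + pi)"
    by (simp add: algebra_simps)
  also have "\<dots> = - f (x + real k * pi)"
    using assms by (simp add: pseudoline_fun_def)
  finally show ?case using Suc by simp
qed simp

lemma pseudoline_fun_shift:
  assumes "pseudoline_fun f"
  shows "f (x + of_int k * pi) = (if even k then f x else - f x)"
proof (cases k rule: int_cases2)
  case (nonneg j)
  then show ?thesis using pseudoline_fun_shift_nat[OF assms, of x j] by simp
next
  case (nonpos j)
  have "f x = (-1) ^ j * f (x + of_int k * pi)"
    using pseudoline_fun_shift_nat[OF assms, of "x + of_int k * pi" j] nonpos by simp
  then show ?thesis using nonpos by (cases "even j") auto
qed

text \<open>Antiperiodicity keeps the whole orbit on the graph, so the two one-sided cases in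
  \<open>mproj\<close> merge into a single translation by an integer multiple of
  \<open>pi\<close>.\<close>

lemma mproj_graph:
  assumes "pseudoline_fun f"
  shows "mproj (x, f x) = range (\<lambda>k::int. (x + of_int k * pi, f (x + of_int k * pi)))"
proof (intro set_eqI iffI)
  fix q assume "q \<in> mproj (x, f x)"
  then obtain k :: nat where k: "q = (tau ^^ k) (x, f x) \<or> (x, f x) = (tau ^^ k) q"
    by (auto simp: mproj_def)
  show "q \<in> range (\<lambda>k::int. (x + of_int k * pi, f (x + of_int k * pi)))"
    using k
  proof
    assume "q = (tau ^^ k) (x, f x)"
    then have "q = (x + of_int (int k) * pi, f (x + of_int (int k) * pi))"
      by (simp add: tau_funpow pseudoline_fun_shift_nat[OF assms])
    then show ?thesis by blast
  next
    assume a: "(x, f x) = (tau ^^ k) q"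
    then have "fst q = x + of_int (- int k) * pi" "f x = (-1) ^ k * snd q"
      by (auto simp: tau_funpow)
    moreover from this have "snd q = f (x + of_int (- int k) * pi)"
      unfolding pseudoline_fun_shift[OF assms] by (cases "even k") auto
    ultimately have "q = (x + of_int (- int k) * pi, f (x + of_int (- int k) * pi))"
      by (simp add: prod_eq_iff)
    then show ?thesis by blast
  qed
next
  fix q assume "q \<in> range (\<lambda>k::int. (x + of_int k * pi, f (x + of_int k * pi)))"
  then obtain k :: int where q: "q = (x + of_int k * pi, f (x + of_int k * pi))"
    by blast
  show "q \<in> mproj (x, f x)"
  proof (cases k rule: int_cases2)
    case (nonneg j)
    then have "q = (tau ^^ j) (x, f x)"
      using q by (simp add: tau_funpow pseudoline_fun_shift_nat[OF assms])
    then show ?thesis by (auto simp: mproj_def)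
  next
    case (nonpos j)
    then have "(x, f x) = (tau ^^ j) q"
      using q pseudoline_fun_shift_nat[OF assms, of "x - real j * pi" j] by (simp add: tau_funpow)
    then show ?thesis unfolding mproj_def by blast
  qed
qed

lemma mproj_eq_graph_iff:
  assumes "pseudoline_fun f"
  shows "mproj (x, f x) = mproj q \<longleftrightarrow> (\<exists>k::int. q = (x + of_int k * pi, f (x + of_int k * pi)))"
proof
  assume "mproj (x, f x) = mproj q"
  moreover have "q \<in> mproj q"
    unfolding mproj_def by (rule CollectI, rule exI[of _ 0]) simp
  ultimately have "q \<in> mproj (x, f x)" by simp
  then have "q \<in> range (\<lambda>k::int. (x + of_int k * pi, f (x + of_int k * pi)))"
    using mproj_graph[OF assms] by simp
  then show "\<exists>k::int. q = (x + of_int k * pi, f (x + of_int k * pi))"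
    by blast
next
  assume "\<exists>k::int. q = (x + of_int k * pi, f (x + of_int k * pi))"
  then obtain k :: int where q: "q = (x + of_int k * pi, f (x + of_int k * pi))"
    by blast
  have *: "x + of_int k * pi + of_int j * pi = x + of_int (k + j) * pi" for j :: int
    by (simp add: algebra_simps)
  have "mproj q = range (\<lambda>j::int. (x + of_int (k + j) * pi, f (x + of_int (k + j) * pi)))"
    unfolding q mproj_graph[OF assms] * ..
  also have "\<dots> = range (\<lambda>j::int. (x + of_int j * pi, f (x + of_int j * pi)))"
    (is "range ?L = range ?R")
  proof -
    have "range ?R \<subseteq> range ?L"
    proof
      fix p assume "p \<in> range ?R"
      then obtain j where "p = ?R j" by blast
      then have "p = ?L (j - k)" by simp
      then show "p \<in> range ?L" by blast
    qed
    moreover have "range ?L \<subseteq> range ?R" by (intro image_subsetI rangeI)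
    ultimately show ?thesis by (rule subset_antisym[rotated])
  qed
  also have "\<dots> = mproj (x, f x)" by (rule mproj_graph[OF assms, symmetric])
  finally show "mproj (x, f x) = mproj q" by (rule sym)
qed

lemma mproj_eq_graphD:
  assumes "pseudoline_fun f" "mproj (x, f x) = mproj (y, z)"
  shows "\<exists>k::int. y = x + of_int k * pi"
  using assms mproj_eq_graph_iff[of f x "(y, z)"] by auto

lemma mproj_mem_pseudoline_of:
  assumes "pseudoline_fun f"
  shows "mproj (x, y) \<in> pseudoline_of f \<longleftrightarrow> y = f x"
proof
  assume "mproj (x, y) \<in> pseudoline_of f"
  then obtain t where "mproj (t, f t) = mproj (x, y)"
    by (auto simp: pseudoline_of_def)
  then show "y = f x" using mproj_eq_graph_iff[OF assms] by auto
qed (auto simp: pseudoline_of_def)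

lemma pseudoline_of_inject:
  assumes "pseudoline_fun f" "pseudoline_fun g"
  shows "pseudoline_of f = pseudoline_of g \<longleftrightarrow> f = g"
proof
  assume "pseudoline_of f = pseudoline_of g"
  then have "f x = g x" for x
    using mproj_mem_pseudoline_of[OF assms(1), of x "f x"]
      mproj_mem_pseudoline_of[OF assms(2), of x "f x"] by simp
  then show "f = g" by auto
qed simp

text \<open>The condition inside \<open>crossing_point\<close> with the two functions fixed. By
  \<open>pseudoline_of_inject\<close> a pseudoline has only one function, so the existential
  quantifiers over functions in \<open>crossing_point\<close> leave no choice.\<close>

definition crosses :: "(real \<Rightarrow> real) \<Rightarrow> (real \<Rightarrow> real) \<Rightarrow> real \<Rightarrow> bool" where
  "crosses f g x \<longleftrightarrow> f x = g x \<and>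
     (\<exists>\<epsilon>>0. \<forall>s\<in>{x-\<epsilon><..<x}. \<forall>t\<in>{x<..<x+\<epsilon>}. (f s - g s) * (f t - g t) < 0)"

lemma crossing_point_iff:
  assumes "pseudoline_fun f" "pseudoline_fun g"
  shows "crossing_point (pseudoline_of f) (pseudoline_of g) p \<longleftrightarrow>
    (\<exists>x. crosses f g x \<and> p = mproj (x, f x))"
proof
  assume "crossing_point (pseudoline_of f) (pseudoline_of g) p"
  then obtain f' g' x where "pseudoline_fun f'" "pseudoline_fun g'"
    "pseudoline_of f = pseudoline_of f'" "pseudoline_of g = pseudoline_of g'"
    and c: "crosses f' g' x" "p = mproj (x, f' x)"
    unfolding crossing_point_def crosses_def by blast
  then have "f' = f" "g' = g" using assms by (auto simp: pseudoline_of_inject)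
  then show "\<exists>x. crosses f g x \<and> p = mproj (x, f x)" using c by blast
qed (use assms in \<open>unfold crossing_point_def crosses_def, blast\<close>)

lemma crosses_sym: "crosses f g x \<longleftrightarrow> crosses g f x"
proof -
  have "(f s - g s) * (f t - g t) = (g s - f s) * (g t - f t)" for s t
    by (simp add: algebra_simps)
  then show ?thesis unfolding crosses_def by auto
qed

lemma crosses_shift:
  assumes "pseudoline_fun f" "pseudoline_fun g" "crosses f g x"
  shows "crosses f g (x + of_int k * pi)"
proof -
  obtain e where e: "e > 0"
    "\<And>s t. s \<in> {x-e<..<x} \<Longrightarrow> t \<in> {x<..<x+e} \<Longrightarrow> (f s - g s) * (f t - g t) < 0"
    using assms(3) unfolding crosses_def by blast
  let ?c = "of_int k * pi"
  have "(f s - g s) * (f t - g t) < 0" if "s \<in> {x+?c-e<..<x+?c}" "t \<in> {x+?c<..<x+?c+e}" for s t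
  proof -
    have "f s = (if even k then f (s - ?c) else - f (s - ?c))"
      "g s = (if even k then g (s - ?c) else - g (s - ?c))"
      "f t = (if even k then f (t - ?c) else - f (t - ?c))"
      "g t = (if even k then g (t - ?c) else - g (t - ?c))"
      using pseudoline_fun_shift[OF assms(1), of "s - ?c" k]
        pseudoline_fun_shift[OF assms(1), of "t - ?c" k]
        pseudoline_fun_shift[OF assms(2), of "s - ?c" k]
        pseudoline_fun_shift[OF assms(2), of "t - ?c" k] by auto
    then have "(f s - g s) * (f t - g t) =
        (f (s - ?c) - g (s - ?c)) * (f (t - ?c) - g (t - ?c))"
      by (auto simp: algebra_simps)
    also have "\<dots> < 0" using that by (intro e(2)) auto
    finally show ?thesis .
  qed
  moreover have "f (x + ?c) = g (x + ?c)"
    using assms by (simp add: pseudoline_fun_shift crosses_def)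
  ultimately show ?thesis unfolding crosses_def using e(1) by blast
qed

section \<open>Arrangements as sets of antiperiodic functions\<close>

lemma finite_translates_in_interval:
  "finite ({x. \<exists>k::int. x = c + of_int k * pi} \<inter> {a..b})"
proof -
  have "{x. \<exists>k::int. x = c + of_int k * pi} \<inter> {a..b}
      \<subseteq> (\<lambda>k::int. c + of_int k * pi) ` {\<lceil>(a - c) / pi\<rceil>..\<lfloor>(b - c) / pi\<rfloor>}"
    by (auto simp: ceiling_le_iff le_floor_iff field_simps intro!: image_eqI)
  then show ?thesis by (rule finite_subset) simp
qed

lemma shift_into_period: "\<exists>k::int. c \<le> x + of_int k * pi \<and> x + of_int k * pi < c + pi"
proof -
  let ?k = "- \<lfloor>(x - c) / pi\<rfloor>"
  have "of_int \<lfloor>(x - c) / pi\<rfloor> * pi \<le> x - c" "x - c < (of_int \<lfloor>(x - c) / pi\<rfloor> + 1) * pi"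
    using of_int_floor_le[of "(x - c) / pi"] real_of_int_floor_add_one_gt[of "(x - c) / pi"]
    unfolding pos_le_divide_eq[OF pi_gt_zero] pos_divide_less_eq[OF pi_gt_zero] .
  then have "c \<le> x + of_int ?k * pi \<and> x + of_int ?k * pi < c + pi"
    by (simp add: algebra_simps)
  then show ?thesis by blast
qed

text \<open>An arrangement in coordinates. A point of the strip has a whole orbit of abscissae, so
  uniqueness of the crossing is stated modulo multiples of \<open>pi\<close> and finiteness of the
  meets on bounded intervals.\<close>

locale pseudolines =
  fixes \<Phi> :: "(real \<Rightarrow> real) set" and S :: "mpoint set"
  assumes finite: "finite \<Phi>"
    and pfun: "f \<in> \<Phi> \<Longrightarrow> pseudoline_fun f"
    and finite_meet: "f \<in> \<Phi> \<Longrightarrow> g \<in> \<Phi> \<Longrightarrow> f \<noteq> g \<Longrightarrow> finite ({x. f x = g x} \<inter> {a..b})"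
    and ex_crosses: "f \<in> \<Phi> \<Longrightarrow> g \<in> \<Phi> \<Longrightarrow> f \<noteq> g \<Longrightarrow> \<exists>x. crosses f g x"
    and crosses_unique: "f \<in> \<Phi> \<Longrightarrow> g \<in> \<Phi> \<Longrightarrow> f \<noteq> g \<Longrightarrow> crosses f g x \<Longrightarrow> crosses f g y \<Longrightarrow>
      \<exists>k::int. y = x + of_int k * pi"
    and simple: "f \<in> \<Phi> \<Longrightarrow> g \<in> \<Phi> \<Longrightarrow> h \<in> \<Phi> \<Longrightarrow> f \<noteq> g \<Longrightarrow> f \<noteq> h \<Longrightarrow> g \<noteq> h \<Longrightarrow>
      f x = g x \<Longrightarrow> h x \<noteq> f x"
    and support: "S = \<Union> (pseudoline_of ` \<Phi>)"

text \<open>A bounded interval contains only finitely many translates of one abscissa, so the map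
  from meets in it to common points has finite fibres. Conversely, the meets in one period already
  represent every common point.\<close>

lemma finite_meet_iff:
  assumes f: "pseudoline_fun f" and g: "pseudoline_fun g"
  shows "finite (pseudoline_of f \<inter> pseudoline_of g) \<longleftrightarrow> (\<forall>a b. finite ({x. f x = g x} \<inter> {a..b}))"
proof
  assume fin: "finite (pseudoline_of f \<inter> pseudoline_of g)"
  show "\<forall>a b. finite ({x. f x = g x} \<inter> {a..b})"
  proof (intro allI)
    fix a b
    let ?X = "{x. f x = g x} \<inter> {a..b}" and ?h = "\<lambda>x. mproj (x, f x)"
    have img: "?h ` ?X \<subseteq> pseudoline_of f \<inter> pseudoline_of g"
      using mproj_mem_pseudoline_of[OF f] mproj_mem_pseudoline_of[OF g] by auto
    have fib: "finite {x\<in>?X. ?h x = p}" for p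
    proof (cases "\<exists>x. ?h x = p")
      case True
      then obtain c where c: "?h c = p" by blast
      have "{x\<in>?X. ?h x = p} \<subseteq> {x. \<exists>k::int. x = c + of_int k * pi} \<inter> {a..b}"
        using mproj_eq_graphD[OF f, of c] c by auto
      then show ?thesis using finite_translates_in_interval finite_subset by blast
    qed auto
    have "?X \<subseteq> (\<Union>p\<in>?h ` ?X. {x\<in>?X. ?h x = p})" by auto
    moreover have "finite (\<Union>p\<in>?h ` ?X. {x\<in>?X. ?h x = p})"
      using finite_subset[OF img fin] fib by blast
    ultimately show "finite ?X" by (rule finite_subset)
  qed
next
  assume fin: "\<forall>a b. finite ({x. f x = g x} \<inter> {a..b})"
  have "pseudoline_of f \<inter> pseudoline_of g \<subseteq> (\<lambda>x. mproj (x, f x)) ` ({x. f x = g x} \<inter> {0..0+pi})"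
  proof
    fix p assume p: "p \<in> pseudoline_of f \<inter> pseudoline_of g"
    then obtain x where x: "p = mproj (x, f x)" by (auto simp: pseudoline_of_def)
    obtain k :: int where k: "0 \<le> x + of_int k * pi" "x + of_int k * pi < 0 + pi"
      using shift_into_period by blast
    let ?y = "x + of_int k * pi"
    have y: "p = mproj (?y, f ?y)"
      unfolding x using mproj_eq_graph_iff[OF f] by blast
    then have "f ?y = g ?y"
      using p mproj_mem_pseudoline_of[OF g] by blast
    then show "p \<in> (\<lambda>x. mproj (x, f x)) ` ({x. f x = g x} \<inter> {0..0+pi})"
      using y k by (intro image_eqI[of _ _ ?y]) auto
  qed
  then show "finite (pseudoline_of f \<inter> pseudoline_of g)"
    using fin by (meson finite_imageI finite_subset)
qed

lemma (in pseudolines) supported_by: "supported_by (pseudoline_of ` \<Phi>) S"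
proof -
  let ?\<Lambda> = "pseudoline_of ` \<Phi>"
  have "pseudoline \<kappa>" if "\<kappa> \<in> ?\<Lambda>" for \<kappa>
    using that pfun by (auto simp: pseudoline_def)
  moreover have "finite (\<kappa> \<inter> \<mu>) \<and> (\<exists>!p. crossing_point \<kappa> \<mu> p)"
    if \<kappa>\<mu>: "\<kappa> \<in> ?\<Lambda>" "\<mu> \<in> ?\<Lambda>" "\<kappa> \<noteq> \<mu>" for \<kappa> \<mu>
  proof -
    obtain f g where fg: "f \<in> \<Phi>" "g \<in> \<Phi>" "f \<noteq> g" "\<kappa> = pseudoline_of f" "\<mu> = pseudoline_of g"
      using \<kappa>\<mu> by blast
    obtain x where x: "crosses f g x" using ex_crosses fg by blast
    have "p = mproj (x, f x)" if p: "crossing_point \<kappa> \<mu> p" for p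
    proof -
      obtain y where y: "crosses f g y" "p = mproj (y, f y)"
        using p crossing_point_iff pfun fg by blast
      then have "\<exists>k::int. y = x + of_int k * pi" using crosses_unique fg x by blast
      then have "mproj (x, f x) = mproj (y, f y)"
        using mproj_eq_graph_iff[OF pfun[OF fg(1)]] by auto
      then show ?thesis using y by simp
    qed
    moreover have "crossing_point \<kappa> \<mu> (mproj (x, f x))"
      using crossing_point_iff pfun fg x by blast
    moreover have "finite (\<kappa> \<inter> \<mu>)"
      using finite_meet_iff[OF pfun pfun] finite_meet fg by blast
    ultimately show ?thesis by blast
  qed
  moreover have "card {\<kappa>\<in>?\<Lambda>. p \<in> \<kappa>} \<le> 2" for p
  proof (rule ccontr)
    assume "\<not> ?thesis"
    then obtain T where T: "T \<subseteq> {\<kappa>\<in>?\<Lambda>. p \<in> \<kappa>}" "card T = 3"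
      using obtain_subset_with_card_n[of 3] by (metis not_less_eq_eq numeral_2_eq_2 numeral_3_eq_3)
    then obtain \<kappa> \<mu> \<nu> where "T = {\<kappa>, \<mu>, \<nu>}" "\<kappa> \<noteq> \<mu>" "\<kappa> \<noteq> \<nu>" "\<mu> \<noteq> \<nu>"
      by (metis card_3_iff)
    then obtain f g h where fgh: "f \<in> \<Phi>" "g \<in> \<Phi>" "h \<in> \<Phi>" "f \<noteq> g" "f \<noteq> h" "g \<noteq> h"
      "p \<in> pseudoline_of f" "p \<in> pseudoline_of g" "p \<in> pseudoline_of h"
      using T(1) by auto
    then obtain x where "p = mproj (x, f x)" by (auto simp: pseudoline_of_def)
    then have "f x = g x" "f x = h x"
      using fgh mproj_mem_pseudoline_of pfun by auto
    then show False using simple[of f g h x] fgh by auto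
  qed
  ultimately show ?thesis
    unfolding supported_by_def arrangement_def using finite support by auto
qed

lemma supported_by_obtain:
  assumes "supported_by \<Lambda> S"
  obtains \<Phi> where "pseudolines \<Phi> S" "\<Lambda> = pseudoline_of ` \<Phi>"
proof
  let ?\<Phi> = "{f. pseudoline_fun f \<and> pseudoline_of f \<in> \<Lambda>}"
  have arr: "arrangement \<Lambda>" and S: "\<Union>\<Lambda> = S" using assms by (auto simp: supported_by_def)
  show \<Lambda>: "\<Lambda> = pseudoline_of ` ?\<Phi>"
    using arr unfolding arrangement_def pseudoline_def by auto
  show "pseudolines ?\<Phi> S"
  proof
    have "inj_on pseudoline_of ?\<Phi>"
      by (auto intro!: inj_onI simp: pseudoline_of_inject)
    moreover have "finite (pseudoline_of ` ?\<Phi>)" using arr \<Lambda> by (simp add: arrangement_def)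
    ultimately show "finite ?\<Phi>" by (metis finite_imageD)
    show "S = \<Union> (pseudoline_of ` ?\<Phi>)" using S \<Lambda> by simp
  next
    fix f g assume fg: "f \<in> ?\<Phi>" "g \<in> ?\<Phi>" "f \<noteq> g"
    then have ne: "pseudoline_of f \<noteq> pseudoline_of g" by (auto simp: pseudoline_of_inject)
    then have *: "finite (pseudoline_of f \<inter> pseudoline_of g)"
      "\<exists>!p. crossing_point (pseudoline_of f) (pseudoline_of g) p"
      using arr fg unfolding arrangement_def by auto
    show "finite ({x. f x = g x} \<inter> {a..b})" for a b
      using *(1) finite_meet_iff[of f g] fg by auto
    show "\<exists>x. crosses f g x"
      using *(2) crossing_point_iff[of f g] fg by auto
    show "\<exists>k::int. y = x + of_int k * pi" if xy: "crosses f g x" "crosses f g y" for x y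
    proof -
      have "mproj (x, f x) = mproj (y, f y)"
        using *(2) crossing_point_iff[of f g] fg xy by blast
      then show ?thesis using mproj_eq_graphD[of f x] fg by auto
    qed
    show "h x \<noteq> f x" if h: "h \<in> ?\<Phi>" "f \<noteq> h" "g \<noteq> h" "f x = g x" for h x
    proof
      assume "h x = f x"
      then have "{pseudoline_of f, pseudoline_of g, pseudoline_of h} \<subseteq> {\<kappa>\<in>\<Lambda>. mproj (x, f x) \<in> \<kappa>}"
        using fg h mproj_mem_pseudoline_of by auto
      moreover have "finite {\<kappa>\<in>\<Lambda>. mproj (x, f x) \<in> \<kappa>}"
        using arr by (simp add: arrangement_def)
      moreover have "card {pseudoline_of f, pseudoline_of g, pseudoline_of h} = 3"
        using fg h ne by (auto simp: card_3_iff pseudoline_of_inject)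
      ultimately have "3 \<le> card {\<kappa>\<in>\<Lambda>. mproj (x, f x) \<in> \<kappa>}"
        by (metis card_mono)
      moreover have "card {\<kappa>\<in>\<Lambda>. mproj (x, f x) \<in> \<kappa>} \<le> 2"
        using arr by (simp add: arrangement_def)
      ultimately show False by simp
    qed
  qed auto
qed

subsection \<open>Vertices, edges and levels\<close>

lemma sign_constant_between_meets:
  fixes f g :: "real \<Rightarrow> real"
  assumes "continuous_on {a<..<b} f" "continuous_on {a<..<b} g"
    and ne: "\<And>t. a < t \<Longrightarrow> t < b \<Longrightarrow> f t \<noteq> g t"
    and st: "s \<in> {a<..<b}" "t \<in> {a<..<b}"
  shows "f s < g s \<longleftrightarrow> f t < g t"
proof -
  have conn: "connected ((\<lambda>x. g x - f x) ` {a<..<b})"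
    using assms by (intro connected_continuous_image continuous_intros) auto
  have "f t < g t" if st: "s \<in> {a<..<b}" "t \<in> {a<..<b}" "f s < g s" for s t
  proof (rule ccontr)
    assume "\<not> f t < g t"
    then have le: "g t - f t \<le> 0" "0 \<le> g s - f s" using st(3) by auto
    have "0 \<in> (\<lambda>x. g x - f x) ` {a<..<b}"
      by (rule connectedD_interval[OF conn _ _ le]) (use st in auto)
    then show False using ne by force
  qed
  then show ?thesis using st by blast
qed

definition meets :: "(real \<Rightarrow> real) set \<Rightarrow> (real \<Rightarrow> real) \<Rightarrow> real set" where
  "meets \<Phi> f = {x. \<exists>g\<in>\<Phi>. g \<noteq> f \<and> g x = f x}"

definition vertices :: "(real \<Rightarrow> real) set \<Rightarrow> (real \<times> real) set" where
  "vertices \<Phi> = {(x, f x) | f x. f \<in> \<Phi> \<and> x \<in> meets \<Phi> f}"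

definition consecutive :: "(real \<Rightarrow> real) set \<Rightarrow> (real \<Rightarrow> real) \<Rightarrow> real \<Rightarrow> real \<Rightarrow> bool" where
  "consecutive \<Phi> f a b \<longleftrightarrow>
     a \<in> meets \<Phi> f \<and> b \<in> meets \<Phi> f \<and> a < b \<and> (\<forall>x. a < x \<longrightarrow> x < b \<longrightarrow> x \<notin> meets \<Phi> f)"

definition strand :: "(real \<Rightarrow> real) \<Rightarrow> real \<Rightarrow> real \<Rightarrow> (real \<times> real) set" where
  "strand f a b = (\<lambda>x. (x, f x)) ` {a<..<b}"

text \<open>At a vertex both strands receive the level of the upper one, because neither counts the
  other. The level of an edge is therefore read off in its interior.\<close>

definition lev :: "(real \<Rightarrow> real) set \<Rightarrow> (real \<Rightarrow> real) \<Rightarrow> real \<Rightarrow> nat" where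
  "lev \<Phi> f x = Suc (card {g\<in>\<Phi>. f x < g x})"

text \<open>The midpoint stands for an arbitrary interior abscissa; \<open>lev_constant\<close>
  justifies this choice.\<close>

definition strand_lev :: "(real \<Rightarrow> real) set \<Rightarrow> (real \<Rightarrow> real) \<Rightarrow> real \<Rightarrow> real \<Rightarrow> nat" where
  "strand_lev \<Phi> f a b = lev \<Phi> f ((a + b) / 2)"

lemma consecutive_unique:
  assumes "consecutive \<Phi> f a b" "consecutive \<Phi> f c d" "a < d" "c < b"
  shows "a = c" "b = d"
proof -
  show "a = c" using assms unfolding consecutive_def by (metis linorder_less_linear)
  then show "b = d" using assms unfolding consecutive_def by (metis linorder_less_linear)
qed

context pseudolines
begin

lemma meet_isolated:
  assumes "f \<in> \<Phi>" "g \<in> \<Phi>" "f \<noteq> g"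
  shows "\<forall>\<^sub>F t in at x. f t \<noteq> g t"
proof -
  let ?X = "{t. f t = g t} \<inter> {x-1..x+1} - {x}"
  have "closed ?X" using finite_meet[OF assms] by (intro finite_imp_closed) auto
  then have "open (- ?X \<inter> {x-1<..<x+1})"
    by (intro open_Int open_Compl open_greaterThanLessThan)
  then have "\<forall>\<^sub>F t in nhds x. t \<in> - ?X \<inter> {x-1<..<x+1}"
    by (intro eventually_nhds_in_open) auto
  then show ?thesis unfolding eventually_at_filter by eventually_elim auto
qed

lemma finite_meets:
  assumes "f \<in> \<Phi>"
  shows "finite (meets \<Phi> f \<inter> {a..b})"
proof -
  have "meets \<Phi> f \<inter> {a..b} = (\<Union>g\<in>\<Phi>-{f}. {x. g x = f x} \<inter> {a..b})"
    by (auto simp: meets_def)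
  moreover have "finite (\<Union>g\<in>\<Phi>-{f}. {x. g x = f x} \<inter> {a..b})"
    using finite finite_meet assms by (intro finite_UN_I) auto
  ultimately show ?thesis by simp
qed

lemma meets_shift:
  assumes "f \<in> \<Phi>" "x \<in> meets \<Phi> f"
  shows "x + of_int k * pi \<in> meets \<Phi> f"
proof -
  obtain g where g: "g \<in> \<Phi>" "g \<noteq> f" "g x = f x" using assms(2) by (auto simp: meets_def)
  then have "g (x + of_int k * pi) = f (x + of_int k * pi)"
    using pseudoline_fun_shift[OF pfun[OF assms(1)], of x k] pseudoline_fun_shift[OF pfun[OF g(1)], of x k]
    by simp
  then show ?thesis using g by (auto simp: meets_def)
qed

lemma cover_eq: "cover S = {(x, f x) | f x. f \<in> \<Phi>}"
  unfolding cover_def support using mproj_mem_pseudoline_of pfun by auto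

lemma vertices_mproj:
  assumes "v \<in> vertices \<Phi>" "mproj v = mproj w"
  shows "w \<in> vertices \<Phi>"
proof -
  obtain f x where v: "f \<in> \<Phi>" "x \<in> meets \<Phi> f" "v = (x, f x)"
    using assms(1) by (auto simp: vertices_def)
  then obtain k :: int where "w = (x + of_int k * pi, f (x + of_int k * pi))"
    using mproj_eq_graph_iff[OF pfun] assms(2) by blast
  then show ?thesis using meets_shift v unfolding vertices_def by blast
qed

lemma intersection_points_eq: "intersection_points (pseudoline_of ` \<Phi>) = mproj ` vertices \<Phi>"
proof (intro set_eqI iffI)
  fix p assume "p \<in> intersection_points (pseudoline_of ` \<Phi>)"
  then obtain f g where fg: "f \<in> \<Phi>" "g \<in> \<Phi>" "f \<noteq> g" "p \<in> pseudoline_of f" "p \<in> pseudoline_of g"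
    by (auto simp: intersection_points_def)
  then obtain x where x: "p = mproj (x, f x)" by (auto simp: pseudoline_of_def)
  then have "f x = g x" using fg mproj_mem_pseudoline_of pfun by blast
  then have "x \<in> meets \<Phi> f" using fg by (auto simp: meets_def)
  then show "p \<in> mproj ` vertices \<Phi>" using x fg by (auto simp: vertices_def)
next
  fix p assume "p \<in> mproj ` vertices \<Phi>"
  then obtain f g x where "p = mproj (x, f x)" "f \<in> \<Phi>" "g \<in> \<Phi>" "g \<noteq> f" "g x = f x"
    by (auto simp: vertices_def meets_def)
  then have "p \<in> pseudoline_of f \<inter> pseudoline_of g" "pseudoline_of f \<noteq> pseudoline_of g"
    using mproj_mem_pseudoline_of[OF pfun] pseudoline_of_inject[OF pfun pfun] by auto
  then show "p \<in> intersection_points (pseudoline_of ` \<Phi>)"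
    unfolding intersection_points_def using \<open>f \<in> \<Phi>\<close> \<open>g \<in> \<Phi>\<close> by blast
qed

lemma ex_generic:
  assumes "a < b"
  shows "\<exists>x. a < x \<and> x < b \<and> (\<forall>y. (x, y) \<notin> vertices \<Phi>)"
proof -
  have "finite (\<Union>f\<in>\<Phi>. meets \<Phi> f \<inter> {a..b})"
    using finite finite_meets by (intro finite_UN_I) auto
  then have "infinite ({a<..<b} - (\<Union>f\<in>\<Phi>. meets \<Phi> f \<inter> {a..b}))"
    using assms by (intro Diff_infinite_finite) auto
  then obtain x where "x \<in> {a<..<b} - (\<Union>f\<in>\<Phi>. meets \<Phi> f \<inter> {a..b})"
    by (metis infinite_imp_nonempty ex_in_conv)
  then show ?thesis by (auto simp: vertices_def intro!: exI[of _ x])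
qed

lemma generic_inj:
  assumes "\<forall>y. (x, y) \<notin> vertices \<Phi>"
  shows "inj_on (\<lambda>f. f x) \<Phi>"
  using assms by (auto simp: vertices_def meets_def inj_on_def)

end

text \<open>Two functions of \<Phi> through a common vertex separate on a punctured neighbourhood,
  and a single function of \<Psi> cannot follow both. Used in both directions, this shows that the
  vertices depend on the support only, so \<open>support_vertices\<close> is a union of identical
  sets.\<close>

lemma vertices_subset:
  assumes "pseudolines \<Phi> S" "pseudolines \<Psi> S"
  shows "vertices \<Phi> \<subseteq> vertices \<Psi>"
proof
  interpret A: pseudolines \<Phi> S by fact
  interpret B: pseudolines \<Psi> S by fact
  have cov: "{(x, f x) | f x. f \<in> \<Phi>} = {(x, f x) | f x. f \<in> \<Psi>}"
    using A.cover_eq B.cover_eq by simp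
  fix v assume "v \<in> vertices \<Phi>"
  then obtain f g x where v: "v = (x, f x)" "f \<in> \<Phi>" "g \<in> \<Phi>" "g \<noteq> f" "g x = f x"
    by (auto simp: vertices_def meets_def)
  have "v \<in> {(x, f x) | f x. f \<in> \<Psi>}" using v cov by blast
  then obtain \<psi> where \<psi>: "\<psi> \<in> \<Psi>" "\<psi> x = f x" using v by auto
  have "x \<in> meets \<Psi> \<psi>"
  proof (rule ccontr)
    assume no: "x \<notin> meets \<Psi> \<psi>"
    \<comment> \<open>Otherwise \<open>\<psi>\<close> is the only strand of the support near the vertex.\<close>
    have local_eq: "\<forall>\<^sub>F t in at x. \<phi> t = \<psi> t" if \<phi>: "\<phi> \<in> \<Phi>" "\<phi> x = \<psi> x" for \<phi>
    proof -
      have "\<forall>\<^sub>F t in at x. \<forall>h\<in>\<Psi>-{\<psi>}. h t - \<phi> t \<noteq> 0"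
      proof (intro eventually_ball_finite ballI)
        show "finite (\<Psi> - {\<psi>})" using B.finite by simp
        fix h assume h: "h \<in> \<Psi> - {\<psi>}"
        have "isCont (\<lambda>t. h t - \<phi> t) x"
          using h \<phi> A.pfun B.pfun by (intro continuous_diff pseudoline_fun_isCont) auto
        then have "((\<lambda>t. h t - \<phi> t) \<longlongrightarrow> h x - \<phi> x) (at x)" by (simp add: isCont_def)
        moreover have "h x - \<phi> x \<noteq> 0" using no h \<phi> by (auto simp: meets_def)
        ultimately show "\<forall>\<^sub>F t in at x. h t - \<phi> t \<noteq> 0" by (rule tendsto_imp_eventually_ne)
      qed
      then show ?thesis
      proof eventually_elim
        fix t assume *: "\<forall>h\<in>\<Psi>-{\<psi>}. h t - \<phi> t \<noteq> 0"
        have "(t, \<phi> t) \<in> {(x, f x) | f x. f \<in> \<Psi>}" using \<phi> cov by blast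
        then obtain h where "h \<in> \<Psi>" "h t = \<phi> t" by auto
        then show "\<phi> t = \<psi> t" using * by force
      qed
    qed
    have "\<forall>\<^sub>F t in at x. f t = \<psi> t" "\<forall>\<^sub>F t in at x. g t = \<psi> t" "\<forall>\<^sub>F t in at x. g t \<noteq> f t"
      using local_eq[OF v(2)] local_eq[OF v(3)] A.meet_isolated[OF v(3,2,4)] \<psi> v(5) by auto
    then have "\<forall>\<^sub>F t in at x. False" by eventually_elim simp
    then show False by (simp add: eventually_False)
  qed
  moreover have "v = (x, \<psi> x)" using \<psi> v(1) by simp
  ultimately show "v \<in> vertices \<Psi>" using \<psi>(1) unfolding vertices_def by blast
qed

context pseudolines
begin

lemma vertices_unique: "pseudolines \<Psi> S \<Longrightarrow> vertices \<Psi> = vertices \<Phi>"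
  using vertices_subset pseudolines_axioms by (metis subset_antisym)

lemma support_vertices_eq: "support_vertices S = mproj ` vertices \<Phi>"
proof -
  have "intersection_points \<Lambda> = mproj ` vertices \<Phi>" if "supported_by \<Lambda> S" for \<Lambda>
    using supported_by_obtain[OF that] pseudolines.intersection_points_eq vertices_unique by metis
  then show ?thesis unfolding support_vertices_def using supported_by by blast
qed

lemma cover_vertices_eq: "cover_vertices S = vertices \<Phi>"
  unfolding cover_vertices_def support_vertices_eq using vertices_mproj by fastforce

text \<open>Over an abscissa without vertices the functions take distinct values, so their number is
  the number of points of the support there, whichever arrangement is chosen.\<close>

lemma card_unique:
  assumes "pseudolines \<Psi> S"
  shows "card \<Psi> = card \<Phi>"
proof -
  interpret B: pseudolines \<Psi> S by fact
  obtain x where x: "\<forall>y. (x, y) \<notin> vertices \<Phi>" using ex_generic[of 0 1] by auto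
  then have "card \<Phi> = card ((\<lambda>f. f x) ` \<Phi>)" using generic_inj by (simp add: card_image)
  also have "(\<lambda>f. f x) ` \<Phi> = {y. (x, y) \<in> cover S}" by (auto simp: cover_eq)
  also have "\<dots> = (\<lambda>f. f x) ` \<Psi>" by (auto simp: B.cover_eq)
  also have "card \<dots> = card \<Psi>"
    using x B.generic_inj vertices_unique[OF assms] by (simp add: card_image)
  finally show ?thesis ..
qed

lemma lev_less:
  assumes "f \<in> \<Phi>" "g \<in> \<Phi>" "g x < f x"
  shows "lev \<Phi> f x < lev \<Phi> g x"
proof -
  have "{h\<in>\<Phi>. f x < h x} \<subset> {h\<in>\<Phi>. g x < h x}" using assms by auto
  then show ?thesis unfolding lev_def using finite by (simp add: psubset_card_mono)
qed

lemma lev_le: "f \<in> \<Phi> \<Longrightarrow> lev \<Phi> f x \<le> card \<Phi>"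
  using finite psubset_card_mono[of \<Phi> "{h\<in>\<Phi>. f x < h x}"] unfolding lev_def by fastforce

lemma sign_constant:
  assumes "f \<in> \<Phi>" "g \<in> \<Phi>" "consecutive \<Phi> f a b" "s \<in> {a<..<b}" "t \<in> {a<..<b}"
  shows "f s < g s \<longleftrightarrow> f t < g t"
proof (cases "g = f")
  case False
  then have "f x \<noteq> g x" if "a < x" "x < b" for x
    using that assms(2,3) by (force simp: consecutive_def meets_def)
  then show ?thesis
    using assms by (intro sign_constant_between_meets[of a b])
      (auto simp: pseudoline_fun_continuous pfun)
qed auto

lemma lev_constant:
  assumes "f \<in> \<Phi>" "consecutive \<Phi> f a b" "t \<in> {a<..<b}"
  shows "lev \<Phi> f t = strand_lev \<Phi> f a b"
proof -
  have "(a + b) / 2 \<in> {a<..<b}" using assms(2) by (auto simp: consecutive_def)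
  then have "{g\<in>\<Phi>. f t < g t} = {g\<in>\<Phi>. f ((a + b) / 2) < g ((a + b) / 2)}"
    using sign_constant assms by blast
  then show ?thesis by (simp add: lev_def strand_lev_def)
qed

text \<open>All admissible abscissae in the edge give the same count, since no function meets the
  edge in its interior. On a line without vertices, heights above the edge correspond one to one to
  functions above it.\<close>

lemma edge_level_eq:
  assumes "f \<in> \<Phi>" "consecutive \<Phi> f a b"
  shows "edge_level S (strand f a b) = strand_lev \<Phi> f a b"
proof -
  have count: "Suc (card {y'. f x < y' \<and> (x, y') \<in> cover S}) = strand_lev \<Phi> f a b"
    if x: "a < x" "x < b" "\<forall>y. (x, y) \<notin> vertices \<Phi>" for x
  proof -
    have "{y'. f x < y' \<and> (x, y') \<in> cover S} = (\<lambda>h. h x) ` {h\<in>\<Phi>. f x < h x}"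
      by (auto simp: cover_eq)
    then have "card {y'. f x < y' \<and> (x, y') \<in> cover S} = card {h\<in>\<Phi>. f x < h x}"
      using generic_inj[OF x(3)] by (auto simp: card_image inj_on_def)
    then show ?thesis using lev_constant[OF assms, of x] x by (simp add: lev_def)
  qed
  have "a < b" using assms(2) by (simp add: consecutive_def)
  then obtain x where x: "a < x" "x < b" "\<forall>y. (x, y) \<notin> vertices \<Phi>"
    using ex_generic by blast
  show ?thesis unfolding edge_level_def
  proof (rule the_equality)
    show "\<exists>x y. (x, y) \<in> strand f a b \<and> (\<forall>y'. (x, y') \<notin> cover_vertices S) \<and>
        strand_lev \<Phi> f a b = Suc (card {y'. y < y' \<and> (x, y') \<in> cover S})"
      using x count[OF x] by (intro exI[of _ x] exI[of _ "f x"]) (auto simp: cover_vertices_eq strand_def)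
  next
    fix k assume "\<exists>x y. (x, y) \<in> strand f a b \<and> (\<forall>y'. (x, y') \<notin> cover_vertices S) \<and>
        k = Suc (card {y'. y < y' \<and> (x, y') \<in> cover S})"
    then show "k = strand_lev \<Phi> f a b" using count by (auto simp: cover_vertices_eq strand_def)
  qed
qed

end

text \<open>A lone pseudoline would have no vertex and hence no bounded edge. With two of them every
  function meets another one in every period, so each edge has two ends.\<close>

locale proper_pseudolines = pseudolines +
  assumes two: "2 \<le> card \<Phi>"
begin

lemma ex_other:
  assumes "f \<in> \<Phi>"
  shows "\<exists>g\<in>\<Phi>. g \<noteq> f"
proof (rule ccontr)
  assume "\<not> ?thesis"
  then have "\<Phi> \<subseteq> {f}" by auto
  then have "card \<Phi> \<le> 1" using card_mono[of "{f}" \<Phi>] by simp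
  then show False using two by simp
qed

lemma meets_unbounded:
  assumes "f \<in> \<Phi>"
  shows "\<exists>b\<in>meets \<Phi> f. x < b" "\<exists>a\<in>meets \<Phi> f. a < x"
proof -
  obtain g where g: "g \<in> \<Phi>" "g \<noteq> f" using ex_other assms by blast
  then obtain c where "crosses g f c" using ex_crosses assms by blast
  then have c: "c \<in> meets \<Phi> f" using g by (auto simp: meets_def crosses_def)
  obtain k :: int where k: "x + 1 \<le> c + of_int k * pi" using shift_into_period by blast
  then show "\<exists>b\<in>meets \<Phi> f. x < b" using meets_shift[OF assms c, of k] by force
  \<comment> \<open>Applying \<open>shift_into_period\<close> with left end \<open>x - pi\<close>
    yields a translate strictly to the left of \<open>x\<close>.\<close>
  obtain k :: int where "c + of_int k * pi < x - pi + pi" using shift_into_period by blast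
  then show "\<exists>a\<in>meets \<Phi> f. a < x" using meets_shift[OF assms c, of k] by force
qed

lemma ex_next:
  assumes "f \<in> \<Phi>"
  shows "\<exists>b\<in>meets \<Phi> f. x < b \<and> (\<forall>t. x < t \<longrightarrow> t < b \<longrightarrow> t \<notin> meets \<Phi> f)"
proof -
  obtain c where c: "c \<in> meets \<Phi> f" "x < c" using meets_unbounded assms by blast
  let ?X = "meets \<Phi> f \<inter> {x<..c}"
  have "finite ?X" using finite_meets[OF assms, of x c] by (rule finite_subset[rotated]) auto
  moreover have "?X \<noteq> {}" using c by auto
  ultimately have "Min ?X \<in> ?X" "\<forall>t\<in>?X. Min ?X \<le> t" using Min_in Min_le by blast+
  then show ?thesis by (intro bexI[of _ "Min ?X"]) force+
qed

lemma ex_prev: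
  assumes "f \<in> \<Phi>"
  shows "\<exists>a\<in>meets \<Phi> f. a < x \<and> (\<forall>t. a < t \<longrightarrow> t < x \<longrightarrow> t \<notin> meets \<Phi> f)"
proof -
  obtain c where c: "c \<in> meets \<Phi> f" "c < x" using meets_unbounded assms by blast
  let ?X = "meets \<Phi> f \<inter> {c..<x}"
  have "finite ?X" using finite_meets[OF assms, of c x] by (rule finite_subset[rotated]) auto
  moreover have "?X \<noteq> {}" using c by auto
  ultimately have "Max ?X \<in> ?X" "\<forall>t\<in>?X. t \<le> Max ?X" using Max_in Max_ge by blast+
  then show ?thesis by (intro bexI[of _ "Max ?X"]) force+
qed

lemma ex_consecutive_right: "f \<in> \<Phi> \<Longrightarrow> a \<in> meets \<Phi> f \<Longrightarrow> \<exists>b. consecutive \<Phi> f a b"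
  using ex_next unfolding consecutive_def by blast

lemma ex_consecutive_left: "f \<in> \<Phi> \<Longrightarrow> b \<in> meets \<Phi> f \<Longrightarrow> \<exists>a. consecutive \<Phi> f a b"
  using ex_prev unfolding consecutive_def by blast

lemma ex_consecutive_around:
  assumes "f \<in> \<Phi>" "x \<notin> meets \<Phi> f"
  shows "\<exists>a b. consecutive \<Phi> f a b \<and> a < x \<and> x < b"
proof -
  obtain b where b: "b \<in> meets \<Phi> f" "x < b" "\<forall>t. x < t \<longrightarrow> t < b \<longrightarrow> t \<notin> meets \<Phi> f"
    using ex_next assms by blast
  obtain a where a: "a \<in> meets \<Phi> f" "a < x" "\<forall>t. a < t \<longrightarrow> t < x \<longrightarrow> t \<notin> meets \<Phi> f"
    using ex_prev assms by blast
  have "t \<notin> meets \<Phi> f" if "a < t" "t < b" for t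
    using a b assms(2) that by (cases t x rule: linorder_cases) auto
  then have "consecutive \<Phi> f a b" using a b unfolding consecutive_def by simp
  then show ?thesis using a b by blast
qed

text \<open>The open arc is clopen in the support without its vertices. It is closed because the
  closed arc \<open>?K\<close> is compact and only its two ends, both vertices, are missing; it is
  open because \<open>?O\<close> keeps the abscissae strictly between the ends and avoids all other
  graphs. A connected clopen set is a component.\<close>

lemma strand_mem_components:
  assumes f: "f \<in> \<Phi>" and c: "consecutive \<Phi> f a b"
  shows "strand f a b \<in> components (cover S - cover_vertices S)" (is "?A \<in> components ?W")
proof -
  have ab: "a < b" using c by (simp add: consecutive_def)
  have contf: "continuous_on X (\<lambda>x. (x, f x))" for X
    using pseudoline_fun_continuous[OF pfun[OF f]] by (intro continuous_intros) auto
  have no: "g x \<noteq> f x" if "a < x" "x < b" "g \<in> \<Phi>" "g \<noteq> f" for g x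
    using c that unfolding consecutive_def meets_def by blast
  have "(x, f x) \<notin> vertices \<Phi>" if x: "a < x" "x < b" for x
  proof
    assume "(x, f x) \<in> vertices \<Phi>"
    then obtain h k where hk: "h \<in> \<Phi>" "k \<in> \<Phi>" "k \<noteq> h" "k x = h x" "h x = f x"
      by (auto simp: vertices_def meets_def)
    show False using no[OF x, of h] no[OF x, of k] hk by auto
  qed
  then have AW: "?A \<subseteq> ?W" using f unfolding cover_eq cover_vertices_eq strand_def by auto
  let ?K = "(\<lambda>x. (x, f x)) ` {a..b}"
  let ?O = "{p::real\<times>real. a < fst p \<and> fst p < b} \<inter> (\<Inter>g\<in>\<Phi>-{f}. {p. snd p \<noteq> g (fst p)})"
  have K: "closed ?K" by (intro compact_imp_closed compact_continuous_image contf) auto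
  have WK: "?W \<inter> ?K = ?A"
  proof -
    have "(a, f a) \<in> vertices \<Phi>" "(b, f b) \<in> vertices \<Phi>"
      using c f by (auto simp: consecutive_def vertices_def)
    then have "x \<noteq> a \<and> x \<noteq> b" if "(x, f x) \<in> ?W" for x
      using that by (auto simp: cover_vertices_eq)
    then have "?W \<inter> ?K \<subseteq> ?A" by (force simp: strand_def)
    then show ?thesis using AW by (force simp: strand_def)
  qed
  have O: "open ?O"
  proof -
    have "open {p::real\<times>real. snd p \<noteq> g (fst p)}" if "g \<in> \<Phi>" for g
    proof -
      have "continuous_on UNIV (\<lambda>p::real\<times>real. g (fst p))"
        by (rule continuous_on_compose2[OF pseudoline_fun_continuous[OF pfun[OF that], of UNIV]])
          (auto intro: continuous_intros)
      then show ?thesis by (intro open_Collect_neq continuous_on_snd continuous_on_id)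
    qed
    moreover have "open {p::real\<times>real. a < fst p \<and> fst p < b}"
      by (intro open_Collect_conj open_Collect_less continuous_intros)
    ultimately show ?thesis using finite by (intro open_Int open_INT) auto
  qed
  have WO: "?W \<inter> ?O = ?A"
  proof -
    have "?W \<inter> ?O \<subseteq> ?A" by (auto simp: cover_eq strand_def image_iff)
    moreover have "?A \<subseteq> ?O" using no by (force simp: strand_def)
    ultimately show ?thesis using AW by auto
  qed
  have clopen: "openin (top_of_set ?W) ?A" "closedin (top_of_set ?W) ?A"
    using openin_open_Int[OF O, of ?W] closedin_closed_Int[OF K, of ?W] unfolding WK WO .
  have "connected ?A" unfolding strand_def by (intro connected_continuous_image contf) auto
  moreover have "?A \<noteq> {}" using ab by (auto simp: strand_def)
  moreover have "D = ?A" if D: "D \<noteq> {}" "?A \<subseteq> D" "D \<subseteq> ?W" "connected D" for D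
  proof -
    have "openin (top_of_set D) ?A" "closedin (top_of_set D) ?A"
      using clopen D by (auto intro: openin_subset_trans closedin_subset_trans)
    then show ?thesis using D(4) \<open>?A \<noteq> {}\<close> unfolding connected_clopen by blast
  qed
  ultimately show ?thesis unfolding in_components_maximal using AW by blast
qed

lemma cover_edges_eq: "cover_edges S = {strand f a b | f a b. f \<in> \<Phi> \<and> consecutive \<Phi> f a b}"
proof (intro set_eqI iffI)
  fix e assume e: "e \<in> cover_edges S"
  then obtain p where p: "p \<in> e" unfolding cover_edges_def using in_components_nonempty by blast
  then have "p \<in> cover S - cover_vertices S"
    using e in_components_subset unfolding cover_edges_def by blast
  then obtain f x where f: "f \<in> \<Phi>" "p = (x, f x)" "x \<notin> meets \<Phi> f"
    unfolding cover_eq cover_vertices_eq by (auto simp: vertices_def)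
  then obtain a b where ab: "consecutive \<Phi> f a b" "a < x" "x < b"
    using ex_consecutive_around by blast
  then have "p \<in> strand f a b" using f by (auto simp: strand_def)
  then have "e = strand f a b"
    using strand_mem_components[OF f(1) ab(1)] e p unfolding cover_edges_def
    by (meson components_nonoverlap disjoint_iff)
  then show "e \<in> {strand f a b | f a b. f \<in> \<Phi> \<and> consecutive \<Phi> f a b}" using f ab by blast
qed (use strand_mem_components in \<open>auto simp: cover_edges_def\<close>)

lemma edge_ends_eq:
  assumes f: "f \<in> \<Phi>" and c: "consecutive \<Phi> f a b"
  shows "edge_ends S (strand f a b) = {(a, f a), (b, f b)}"
proof -
  have ab: "a < b" using c by (simp add: consecutive_def)
  have contf: "continuous_on X (\<lambda>x. (x, f x))" for X
    using pseudoline_fun_continuous[OF pfun[OF f]] by (intro continuous_intros) auto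
  have "closed ((\<lambda>x. (x, f x)) ` {a..b})"
    by (intro compact_imp_closed compact_continuous_image contf) auto
  then have "closure (strand f a b) \<subseteq> (\<lambda>x. (x, f x)) ` {a..b}"
    unfolding strand_def by (intro closure_minimal) auto
  moreover have "(\<lambda>x. (x, f x)) ` {a..b} \<subseteq> closure (strand f a b)"
    using image_closure_subset[of "{a<..<b}" "\<lambda>x. (x, f x)" "closure (strand f a b)"] contf ab
      closure_subset[of "strand f a b"] by (simp add: strand_def)
  ultimately have cl: "closure (strand f a b) = (\<lambda>x. (x, f x)) ` {a..b}" by auto
  have "(a, f a) \<in> vertices \<Phi>" "(b, f b) \<in> vertices \<Phi>"
    using c f by (auto simp: consecutive_def vertices_def)
  moreover have "(x, f x) \<notin> vertices \<Phi>" if "a < x" "x < b" for x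
  proof -
    have "(x, f x) \<in> strand f a b" using that by (auto simp: strand_def)
    then show ?thesis
      using in_components_subset[OF strand_mem_components[OF f c]] cover_vertices_eq by auto
  qed
  ultimately have "(x, f x) \<in> vertices \<Phi> \<longleftrightarrow> x = a \<or> x = b" if "a \<le> x" "x \<le> b" for x
    using that by (metis order_le_less)
  then show ?thesis unfolding edge_ends_def cl cover_vertices_eq using ab by auto
qed

lemma cover_arcs_eq:
  "cover_arcs S = {((a, f a), (b, f b)) | f a b. f \<in> \<Phi> \<and> consecutive \<Phi> f a b}" (is "_ = ?R")
proof (intro set_eqI iffI)
  fix p assume "p \<in> cover_arcs S"
  then obtain z z' f a b where p: "p = (z, z')" "f \<in> \<Phi>" "consecutive \<Phi> f a b"
    "z \<in> edge_ends S (strand f a b)" "z' \<in> edge_ends S (strand f a b)" "fst z < fst z'"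
    unfolding cover_arcs_def cover_edges_eq by auto
  then have "z = (a, f a)" "z' = (b, f b)" using edge_ends_eq p by (auto simp: consecutive_def)
  then show "p \<in> ?R" using p by blast
next
  fix p assume "p \<in> ?R"
  then obtain f a b where p: "p = ((a, f a), (b, f b))" "f \<in> \<Phi>" "consecutive \<Phi> f a b" by auto
  then have "strand f a b \<in> cover_edges S" by (auto simp: cover_edges_eq)
  then show "p \<in> cover_arcs S"
    unfolding cover_arcs_def using p edge_ends_eq[OF p(2,3)]
    by (auto simp: consecutive_def intro!: bexI[of _ "strand f a b"])
qed

end

subsection \<open>Strands at a vertex\<close>

definition right_below :: "(real \<Rightarrow> real) \<Rightarrow> (real \<Rightarrow> real) \<Rightarrow> real \<Rightarrow> bool" where
  "right_below f g x \<longleftrightarrow> (\<forall>\<^sub>F t in at_right x. f t < g t)"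

definition left_below :: "(real \<Rightarrow> real) \<Rightarrow> (real \<Rightarrow> real) \<Rightarrow> real \<Rightarrow> bool" where
  "left_below f g x \<longleftrightarrow> (\<forall>\<^sub>F t in at_left x. f t < g t)"

context pseudolines
begin

text \<open>Meets are isolated, so the difference keeps its sign on each side close to
  \<open>x\<close>. One radius serves both sides, and with it the failure of
  \<open>right_below\<close> or \<open>left_below\<close> becomes the strict opposite order.\<close>

lemma ex_sided_neighbourhood:
  assumes "f \<in> \<Phi>" "g \<in> \<Phi>" "f \<noteq> g"
  shows "\<exists>e>0. (\<forall>t. x < t \<longrightarrow> t < x + e \<longrightarrow> f t \<noteq> g t \<and> (f t < g t \<longleftrightarrow> right_below f g x)) \<and>
    (\<forall>t. x - e < t \<longrightarrow> t < x \<longrightarrow> f t \<noteq> g t \<and> (f t < g t \<longleftrightarrow> left_below f g x))"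
proof -
  obtain e where e: "e > 0" "\<And>t. t \<noteq> x \<Longrightarrow> dist t x < e \<Longrightarrow> f t \<noteq> g t"
    using meet_isolated[OF assms, of x] unfolding eventually_at by blast
  have ne: "f t \<noteq> g t" if "x - e < t" "t < x + e" "t \<noteq> x" for t
    using that e(2)[of t] by (auto simp: dist_real_def)
  have r: "f s < g s \<longleftrightarrow> f t < g t" if "s \<in> {x<..<x+e}" "t \<in> {x<..<x+e}" for s t
    using that assms ne e(1) by (intro sign_constant_between_meets[of x "x+e"])
      (auto simp: pseudoline_fun_continuous pfun)
  have l: "f s < g s \<longleftrightarrow> f t < g t" if "s \<in> {x-e<..<x}" "t \<in> {x-e<..<x}" for s t
    using that assms ne e(1) by (intro sign_constant_between_meets[of "x-e" x])
      (auto simp: pseudoline_fun_continuous pfun)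
  have "f t < g t \<longleftrightarrow> right_below f g x" if t: "x < t" "t < x + e" for t
  proof
    have ev: "\<forall>\<^sub>F s in at_right x. s \<in> {x<..<x+e}"
      using e(1) by (intro eventually_at_right_real) auto
    assume "f t < g t"
    then have "f s < g s" if "s \<in> {x<..<x+e}" for s using r[of s t] t that by auto
    then show "right_below f g x" unfolding right_below_def by (rule eventually_mono[OF ev])
  next
    have ev: "\<forall>\<^sub>F s in at_right x. s \<in> {x<..<x+e}"
      using e(1) by (intro eventually_at_right_real) auto
    assume "right_below f g x"
    then have "\<forall>\<^sub>F s in at_right x. s \<in> {x<..<x+e} \<and> f s < g s"
      unfolding right_below_def using ev by eventually_elim auto
    then obtain s where "s \<in> {x<..<x+e}" "f s < g s"
      using eventually_happens' trivial_limit_at_right_real by blast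
    then show "f t < g t" using r[of s t] t by auto
  qed
  moreover have "f t < g t \<longleftrightarrow> left_below f g x" if t: "x - e < t" "t < x" for t
  proof
    have ev: "\<forall>\<^sub>F s in at_left x. s \<in> {x-e<..<x}"
      using e(1) by (intro eventually_at_left_real) auto
    assume "f t < g t"
    then have "f s < g s" if "s \<in> {x-e<..<x}" for s using l[of s t] t that by auto
    then show "left_below f g x" unfolding left_below_def by (rule eventually_mono[OF ev])
  next
    have ev: "\<forall>\<^sub>F s in at_left x. s \<in> {x-e<..<x}"
      using e(1) by (intro eventually_at_left_real) auto
    assume "left_below f g x"
    then have "\<forall>\<^sub>F s in at_left x. s \<in> {x-e<..<x} \<and> f s < g s"
      unfolding left_below_def using ev by eventually_elim auto
    then obtain s where "s \<in> {x-e<..<x}" "f s < g s"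
      using eventually_happens' trivial_limit_at_left_real by blast
    then show "f t < g t" using l[of s t] t by auto
  qed
  ultimately show ?thesis using e(1) ne by (intro exI[of _ e]) auto
qed

lemma right_below_swap:
  assumes "f \<in> \<Phi>" "g \<in> \<Phi>" "f \<noteq> g"
  shows "right_below g f x \<longleftrightarrow> \<not> right_below f g x"
proof -
  obtain e where e: "e > 0" "\<forall>t. x < t \<longrightarrow> t < x + e \<longrightarrow> f t \<noteq> g t \<and> (f t < g t \<longleftrightarrow> right_below f g x)"
    using ex_sided_neighbourhood[OF assms] by blast
  obtain d where d: "d > 0" "\<forall>t. x < t \<longrightarrow> t < x + d \<longrightarrow> g t \<noteq> f t \<and> (g t < f t \<longleftrightarrow> right_below g f x)"
    using ex_sided_neighbourhood[OF assms(2,1) assms(3)[symmetric]] by blast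
  let ?t = "x + min d e / 2"
  have "x < ?t" "?t < x + e" "?t < x + d" using e d by auto
  then show ?thesis using e(2)[rule_format, of ?t] d(2)[rule_format, of ?t] by auto
qed

text \<open>The sign condition becomes a comparison of the two one-sided orders: they differ at a
  crossing and agree at a contact.\<close>

lemma crosses_iff:
  assumes "f \<in> \<Phi>" "g \<in> \<Phi>" "f \<noteq> g"
  shows "crosses f g x \<longleftrightarrow> f x = g x \<and> (left_below f g x \<longleftrightarrow> \<not> right_below f g x)"
proof -
  obtain e where e: "e > 0" "\<And>t. x < t \<Longrightarrow> t < x + e \<Longrightarrow> f t \<noteq> g t \<and> (f t < g t \<longleftrightarrow> right_below f g x)"
    "\<And>t. x - e < t \<Longrightarrow> t < x \<Longrightarrow> f t \<noteq> g t \<and> (f t < g t \<longleftrightarrow> left_below f g x)"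
    using ex_sided_neighbourhood[OF assms, of x] by auto
  show ?thesis
  proof (rule iffI)
    assume c: "crosses f g x"
    obtain d where d: "d > 0"
      "\<forall>s\<in>{x-d<..<x}. \<forall>t\<in>{x<..<x+d}. (f s - g s) * (f t - g t) < 0"
      using c unfolding crosses_def by blast
    let ?m = "min d e / 2"
    have m: "x - e < x - ?m" "x - ?m < x" "x < x + ?m" "x + ?m < x + e"
      "x - ?m \<in> {x-d<..<x}" "x + ?m \<in> {x<..<x+d}" using d(1) e(1) by auto
    have "left_below f g x \<longleftrightarrow> \<not> right_below f g x"
      using d(2)[rule_format, OF m(5,6)] e(3)[OF m(1,2)] e(2)[OF m(3,4)]
      by (auto simp: mult_less_0_iff)
    then show "f x = g x \<and> (left_below f g x \<longleftrightarrow> \<not> right_below f g x)"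
      using c by (simp add: crosses_def)
  next
    assume a: "f x = g x \<and> (left_below f g x \<longleftrightarrow> \<not> right_below f g x)"
    have "(f s - g s) * (f t - g t) < 0" if "s \<in> {x-e<..<x}" "t \<in> {x<..<x+e}" for s t
      using e(3)[of s] e(2)[of t] that a by (auto simp: mult_less_0_iff)
    then show "crosses f g x" unfolding crosses_def using a e(1) by blast
  qed
qed

text \<open>By simplicity every third function is separated from \<open>f\<close> at
  \<open>x\<close>, and by continuity it stays on its side nearby. Only \<open>g\<close>, which is
  not counted at \<open>x\<close> itself, can enter the count.\<close>

lemma lev_near_meet:
  assumes "f \<in> \<Phi>" "g \<in> \<Phi>" "f \<noteq> g" "f x = g x"
  shows "\<forall>\<^sub>F t in at x. lev \<Phi> f t = lev \<Phi> f x + of_bool (f t < g t)"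
proof -
  have "\<forall>\<^sub>F t in at x. \<forall>h\<in>\<Phi>-{f,g}. f t < h t \<longleftrightarrow> f x < h x"
  proof (intro eventually_ball_finite ballI)
    show "finite (\<Phi> - {f, g})" using finite by simp
    fix h assume h: "h \<in> \<Phi> - {f, g}"
    then have ne: "h x \<noteq> f x" using simple[of f g h x] assms by auto
    have "isCont (\<lambda>t. h t - f t) x"
      using h assms pfun by (intro continuous_diff pseudoline_fun_isCont) auto
    then have lim: "((\<lambda>t. h t - f t) \<longlongrightarrow> h x - f x) (at x)" by (simp add: isCont_def)
    show "\<forall>\<^sub>F t in at x. f t < h t \<longleftrightarrow> f x < h x"
    proof (cases "f x < h x")
      case True
      then have "\<forall>\<^sub>F t in at x. 0 < h t - f t" by (intro order_tendstoD[OF lim]) auto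
      then show ?thesis by eventually_elim (use True in auto)
    next
      case False
      then have "\<forall>\<^sub>F t in at x. h t - f t < 0" using ne by (intro order_tendstoD[OF lim]) auto
      then show ?thesis by eventually_elim (use False in auto)
    qed
  qed
  then show ?thesis
  proof eventually_elim
    fix t assume *: "\<forall>h\<in>\<Phi>-{f,g}. f t < h t \<longleftrightarrow> f x < h x"
    have "h \<in> {h\<in>\<Phi>. f t < h t} \<longleftrightarrow> h \<in> {h\<in>\<Phi>. f x < h x} \<union> (if f t < g t then {g} else {})" for h
      using * assms by (cases "h = f"; cases "h = g") auto
    then have "{h\<in>\<Phi>. f t < h t} = {h\<in>\<Phi>. f x < h x} \<union> (if f t < g t then {g} else {})"
      by blast
    moreover have "g \<notin> {h\<in>\<Phi>. f x < h x}" using assms by simp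
    ultimately show "lev \<Phi> f t = lev \<Phi> f x + of_bool (f t < g t)"
      using finite by (simp add: lev_def)
  qed
qed

lemma strand_lev_right:
  assumes "f \<in> \<Phi>" "g \<in> \<Phi>" "f \<noteq> g" "f x = g x" "consecutive \<Phi> f x b"
  shows "strand_lev \<Phi> f x b = lev \<Phi> f x + of_bool (right_below f g x)"
proof -
  obtain e where e: "e > 0" "\<forall>t. x < t \<longrightarrow> t < x + e \<longrightarrow> f t \<noteq> g t \<and> (f t < g t \<longleftrightarrow> right_below f g x)"
    using ex_sided_neighbourhood[OF assms(1-3)] by blast
  obtain d where d: "d > 0" "\<And>t. t \<noteq> x \<Longrightarrow> dist t x < d \<Longrightarrow> lev \<Phi> f t = lev \<Phi> f x + of_bool (f t < g t)"
    using lev_near_meet[OF assms(1-4)] unfolding eventually_at by blast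
  have "x < b" using assms(5) by (simp add: consecutive_def)
  define t where "t = x + min (min d e) (b - x) / 2"
  have "0 < min (min d e) (b - x)" using e d \<open>x < b\<close> by simp
  then have t: "x < t" "t < x + e" "t < x + d" "t < b" unfolding t_def by (auto simp: min_def field_simps split: if_splits)
  then show ?thesis
    using lev_constant[OF assms(1,5), of t] d(2)[of t] e(2) by (auto simp: dist_real_def)
qed

lemma strand_lev_left:
  assumes "f \<in> \<Phi>" "g \<in> \<Phi>" "f \<noteq> g" "f x = g x" "consecutive \<Phi> f a x"
  shows "strand_lev \<Phi> f a x = lev \<Phi> f x + of_bool (left_below f g x)"
proof -
  obtain e where e: "e > 0" "\<forall>t. x - e < t \<longrightarrow> t < x \<longrightarrow> f t \<noteq> g t \<and> (f t < g t \<longleftrightarrow> left_below f g x)"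
    using ex_sided_neighbourhood[OF assms(1-3)] by blast
  obtain d where d: "d > 0" "\<And>t. t \<noteq> x \<Longrightarrow> dist t x < d \<Longrightarrow> lev \<Phi> f t = lev \<Phi> f x + of_bool (f t < g t)"
    using lev_near_meet[OF assms(1-4)] unfolding eventually_at by blast
  have "a < x" using assms(5) by (simp add: consecutive_def)
  define t where "t = x - min (min d e) (x - a) / 2"
  have "0 < min (min d e) (x - a)" using e d \<open>a < x\<close> by simp
  then have t: "t < x" "x - e < t" "x - d < t" "a < t" unfolding t_def by (auto simp: min_def field_simps split: if_splits)
  then show ?thesis
    using lev_constant[OF assms(1,5), of t] d(2)[of t] e(2) by (auto simp: dist_real_def)
qed

text \<open>The symmetry of \<open>crosses\<close> carries \<open>right_below_swap\<close> over to
  the left side.\<close>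

lemma left_below_swap:
  assumes "f \<in> \<Phi>" "g \<in> \<Phi>" "f \<noteq> g" "f x = g x"
  shows "left_below g f x \<longleftrightarrow> \<not> left_below f g x"
  using assms crosses_iff[OF assms(1-3), of x] crosses_iff[OF assms(2,1) assms(3)[symmetric], of x]
    right_below_swap[OF assms(1-3), of x] crosses_sym[of f g x] by auto

lemma lev_eq_at_meet: "f x = g x \<Longrightarrow> lev \<Phi> f x = lev \<Phi> g x"
  by (simp add: lev_def)

lemma consecutive_shift:
  assumes "f \<in> \<Phi>" "consecutive \<Phi> f a b"
  shows "consecutive \<Phi> f (a + of_int k * pi) (b + of_int k * pi)"
  unfolding consecutive_def
proof (intro conjI allI impI notI)
  show "a + of_int k * pi \<in> meets \<Phi> f" "b + of_int k * pi \<in> meets \<Phi> f"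
    "a + of_int k * pi < b + of_int k * pi"
    using assms meets_shift by (auto simp: consecutive_def)
  fix x assume x: "a + of_int k * pi < x" "x < b + of_int k * pi" "x \<in> meets \<Phi> f"
  then have "x + of_int (-k) * pi \<in> meets \<Phi> f" using meets_shift assms(1) by blast
  then show False using x assms(2) by (auto simp: consecutive_def)
qed

end

context proper_pseudolines
begin

lemma cover_le_along:
  assumes f: "f \<in> \<Phi>" and "a \<in> meets \<Phi> f" "b \<in> meets \<Phi> f" "a \<le> b"
  shows "cover_le S (a, f a) (b, f b)"
  using assms(2-4)
proof (induction "card (meets \<Phi> f \<inter> {a<..b})" arbitrary: a rule: less_induct)
  case less
  show ?case
  proof (cases "a = b")
    case False
    obtain c where c: "consecutive \<Phi> f a c" using ex_consecutive_right[OF f less.prems(1)] by blast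
    have "a < b" using less.prems False by simp
    then have cb: "a < c" "c \<le> b" "c \<in> meets \<Phi> f"
      using c less.prems(2) unfolding consecutive_def by (blast, metis not_le, blast)
    have fin: "finite (meets \<Phi> f \<inter> {a<..b})"
      using finite_meets[OF f, of a b] by (rule finite_subset[rotated]) auto
    have "meets \<Phi> f \<inter> {c<..b} \<subset> meets \<Phi> f \<inter> {a<..b}" using cb by auto
    then have "card (meets \<Phi> f \<inter> {c<..b}) < card (meets \<Phi> f \<inter> {a<..b})"
      using fin by (simp add: psubset_card_mono)
    then have "cover_le S (c, f c) (b, f b)" using less.hyps cb less.prems by blast
    moreover have "((a, f a), (c, f c)) \<in> cover_arcs S" using c f by (auto simp: cover_arcs_eq)
    ultimately show ?thesis unfolding cover_le_def by (rule converse_rtrancl_into_rtrancl[rotated])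
  qed (simp add: cover_le_def)
qed

lemma cover_le_trans: "cover_le S u v \<Longrightarrow> cover_le S v w \<Longrightarrow> cover_le S u w"
  unfolding cover_le_def by (rule rtrancl_trans)

lemma cover_le_fst:
  assumes "cover_le S u v"
  shows "u = v \<or> fst u < fst v"
  using assms unfolding cover_le_def
  by (induction rule: rtrancl_induct) (auto simp: cover_arcs_eq consecutive_def)

lemma cover_le_vertices:
  assumes "cover_le S u v" "u \<in> vertices \<Phi>"
  shows "v \<in> vertices \<Phi>"
  using assms unfolding cover_le_def
  by (induction rule: rtrancl_induct) (auto simp: cover_arcs_eq consecutive_def vertices_def)

lemma vertex_obtain:
  assumes "v \<in> vertices \<Phi>"
  obtains f g x where "f \<in> \<Phi>" "g \<in> \<Phi>" "f \<noteq> g" "f x = g x" "v = (x, f x)" "x \<in> meets \<Phi> f" "x \<in> meets \<Phi> g"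
proof -
  obtain f g x where v: "f \<in> \<Phi>" "g \<in> \<Phi>" "g \<noteq> f" "g x = f x" "v = (x, f x)"
    using assms by (auto simp: vertices_def meets_def)
  then have "x \<in> meets \<Phi> f" "x \<in> meets \<Phi> g" unfolding meets_def by force+
  then show ?thesis using that[of f g x] v by simp
qed

text \<open>A function through \<open>v\<close> crosses \<open>f\<close> in every period, so
  following it in either direction leads to a vertex on \<open>f\<close>. Hence a filter, being
  nonempty and proper, contains a vertex of each function and misses another.\<close>

lemma vertex_reaches:
  assumes "v \<in> vertices \<Phi>" "f \<in> \<Phi>"
  shows "\<exists>b\<in>meets \<Phi> f. cover_le S v (b, f b)" "\<exists>a\<in>meets \<Phi> f. cover_le S (a, f a) v"
proof -
  obtain g x where g: "g \<in> \<Phi>" "v = (x, g x)" "x \<in> meets \<Phi> g"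
    using vertex_obtain[OF assms(1)] by metis
  have "(\<exists>b\<in>meets \<Phi> f. cover_le S v (b, f b)) \<and> (\<exists>a\<in>meets \<Phi> f. cover_le S (a, f a) v)"
  proof (cases "g = f")
    case True
    then show ?thesis using g unfolding cover_le_def by blast
  next
    case False
    obtain c where c: "crosses f g c" using ex_crosses False g assms(2) by blast
    have shift: "f (c + of_int k * pi) = g (c + of_int k * pi)" for k
      using crosses_shift[OF pfun pfun c] assms(2) g(1) by (auto simp: crosses_def)
    then have m: "c + of_int k * pi \<in> meets \<Phi> f" "c + of_int k * pi \<in> meets \<Phi> g" for k
      using False g(1) assms(2) unfolding meets_def by force+
    obtain k :: int where k: "x \<le> c + of_int k * pi" using shift_into_period by blast
    obtain l :: int where "c + of_int l * pi < x - pi + pi" using shift_into_period by blast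
    then have l: "c + of_int l * pi \<le> x" by simp
    have "cover_le S v (c + of_int k * pi, f (c + of_int k * pi))"
      using cover_le_along[OF g(1,3) m(2) k] g(2) shift by simp
    moreover have "cover_le S (c + of_int l * pi, f (c + of_int l * pi)) v"
      using cover_le_along[OF g(1) m(2) g(3) l] g(2) shift by simp
    ultimately show ?thesis using m by blast
  qed
  then show "\<exists>b\<in>meets \<Phi> f. cover_le S v (b, f b)" "\<exists>a\<in>meets \<Phi> f. cover_le S (a, f a) v" by auto
qed

end

subsection \<open>Filters and positions\<close>

definition cut_pair ::
    "(real \<Rightarrow> real) set \<Rightarrow> (real \<times> real) set \<Rightarrow> (real \<Rightarrow> real) \<Rightarrow> real \<Rightarrow> real \<Rightarrow> bool" where
  "cut_pair \<Phi> F f a b \<longleftrightarrow> consecutive \<Phi> f a b \<and> (a, f a) \<notin> F \<and> (b, f b) \<in> F"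

text \<open>The place, counted from the top, at which the cut passes through \<open>f\<close>. The
  description is unique because \<open>f\<close> has exactly one cut edge for a filter
  (\<open>ex_cut_pair\<close>, \<open>cut_pair_unique\<close>).\<close>

definition position :: "(real \<Rightarrow> real) set \<Rightarrow> (real \<times> real) set \<Rightarrow> (real \<Rightarrow> real) \<Rightarrow> nat" where
  "position \<Phi> F f = (THE k. \<exists>a b. cut_pair \<Phi> F f a b \<and> k = strand_lev \<Phi> f a b)"

context proper_pseudolines
begin

lemma filter_vertices: "vertex_filter S F \<Longrightarrow> F \<subseteq> vertices \<Phi>"
  by (auto simp: vertex_filter_def cover_vertices_eq)

lemma filter_up:
  assumes "vertex_filter S F" "u \<in> F" "cover_le S u v"
  shows "v \<in> F"
  using assms cover_le_vertices[OF assms(3)] filter_vertices[OF assms(1)]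
  unfolding vertex_filter_def cover_vertices_eq by blast

lemma filter_up_along:
  assumes "vertex_filter S F" "f \<in> \<Phi>" "a \<in> meets \<Phi> f" "b \<in> meets \<Phi> f" "a \<le> b" "(a, f a) \<in> F"
  shows "(b, f b) \<in> F"
  using filter_up cover_le_along assms by blast

lemma filter_ex_in:
  assumes "vertex_filter S F" "f \<in> \<Phi>"
  shows "\<exists>b\<in>meets \<Phi> f. (b, f b) \<in> F"
proof -
  obtain v where "v \<in> F" using assms(1) by (auto simp: vertex_filter_def)
  then show ?thesis using vertex_reaches(1) filter_vertices filter_up assms by blast
qed

lemma filter_ex_out:
  assumes "vertex_filter S F" "f \<in> \<Phi>"
  shows "\<exists>a\<in>meets \<Phi> f. (a, f a) \<notin> F"
proof -
  obtain v where "v \<in> vertices \<Phi>" "v \<notin> F"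
    using assms(1) by (auto simp: vertex_filter_def cover_vertices_eq)
  then show ?thesis using vertex_reaches(2) filter_up assms by blast
qed

lemma ex_cut_pair:
  assumes F: "vertex_filter S F" and f: "f \<in> \<Phi>"
  shows "\<exists>a b. cut_pair \<Phi> F f a b"
proof -
  obtain b0 where b0: "b0 \<in> meets \<Phi> f" "(b0, f b0) \<in> F" using filter_ex_in assms by blast
  obtain a0 where a0: "a0 \<in> meets \<Phi> f" "(a0, f a0) \<notin> F" using filter_ex_out assms by blast
  have ab0: "a0 < b0" using filter_up_along[OF F f b0(1) a0(1)] a0 b0 by force
  \<comment> \<open>The first vertex on \<open>f\<close> from \<open>a0\<close> onwards that belongs
    to the filter. Since \<open>a0\<close> is outside, the predecessor of this vertex is not before
    \<open>a0\<close>, hence it lies outside as well by minimality.\<close>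
  let ?X = "meets \<Phi> f \<inter> {a0..b0} \<inter> {x. (x, f x) \<in> F}"
  have "finite ?X" using finite_meets[OF f, of a0 b0] by blast
  moreover have "?X \<noteq> {}" using b0 ab0 by auto
  ultimately have M: "Min ?X \<in> ?X" "\<forall>t\<in>?X. Min ?X \<le> t" using Min_in Min_le by blast+
  then obtain a where a: "consecutive \<Phi> f a (Min ?X)" using ex_consecutive_left[OF f] by blast
  have "(a, f a) \<notin> F"
  proof
    assume aF: "(a, f a) \<in> F"
    have am: "a \<in> meets \<Phi> f" "a < Min ?X" using a by (auto simp: consecutive_def)
    have "a0 \<le> a" using filter_up_along[OF F f am(1) a0(1)] aF a0(2) by force
    then have "a \<in> ?X" using am aF M(1) by auto
    then show False using M(2) am(2) by force
  qed
  then show ?thesis using a M(1) unfolding cut_pair_def by blast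
qed

lemma cut_pair_unique:
  assumes "vertex_filter S F" "f \<in> \<Phi>" "cut_pair \<Phi> F f a b" "cut_pair \<Phi> F f c d"
  shows "a = c" "b = d"
proof -
  have m: "a \<in> meets \<Phi> f" "b \<in> meets \<Phi> f" "c \<in> meets \<Phi> f" "d \<in> meets \<Phi> f"
    using assms(3,4) by (auto simp: cut_pair_def consecutive_def)
  have "a < d" using filter_up_along[OF assms(1,2) m(4,1)] assms(3,4) by (force simp: cut_pair_def)
  moreover have "c < b"
    using filter_up_along[OF assms(1,2) m(2,3)] assms(3,4) by (force simp: cut_pair_def)
  ultimately show "a = c" "b = d"
    using consecutive_unique assms(3,4) unfolding cut_pair_def by blast+
qed

lemma position_eq:
  assumes "vertex_filter S F" "f \<in> \<Phi>" "cut_pair \<Phi> F f a b"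
  shows "position \<Phi> F f = strand_lev \<Phi> f a b"
  unfolding position_def using cut_pair_unique[OF assms(1,2)] assms(3) by (intro the_equality) blast+

lemma cut_edges_eq:
  assumes F: "vertex_filter S F"
  shows "cut_edges S F = {strand f a b | f a b. f \<in> \<Phi> \<and> cut_pair \<Phi> F f a b}"
proof -
  \<comment> \<open>A filter is closed to the right along \<open>f\<close>, so if exactly one end
    belongs to it, that is the right end.\<close>
  have key: "(\<exists>!z. z \<in> edge_ends S (strand f a b) \<and> z \<in> F) \<longleftrightarrow> cut_pair \<Phi> F f a b"
    if f: "f \<in> \<Phi>" and c: "consecutive \<Phi> f a b" for f a b
  proof -
    have "a < b" "a \<in> meets \<Phi> f" "b \<in> meets \<Phi> f" using c by (auto simp: consecutive_def)
    moreover from this have "(a, f a) \<in> F \<longrightarrow> (b, f b) \<in> F"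
      using filter_up_along[OF F f] by auto
    ultimately show ?thesis unfolding edge_ends_eq[OF f c] cut_pair_def using c by auto
  qed
  show ?thesis
  proof (intro set_eqI iffI)
    fix e assume "e \<in> cut_edges S F"
    then obtain f a b where "f \<in> \<Phi>" "consecutive \<Phi> f a b" "e = strand f a b"
      "\<exists>!z. z \<in> edge_ends S e \<and> z \<in> F"
      unfolding cut_edges_def cover_edges_eq by blast
    then show "e \<in> {strand f a b | f a b. f \<in> \<Phi> \<and> cut_pair \<Phi> F f a b}" using key[of f a b] by auto
  next
    fix e assume "e \<in> {strand f a b | f a b. f \<in> \<Phi> \<and> cut_pair \<Phi> F f a b}"
    then obtain f a b where e: "e = strand f a b" "f \<in> \<Phi>" "cut_pair \<Phi> F f a b" by blast
    then have c: "consecutive \<Phi> f a b" by (simp add: cut_pair_def)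
    then have "e \<in> cover_edges S" unfolding cover_edges_eq using e by blast
    then show "e \<in> cut_edges S F" unfolding cut_edges_def using key[OF e(2) c] e by simp
  qed
qed

text \<open>The two strands at a vertex occupy the same two adjacent levels on both sides. One of
  the outgoing edges therefore continues the level: the one on \<open>f\<close> at a contact, the
  one on the other function at a crossing.\<close>

lemma strand_continue:
  assumes f: "f \<in> \<Phi>" and c: "consecutive \<Phi> f a b"
  shows "\<exists>h\<in>\<Phi>. \<exists>c. consecutive \<Phi> h b c \<and> h b = f b \<and> strand_lev \<Phi> h b c = strand_lev \<Phi> f a b"
proof -
  obtain g where g: "g \<in> \<Phi>" "g \<noteq> f" "g b = f b" using c by (auto simp: consecutive_def meets_def)
  then have "b \<in> meets \<Phi> f" "b \<in> meets \<Phi> g" using f by (force simp: meets_def)+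
  then obtain d d' where d: "consecutive \<Phi> f b d" "consecutive \<Phi> g b d'"
    using ex_consecutive_right f g by blast
  have "strand_lev \<Phi> f a b = lev \<Phi> f b + of_bool (left_below f g b)"
    using strand_lev_left[OF f g(1) _ _ c] g by auto
  moreover have "strand_lev \<Phi> f b d = lev \<Phi> f b + of_bool (right_below f g b)"
    using strand_lev_right[OF f g(1) _ _ d(1)] g by auto
  moreover have "strand_lev \<Phi> g b d' = lev \<Phi> f b + of_bool (\<not> right_below f g b)"
    using strand_lev_right[OF g(1) f _ _ d(2)] g right_below_swap[OF f g(1)] lev_eq_at_meet[of f b g]
    by auto
  ultimately show ?thesis using f g d by (cases "left_below f g b = right_below f g b") auto
qed

text \<open>The path from one vertex to the other follows the level, which is a curve.\<close>

lemma cover_le_same_level: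
  assumes f': "f' \<in> \<Phi>" "consecutive \<Phi> f' a' b'"
    and "f \<in> \<Phi>" "consecutive \<Phi> f a b" "strand_lev \<Phi> f a b = strand_lev \<Phi> f' a' b'" "b \<le> a'"
  shows "cover_le S (b, f b) (a', f' a')"
  using assms(3-)
\<comment> \<open>The measure counts the abscissae of vertices in \<open>{b<..a'}\<close>; the set
  in front is there for finiteness. It decreases because the end \<open>c\<close> of the next edge
  is itself such an abscissa.\<close>
proof (induction "card ((\<Union>h\<in>\<Phi>. meets \<Phi> h \<inter> {b..a'}) \<inter> {b<..a'})" arbitrary: f a b rule: less_induct)
  case less
  obtain h c where h: "h \<in> \<Phi>" "consecutive \<Phi> h b c" "h b = f b" "strand_lev \<Phi> h b c = strand_lev \<Phi> f' a' b'"
    using strand_continue[OF less.prems(1,2)] less.prems(3) by auto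
  then have bc: "b < c" "b \<in> meets \<Phi> h" "c \<in> meets \<Phi> h" by (auto simp: consecutive_def)
  have ab': "a' < b'" "a' \<in> meets \<Phi> f'" using f'(2) by (auto simp: consecutive_def)
  show ?case
  proof (cases "c \<le> a'")
    case True
    have "finite (\<Union>h\<in>\<Phi>. meets \<Phi> h \<inter> {b..a'})"
      using finite finite_meets by (intro finite_UN_I) auto
    moreover have "(\<Union>h\<in>\<Phi>. meets \<Phi> h \<inter> {c..a'}) \<inter> {c<..a'} \<subset>
        (\<Union>h\<in>\<Phi>. meets \<Phi> h \<inter> {b..a'}) \<inter> {b<..a'}"
    proof (rule psubsetI)
      have "c \<in> (\<Union>h\<in>\<Phi>. meets \<Phi> h \<inter> {b..a'}) \<inter> {b<..a'}" using bc h(1) True by auto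
      then show "(\<Union>h\<in>\<Phi>. meets \<Phi> h \<inter> {c..a'}) \<inter> {c<..a'} \<noteq>
          (\<Union>h\<in>\<Phi>. meets \<Phi> h \<inter> {b..a'}) \<inter> {b<..a'}" by auto
    qed (use bc in auto)
    ultimately have "cover_le S (c, h c) (a', f' a')"
      using less.hyps[OF psubset_card_mono h(1,2,4) True] by blast
    moreover have "cover_le S (b, f b) (c, h c)"
      using cover_le_along[OF h(1) bc(2,3)] bc(1) h(3) by simp
    ultimately show ?thesis using cover_le_trans by blast
  next
    case False
    \<comment> \<open>The edge from \<open>b\<close> now extends beyond \<open>a'\<close> and thus
      overlaps the target edge. Equal levels over a common abscissa put both edges on one function,
      which has no vertex strictly between \<open>b\<close> and \<open>c\<close>, so
      \<open>a'\<close> must be \<open>b\<close>.\<close>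
    define t where "t = (a' + min c b') / 2"
    have t: "a' < t" "t < c" "t < b'" "b < t" using False ab' less.prems(4) bc by (auto simp: t_def min_def)
    have "lev \<Phi> h t = lev \<Phi> f' t"
      using lev_constant[OF h(1,2), of t] lev_constant[OF f', of t] h(4) t by auto
    then have "h t = f' t"
      using lev_less[OF h(1) f'(1), of t] lev_less[OF f'(1) h(1), of t] by (metis less_irrefl linorder_less_linear)
    then have "h = f'" using h(1,2) f'(1) t unfolding consecutive_def meets_def by force
    then have "a' = b" using h(2) ab' less.prems(4) False unfolding consecutive_def by force
    then show ?thesis using h(3) \<open>h = f'\<close> by (simp add: cover_le_def)
  qed
qed

text \<open>If one of two cut edges of equal level lay entirely to the left of the other, the path
  along the level would lead from its right end, inside the filter, to the left end of the other,
  outside it. So the edges overlap in abscissa, and equal levels force equal functions.\<close>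

lemma inj_on_position:
  assumes F: "vertex_filter S F"
  shows "inj_on (position \<Phi> F) \<Phi>"
proof (rule inj_onI)
  fix f g assume fg: "f \<in> \<Phi>" "g \<in> \<Phi>" "position \<Phi> F f = position \<Phi> F g"
  obtain a b where ab: "cut_pair \<Phi> F f a b" using ex_cut_pair F fg by blast
  obtain c d where cd: "cut_pair \<Phi> F g c d" using ex_cut_pair F fg by blast
  have lev: "strand_lev \<Phi> f a b = strand_lev \<Phi> g c d" using position_eq F fg ab cd by metis
  have cons: "consecutive \<Phi> f a b" "consecutive \<Phi> g c d" and mem: "(b, f b) \<in> F" "(a, f a) \<notin> F" "(d, g d) \<in> F" "(c, g c) \<notin> F"
    using ab cd by (auto simp: cut_pair_def)
  have "\<not> b \<le> c" using cover_le_same_level[OF fg(2) cons(2) fg(1) cons(1) lev] filter_up F mem by blast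
  moreover have "\<not> d \<le> a"
    using cover_le_same_level[OF fg(1) cons(1) fg(2) cons(2) lev[symmetric]] filter_up F mem by blast
  moreover have "a < b" "c < d" using cons by (auto simp: consecutive_def)
  ultimately obtain t where t: "t \<in> {a<..<b}" "t \<in> {c<..<d}"
    using dense[of "max a c" "min b d"] by auto
  have "lev \<Phi> f t = lev \<Phi> g t" using lev_constant fg cons t lev by metis
  then have "f t = g t"
    using lev_less[OF fg(1,2), of t] lev_less[OF fg(2,1), of t] by (metis less_irrefl linorder_less_linear)
  then show "f = g" using cons(1) fg t unfolding consecutive_def meets_def by force
qed

lemma bij_betw_position:
  assumes F: "vertex_filter S F"
  shows "bij_betw (position \<Phi> F) \<Phi> {1..card \<Phi>}"
proof -
  have "position \<Phi> F f \<in> {1..card \<Phi>}" if f: "f \<in> \<Phi>" for f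
  proof -
    obtain a b where "cut_pair \<Phi> F f a b" using ex_cut_pair F f by blast
    then show ?thesis using position_eq[OF F f] lev_le[OF f] by (auto simp: strand_lev_def lev_def)
  qed
  then have "position \<Phi> F ` \<Phi> \<subseteq> {1..card \<Phi>}" by blast
  moreover have "card (position \<Phi> F ` \<Phi>) = card {1..card \<Phi>}"
    using inj_on_position[OF F] by (simp add: card_image)
  ultimately have "position \<Phi> F ` \<Phi> = {1..card \<Phi>}" by (intro card_subset_eq) auto
  then show ?thesis using inj_on_position[OF F] by (simp add: bij_betw_def)
qed

lemma cut_edge_eq:
  assumes F: "vertex_filter S F" and f: "f \<in> \<Phi>" and ab: "cut_pair \<Phi> F f a b"
  shows "cut_edge S F (position \<Phi> F f) = strand f a b"
  unfolding cut_edge_def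
proof (rule the_equality)
  show "strand f a b \<in> cut_edges S F \<and> edge_level S (strand f a b) = position \<Phi> F f"
    using cut_edges_eq[OF F] position_eq[OF assms] edge_level_eq[OF f, of a b] f ab
    unfolding cut_pair_def by auto
  fix e assume e: "e \<in> cut_edges S F \<and> edge_level S e = position \<Phi> F f"
  then obtain g c d where g: "g \<in> \<Phi>" "cut_pair \<Phi> F g c d" "e = strand g c d"
    using cut_edges_eq[OF F] by auto
  then have "position \<Phi> F g = position \<Phi> F f"
    using e position_eq[OF F g(1,2)] edge_level_eq[OF g(1), of c d] by (auto simp: cut_pair_def)
  then have "g = f" using inj_on_position[OF F] g f by (auto dest: inj_onD)
  then show "e = strand f a b" using cut_pair_unique[OF F f ab] g by auto
qed

text \<open>The enlarged set being a filter puts the right neighbour of the new vertex into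
  \<open>F\<close>; \<open>F\<close> being a filter keeps the left neighbour out. Adding a vertex
  thus moves the cut on \<open>f\<close> from the edge on its right to the edge on its left.\<close>

lemma cut_pair_step:
  assumes F: "vertex_filter S F" and F': "vertex_filter S (insert (x, f x) F)" and z: "(x, f x) \<notin> F"
    and f: "f \<in> \<Phi>" and x: "x \<in> meets \<Phi> f"
  shows "consecutive \<Phi> f x b \<Longrightarrow> cut_pair \<Phi> F f x b"
    and "consecutive \<Phi> f a x \<Longrightarrow> cut_pair \<Phi> (insert (x, f x) F) f a x"
proof -
  assume b: "consecutive \<Phi> f x b"
  then have "x < b" "b \<in> meets \<Phi> f" by (auto simp: consecutive_def)
  then have "(b, f b) \<in> insert (x, f x) F" using filter_up_along[OF F' f x, of b] by simp
  then show "cut_pair \<Phi> F f x b" using b z \<open>x < b\<close> by (auto simp: cut_pair_def)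
next
  assume a: "consecutive \<Phi> f a x"
  then have "a < x" "a \<in> meets \<Phi> f" by (auto simp: consecutive_def)
  then have "(a, f a) \<notin> F" using filter_up_along[OF F f _ x] z by force
  then show "cut_pair \<Phi> (insert (x, f x) F) f a x" using a \<open>a < x\<close> by (auto simp: cut_pair_def)
qed

lemma position_step:
  assumes F: "vertex_filter S F" and F': "vertex_filter S (insert (x, f x) F)" and z: "(x, f x) \<notin> F"
    and fg: "f \<in> \<Phi>" "g \<in> \<Phi>" "f \<noteq> g" "f x = g x"
  shows "position \<Phi> F f = lev \<Phi> f x + of_bool (right_below f g x)"
    and "position \<Phi> (insert (x, f x) F) f = lev \<Phi> f x + of_bool (left_below f g x)"
proof -
  have x: "x \<in> meets \<Phi> f" using fg by (force simp: meets_def)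
  obtain a b where "consecutive \<Phi> f a x" "consecutive \<Phi> f x b"
    using ex_consecutive_left ex_consecutive_right x fg(1) by blast
  then show "position \<Phi> F f = lev \<Phi> f x + of_bool (right_below f g x)"
    "position \<Phi> (insert (x, f x) F) f = lev \<Phi> f x + of_bool (left_below f g x)"
    using position_eq[OF F fg(1) cut_pair_step(1)[OF F F' z fg(1) x]]
      position_eq[OF F' fg(1) cut_pair_step(2)[OF F F' z fg(1) x]]
      strand_lev_left[OF fg] strand_lev_right[OF fg] by metis+
qed

lemma position_step_other:
  assumes F: "vertex_filter S F" and F': "vertex_filter S (insert (x, y) F)"
    and h: "h \<in> \<Phi>" "h x \<noteq> y"
  shows "position \<Phi> (insert (x, y) F) h = position \<Phi> F h"
proof -
  obtain a b where ab: "cut_pair \<Phi> F h a b" using ex_cut_pair F h by blast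
  then have "cut_pair \<Phi> (insert (x, y) F) h a b" using h(2) by (auto simp: cut_pair_def)
  then show ?thesis using position_eq[OF F h(1)] position_eq[OF F' h(1)] ab by metis
qed

section \<open>The fundamental domain between a filter and its translate\<close>

lemma tau_graph: "f \<in> \<Phi> \<Longrightarrow> tau (x, f x) = (x + pi, f (x + pi))"
  using pseudoline_fun_shift[OF pfun, of f x 1] by (simp add: tau_def)

lemma mem_tau_image:
  assumes "f \<in> \<Phi>"
  shows "(x, f x) \<in> tau ` F \<longleftrightarrow> (x - pi, f (x - pi)) \<in> F"
proof -
  have *: "tau (x - pi, f (x - pi)) = (x, f x)" using tau_graph[OF assms, of "x - pi"] by simp
  have "p = (x - pi, f (x - pi))" if "tau p = (x, f x)" for p
    using that * by (auto simp: tau_def prod_eq_iff)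
  then show ?thesis using * by (metis image_iff)
qed

lemma meets_shift_pi:
  assumes "f \<in> \<Phi>" "x \<in> meets \<Phi> f"
  shows "x + pi \<in> meets \<Phi> f" "x - pi \<in> meets \<Phi> f"
  using meets_shift[OF assms, of 1] meets_shift[OF assms, of "-1"] by auto

lemma tau_image_subset:
  assumes F: "vertex_filter S F"
  shows "tau ` F \<subseteq> F"
proof
  fix v assume "v \<in> tau ` F"
  then obtain u where u: "u \<in> F" "v = tau u" by blast
  obtain f x where f: "f \<in> \<Phi>" "u = (x, f x)" "x \<in> meets \<Phi> f"
    using u(1) filter_vertices[OF F] by (auto simp: vertices_def)
  then have "(x + pi, f (x + pi)) \<in> F"
    using filter_up_along[OF F f(1), of x "x + pi"] u(1) meets_shift_pi by auto
  then show "v \<in> F" using u(2) f tau_graph by simp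
qed

lemma tau_image_up:
  assumes F: "vertex_filter S F" and "u \<in> tau ` F" "cover_le S u v"
  shows "v \<in> tau ` F"
  using assms(3,2) unfolding cover_le_def
proof (induction rule: rtrancl_induct)
  case (step y z)
  then obtain f a b where f: "f \<in> \<Phi>" "consecutive \<Phi> f a b" "y = (a, f a)" "z = (b, f b)"
    by (auto simp: cover_arcs_eq)
  then have "a \<in> meets \<Phi> f" "b \<in> meets \<Phi> f" "a < b" by (auto simp: consecutive_def)
  moreover have "(a - pi, f (a - pi)) \<in> F" using step f mem_tau_image by simp
  ultimately have "(b - pi, f (b - pi)) \<in> F"
    using filter_up_along[OF F f(1), of "a - pi" "b - pi"] meets_shift_pi f(1) by auto
  then show ?case using f mem_tau_image by simp
qed

lemma mproj_shift:
  assumes "f \<in> \<Phi>"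
  shows "mproj (x + of_int k * pi, f (x + of_int k * pi)) = mproj (x, f x)"
  using mproj_eq_graph_iff[OF pfun[OF assms], of x "(x + of_int k * pi, f (x + of_int k * pi))"] by auto

lemma translate_mem_tau_image:
  assumes F: "vertex_filter S F" and f: "f \<in> \<Phi>" "x \<in> meets \<Phi> f" "(x, f x) \<in> F" and k: "(k::int) \<ge> 1"
  shows "(x + of_int k * pi, f (x + of_int k * pi)) \<in> tau ` F"
proof -
  have "x + of_int (k - 1) * pi \<in> meets \<Phi> f" using meets_shift f by blast
  moreover have "x \<le> x + of_int (k - 1) * pi" using k by simp
  ultimately have "(x + of_int (k - 1) * pi, f (x + of_int (k - 1) * pi)) \<in> F"
    using filter_up_along[OF F f(1,2) _ _ f(3)] by blast
  moreover have "x + of_int k * pi - pi = x + of_int (k - 1) * pi" by (simp add: algebra_simps)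
  ultimately show ?thesis unfolding mem_tau_image[OF f(1)] by (simp only:)
qed

text \<open>Of two distinct lifts on one orbit the right one is a positive translate of the other,
  so it belongs to the translated filter and is excluded.\<close>

lemma fundamental_domain_unique:
  assumes F: "vertex_filter S F" and u: "u \<in> F - tau ` F" and v: "v \<in> F - tau ` F"
    and eq: "mproj u = mproj v"
  shows "u = v"
proof -
  obtain f x where f: "f \<in> \<Phi>" "u = (x, f x)" "x \<in> meets \<Phi> f"
    using u filter_vertices[OF F] by (auto simp: vertices_def)
  then obtain k :: int where k: "v = (x + of_int k * pi, f (x + of_int k * pi))"
    using mproj_eq_graph_iff[OF pfun] eq by blast
  let ?y = "x + of_int k * pi"
  have y: "?y \<in> meets \<Phi> f" using meets_shift f by blast
  have x: "x = ?y + of_int (- k) * pi" by simp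
  consider "k \<ge> 1" | "- k \<ge> 1" | "k = 0" by linarith
  then show ?thesis
  proof cases
    case 1
    then show ?thesis using translate_mem_tau_image[OF F f(1,3) _ 1] u v f k by auto
  next
    case 2
    have "u \<in> tau ` F"
      using translate_mem_tau_image[OF F f(1) y _ 2] v f(2) k x by simp
    then show ?thesis using u by blast
  qed (use f k in auto)
qed

lemma fundamental_domain_ex:
  assumes F: "vertex_filter S F" and v: "v \<in> vertices \<Phi>"
  shows "\<exists>z\<in>F - tau ` F. mproj z = mproj v"
proof -
  obtain f x where f: "f \<in> \<Phi>" "v = (x, f x)" "x \<in> meets \<Phi> f"
    using v by (auto simp: vertices_def)
  let ?y = "\<lambda>k::int. x + of_int k * pi"
  let ?P = "\<lambda>k. (?y k, f (?y k)) \<in> F"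
  have m: "?y k \<in> meets \<Phi> f" for k using meets_shift f by blast
  have up: "?P l" if "?P k" "k \<le> l" for k l
    using filter_up_along[OF F f(1) m m, of k l] that by simp
  obtain b where b: "b \<in> meets \<Phi> f" "(b, f b) \<in> F" using filter_ex_in F f by blast
  obtain k1 where "b \<le> ?y k1" using shift_into_period by blast
  then have k1: "?P k1" using filter_up_along[OF F f(1) b(1) m _ b(2)] by blast
  obtain a where a: "a \<in> meets \<Phi> f" "(a, f a) \<notin> F" using filter_ex_out F f by blast
  obtain k0 where "?y k0 < a - pi + pi" using shift_into_period by blast
  then have k0: "\<not> ?P k0" using filter_up_along[OF F f(1) m a(1), of k0] a(2) by auto
  \<comment> \<open>The indices of translates inside the filter form an up-closed set that is
    neither empty nor everything, so there is a first one.\<close>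
  have "\<exists>k. ?P k \<and> \<not> ?P (k - 1)"
  proof (rule ccontr)
    assume no: "\<not> ?thesis"
    have "?P k0" if "k0 \<le> k1" using that
      by (induction k0 rule: int_le_induct) (use k1 no in auto)
    then show False using k0 up[OF k1, of k0] by linarith
  qed
  then obtain k where k: "?P k" "\<not> ?P (k - 1)" by blast
  have "?y k - pi = ?y (k - 1)" by (simp add: algebra_simps)
  then have "(?y k, f (?y k)) \<notin> tau ` F" using k(2) unfolding mem_tau_image[OF f(1)] by (simp only: not_False_eq_True)
  moreover have "mproj (?y k, f (?y k)) = mproj v" using mproj_shift f by simp
  ultimately show ?thesis using k(1) by blast
qed

lemma cut_lift_mproj:
  assumes F: "vertex_filter S F" and "z \<in> F - tau ` F"
  shows "cut_lift F (mproj z) = z"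
  unfolding cut_lift_def using assms fundamental_domain_unique[OF F] by (intro the_equality) auto

lemma cut_lift_mem:
  assumes F: "vertex_filter S F" and "p \<in> mproj ` vertices \<Phi>"
  shows "cut_lift F p \<in> F - tau ` F" "mproj (cut_lift F p) = p"
proof -
  obtain z where z: "z \<in> F - tau ` F" "mproj z = p"
    using fundamental_domain_ex[OF F] assms(2) by blast
  then have "cut_lift F p = z" using cut_lift_mproj[OF F z(1)] by simp
  then show "cut_lift F p \<in> F - tau ` F" "mproj (cut_lift F p) = p" using z by blast+
qed

lemma bij_betw_mproj_fundamental_domain:
  assumes F: "vertex_filter S F"
  shows "bij_betw mproj (F - tau ` F) (mproj ` vertices \<Phi>)"
  unfolding bij_betw_def
proof
  show "inj_on mproj (F - tau ` F)" using fundamental_domain_unique[OF F] by (intro inj_onI) auto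
  show "mproj ` (F - tau ` F) = mproj ` vertices \<Phi>"
  proof (intro equalityI subsetI)
    fix p assume "p \<in> mproj ` vertices \<Phi>"
    then show "p \<in> mproj ` (F - tau ` F)" using cut_lift_mem[OF F] by (metis image_eqI)
  qed (use filter_vertices[OF F] in blast)
qed

lemma finite_mproj_vertices: "finite (mproj ` vertices \<Phi>)"
proof -
  have "mproj ` vertices \<Phi> \<subseteq> (\<Union>f\<in>\<Phi>. (\<lambda>x. mproj (x, f x)) ` (meets \<Phi> f \<inter> {0..0+pi}))"
  proof
    fix p assume "p \<in> mproj ` vertices \<Phi>"
    then obtain f x where f: "f \<in> \<Phi>" "x \<in> meets \<Phi> f" "p = mproj (x, f x)"
      by (auto simp: vertices_def)
    obtain k :: int where k: "0 \<le> x + of_int k * pi" "x + of_int k * pi < 0 + pi"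
      using shift_into_period by blast
    have "p = mproj (x + of_int k * pi, f (x + of_int k * pi))"
      using mproj_shift f by simp
    moreover have "x + of_int k * pi \<in> meets \<Phi> f" using meets_shift f by blast
    ultimately show "p \<in> (\<Union>f\<in>\<Phi>. (\<lambda>x. mproj (x, f x)) ` (meets \<Phi> f \<inter> {0..0+pi}))"
      using f(1) k by (intro UN_I[of f] image_eqI[of _ _ "x + of_int k * pi"]) auto
  qed
  moreover have "finite (\<Union>f\<in>\<Phi>. (\<lambda>x. mproj (x, f x)) ` (meets \<Phi> f \<inter> {0..0+pi}))"
    using finite finite_meets by (intro finite_UN_I finite_imageI) auto
  ultimately show ?thesis by (rule finite_subset)
qed

lemma ex_sweep:
  assumes F: "vertex_filter S F"
  shows "\<exists>Fs z. sweep S F (card (mproj ` vertices \<Phi>)) Fs z"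
proof -
  let ?D = "F - tau ` F" and ?m = "card (mproj ` vertices \<Phi>)"
  have D: "finite ?D" "card ?D = ?m"
    using bij_betw_mproj_fundamental_domain[OF F] finite_mproj_vertices
    by (auto simp: bij_betw_finite bij_betw_same_card)
  obtain xs where xs: "set xs = ?D" "distinct xs" using finite_distinct_list[OF D(1)] by blast
  \<comment> \<open>Decreasing abscissa: oriented paths increase the abscissa, so everything above a
    vertex is added before it. Vertices with equal abscissa are incomparable and may come in any
    order.\<close>
  define ys where "ys = sort_key (\<lambda>v. - fst v) xs"
  have ys: "set ys = ?D" "distinct ys" "sorted (map (\<lambda>v. - fst v) ys)"
    using xs by (auto simp: ys_def)
  have len: "length ys = ?m" using ys D(2) distinct_card by fastforce
  define Fs where "Fs i = tau ` F \<union> set (take i ys)" for i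
  have sub: "Fs i \<subseteq> F" for i
    using tau_image_subset[OF F] ys(1) set_take_subset[of i ys] by (auto simp: Fs_def)
  have "vertex_filter S (Fs i)" for i
    unfolding vertex_filter_def
  proof (intro conjI ballI impI)
    show "Fs i \<noteq> {}" using F by (auto simp: Fs_def vertex_filter_def)
    show "Fs i \<subset> cover_vertices S"
      using F sub[of i] unfolding vertex_filter_def by (metis subset_psubset_trans)
    fix u v assume uv: "u \<in> Fs i" "cover_le S u v"
    show "v \<in> Fs i"
    proof (cases "u \<in> tau ` F")
      case True
      then show ?thesis using tau_image_up[OF F _ uv(2)] by (auto simp: Fs_def)
    next
      case False
      then obtain j where j: "j < i" "j < length ys" "u = ys ! j"
        using uv(1) by (auto simp: Fs_def in_set_conv_nth)
      have "v \<in> F" using filter_up[OF F _ uv(2)] sub uv(1) by blast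
      show ?thesis
      proof (cases "v \<in> tau ` F")
        case False
        then obtain l where l: "l < length ys" "v = ys ! l"
          using \<open>v \<in> F\<close> ys(1) by (metis DiffI in_set_conv_nth)
        have "l < i"
        proof (rule ccontr)
          assume "\<not> l < i"
          then have "fst v \<le> fst u"
            using sorted_nth_mono[OF ys(3), of j l] j l by simp
          then have "u = v" using cover_le_fst[OF uv(2)] by auto
          then have "j = l" using ys(2) j l by (metis nth_eq_iff_index_eq)
          then show False using j \<open>\<not> l < i\<close> by simp
        qed
        then show ?thesis using l by (auto simp: Fs_def in_set_conv_nth intro!: exI[of _ l])
      qed (simp add: Fs_def)
    qed
  qed
  moreover have "Fs i \<subset> Fs (Suc i) \<and> Fs (Suc i) - Fs i = {ys ! i}" if "i < ?m" for i
  proof -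
    have i: "i < length ys" using that len by simp
    then have 1: "Fs (Suc i) = insert (ys ! i) (Fs i)" by (simp add: Fs_def take_Suc_conv_app_nth)
    have "ys ! i \<notin> set (take i ys)"
      using ys(2) i by (auto simp: in_set_conv_nth nth_eq_iff_index_eq)
    moreover have "ys ! i \<notin> tau ` F" using ys(1) i by (metis DiffD2 nth_mem)
    ultimately have 2: "ys ! i \<notin> Fs i" by (simp add: Fs_def)
    then show ?thesis using 1 by auto
  qed
  moreover have "Fs ?m = F" using ys(1) len tau_image_subset[OF F] by (auto simp: Fs_def)
  moreover have "Fs 0 = tau ` F" by (simp add: Fs_def)
  ultimately have "sweep S F ?m Fs (\<lambda>i. ys ! i)" unfolding sweep_def by blast
  then show ?thesis by blast
qed

section \<open>Permutations of a sweep in terms of positions\<close>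

lemma mproj_strand_subset:
  assumes f: "f \<in> \<Phi>" "consecutive \<Phi> f a b" and h: "h \<in> \<Phi>"
  shows "mproj ` strand f a b \<subseteq> pseudoline_of h \<longleftrightarrow> h = f"
proof
  assume sub: "mproj ` strand f a b \<subseteq> pseudoline_of h"
  obtain t where t: "a < t" "t < b" using f(2) dense unfolding consecutive_def by blast
  then have "mproj (t, f t) \<in> pseudoline_of h" using sub by (auto simp: strand_def)
  then have "f t = h t" using mproj_mem_pseudoline_of[OF pfun[OF h]] by simp
  then show "h = f" using f t h unfolding consecutive_def meets_def by force
qed (auto simp: strand_def pseudoline_of_def)

lemma mproj_cut_edge_subset:
  assumes "vertex_filter S F" "f \<in> \<Phi>" "h \<in> \<Phi>"
  shows "mproj ` cut_edge S F (position \<Phi> F f) \<subseteq> pseudoline_of h \<longleftrightarrow> h = f"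
proof -
  obtain a b where ab: "cut_pair \<Phi> F f a b" using ex_cut_pair assms by blast
  then have "consecutive \<Phi> f a b" by (simp add: cut_pair_def)
  then show ?thesis using mproj_strand_subset[OF assms(2) _ assms(3)] cut_edge_eq[OF assms(1,2) ab] by simp
qed

lemma pseudoline_at_position:
  assumes "vertex_filter S F" "f \<in> \<Phi>"
  shows "pseudoline_at S (pseudoline_of ` \<Phi>) F (position \<Phi> F f) = pseudoline_of f"
  unfolding pseudoline_at_def using mproj_cut_edge_subset[OF assms] assms(2)
  by (intro the_equality) auto

lemma position_range:
  assumes "vertex_filter S F" "f \<in> \<Phi>"
  shows "position \<Phi> F f \<in> {1..card \<Phi>}"
  using bij_betw_position[OF assms(1)] assms(2) by (auto simp: bij_betw_def)

text \<open>The pseudoline of index \<open>k\<close> starts at position \<open>n + 1 - k\<close>, so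
  its index is the reversal of its initial position. From here on every permutation is computed from
  positions of functions.\<close>

lemma sweep_perm_position:
  assumes F0: "vertex_filter S (Fs 0)" and Fi: "vertex_filter S (Fs i)" and f: "f \<in> \<Phi>"
  shows "sweep_perm (card \<Phi>) S (pseudoline_of ` \<Phi>) Fs i (position \<Phi> (Fs i) f) =
    card \<Phi> + 1 - position \<Phi> (Fs 0) f"
  unfolding sweep_perm_def
proof (rule the_equality)
  have idx: "indexed_pseudoline (card \<Phi>) S (pseudoline_of ` \<Phi>) Fs (card \<Phi> + 1 - position \<Phi> (Fs 0) h) =
      pseudoline_of h" if "h \<in> \<Phi>" for h
    using position_range[OF F0 that] pseudoline_at_position[OF F0 that]
    by (simp add: indexed_pseudoline_def)
  show "card \<Phi> + 1 - position \<Phi> (Fs 0) f \<in> {1..card \<Phi>} \<and>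
      mproj ` cut_edge S (Fs i) (position \<Phi> (Fs i) f)
        \<subseteq> indexed_pseudoline (card \<Phi>) S (pseudoline_of ` \<Phi>) Fs (card \<Phi> + 1 - position \<Phi> (Fs 0) f)"
    using idx[OF f] position_range[OF F0 f] mproj_cut_edge_subset[OF Fi f f] by auto
  fix k assume k: "k \<in> {1..card \<Phi>} \<and> mproj ` cut_edge S (Fs i) (position \<Phi> (Fs i) f)
      \<subseteq> indexed_pseudoline (card \<Phi>) S (pseudoline_of ` \<Phi>) Fs k"
  then have "card \<Phi> + 1 - k \<in> {1..card \<Phi>}" by auto
  then obtain h where h: "h \<in> \<Phi>" "position \<Phi> (Fs 0) h = card \<Phi> + 1 - k"
    using bij_betw_position[OF F0] unfolding bij_betw_def by (metis imageE)
  then have "k = card \<Phi> + 1 - position \<Phi> (Fs 0) h" using k by auto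
  moreover from this have "h = f" using k idx[OF h(1)] mproj_cut_edge_subset[OF Fi f h(1)] by simp
  ultimately show "k = card \<Phi> + 1 - position \<Phi> (Fs 0) f" by simp
qed

text \<open>Before the step the cut passes just to the right of the vertex, so \<open>f\<close> is
  chosen as the upper of the two strands on that side.\<close>

lemma sweep_index_eq:
  assumes F: "vertex_filter S (Fs i)" and F': "vertex_filter S (insert (z i) (Fs i))" and z: "z i \<notin> Fs i"
    and fg: "f \<in> \<Phi>" "g \<in> \<Phi>" "f \<noteq> g" "f x = g x" "z i = (x, f x)" and above: "\<not> right_below f g x"
  shows "sweep_index (card \<Phi>) S Fs z i = position \<Phi> (Fs i) f"
    and "position \<Phi> (Fs i) g = Suc (position \<Phi> (Fs i) f)"
proof -
  let ?p = "position \<Phi> (Fs i)"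
  have x: "x \<in> meets \<Phi> f" "x \<in> meets \<Phi> g" using fg unfolding meets_def by force+
  obtain b c where bc: "consecutive \<Phi> f x b" "consecutive \<Phi> g x c"
    using ex_consecutive_right x fg by blast
  have zg: "z i = (x, g x)" using fg by simp
  have cf: "cut_pair \<Phi> (Fs i) f x b"
    using cut_pair_step(1)[of "Fs i" x f b] F F' z fg x bc by simp
  have cg: "cut_pair \<Phi> (Fs i) g x c"
    using cut_pair_step(1)[of "Fs i" x g c] F F' z zg fg(2) x bc by simp
  have pf: "?p f = lev \<Phi> f x"
    using position_step(1)[of "Fs i" x f g] F F' z fg above by simp
  have "?p g = lev \<Phi> g x + 1"
    using position_step(1)[OF F F'[unfolded zg] z[unfolded zg] fg(2,1) fg(3)[symmetric] fg(4)[symmetric]]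
      above right_below_swap[OF fg(1-3)] by simp
  then show pg: "?p g = Suc (?p f)" using pf lev_eq_at_meet[of f x g] fg(4) by simp
  \<comment> \<open>By simplicity only \<open>f\<close> and \<open>g\<close> pass through the
    vertex, so no other cut edge ends there. Their positions being adjacent then fixes
    \<open>k\<close>.\<close>
  have on: "?p h = ?p f \<or> ?p h = ?p g" if h: "h \<in> \<Phi>" "z i \<in> edge_ends S (cut_edge S (Fs i) (?p h))" for h
  proof -
    obtain c d where cd: "cut_pair \<Phi> (Fs i) h c d" using ex_cut_pair F h by blast
    then have "consecutive \<Phi> h c d" by (simp add: cut_pair_def)
    then have "z i \<in> {(c, h c), (d, h d)}" using h cut_edge_eq[OF F h(1) cd] edge_ends_eq by simp
    then have "h x = f x" using fg(5) by auto
    then show ?thesis using simple[of f g h x] fg h by auto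
  qed
  show "sweep_index (card \<Phi>) S Fs z i = ?p f"
    unfolding sweep_index_def
  proof (rule the_equality)
    have "?p f \<in> {1..<card \<Phi>}" using position_range[OF F fg(1)] position_range[OF F fg(2)] pg by auto
    moreover have "z i \<in> edge_ends S (cut_edge S (Fs i) (?p f))"
      using cut_edge_eq[OF F fg(1) cf] edge_ends_eq[OF fg(1) bc(1)] fg(5) by simp
    moreover have "z i \<in> edge_ends S (cut_edge S (Fs i) (?p f + 1))"
      using cut_edge_eq[OF F fg(2) cg] edge_ends_eq[OF fg(2) bc(2)] zg pg by simp
    ultimately show "?p f \<in> {1..<card \<Phi>} \<and>
        z i \<in> edge_ends S (cut_edge S (Fs i) (?p f)) \<inter> edge_ends S (cut_edge S (Fs i) (?p f + 1))"
      by simp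
    fix k assume k: "k \<in> {1..<card \<Phi>} \<and>
        z i \<in> edge_ends S (cut_edge S (Fs i) k) \<inter> edge_ends S (cut_edge S (Fs i) (k + 1))"
    then have "k \<in> {1..card \<Phi>}" "k + 1 \<in> {1..card \<Phi>}" by auto
    then obtain h h' where h: "h \<in> \<Phi>" "?p h = k" "h' \<in> \<Phi>" "?p h' = k + 1"
      using bij_betw_position[OF F] unfolding bij_betw_def by (metis imageE)
    then show "k = ?p f" using on[of h] on[of h'] k pg by auto
  qed
qed

end

subsection \<open>Sweeps\<close>

lemma sweep_step:
  assumes "sweep S F m Fs z" "i < m"
  shows "Fs (Suc i) = insert (z i) (Fs i)" "z i \<notin> Fs i"
  using assms unfolding sweep_def by blast+

lemma sweep_filters_eq:
  assumes "sweep S F m Fs z" "i \<le> m"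
  shows "Fs i = tau ` F \<union> z ` {..<i}"
  using assms(2)
proof (induction i)
  case 0
  then show ?case using assms(1) by (simp add: sweep_def)
next
  case (Suc i)
  then show ?case using sweep_step(1)[OF assms(1), of i] by (auto simp: lessThan_Suc)
qed

lemma sweep_filter:
  assumes "sweep S F m Fs z" "i \<le> m"
  shows "vertex_filter S (Fs i)"
  using assms by (simp add: sweep_def)

lemma sweep_points:
  assumes "sweep S F m Fs z"
  shows "z ` {..<m} = F - tau ` F" "inj_on z {..<m}"
proof -
  have "Fs m = F" using assms by (simp add: sweep_def)
  then have F: "z ` {..<m} \<subseteq> F" "F - tau ` F \<subseteq> z ` {..<m}"
    using sweep_filters_eq[OF assms, of m] by auto
  have out: "z i \<notin> tau ` F \<union> z ` {..<i}" if "i < m" for i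
    using sweep_filters_eq[OF assms, of i] sweep_step(2)[OF assms that] that by auto
  then have "z ` {..<m} \<inter> tau ` F = {}" by blast
  then show "z ` {..<m} = F - tau ` F" using F by blast
  have "z i \<noteq> z j" if "i < j" "j < m" for i j
    using out[OF that(2)] that(1) by (metis UnCI imageI lessThan_iff)
  then show "inj_on z {..<m}" by (intro inj_onI) (metis lessThan_iff linorder_neq_iff)
qed

text \<open>The name refers to abscissae: the contacts of a pair lie to the left of its crossing.
  Since a sweep runs from right to left along each function, it reaches the crossing of a pair
  before any of its contacts.\<close>

definition contacts_first :: "(real \<Rightarrow> real) set \<Rightarrow> (real \<times> real) set \<Rightarrow> bool" where
  "contacts_first \<Phi> F \<longleftrightarrow> (\<forall>f\<in>\<Phi>. \<forall>g\<in>\<Phi>. \<forall>x y. f \<noteq> g \<longrightarrow> crosses f g x \<longrightarrow> f y = g y \<longrightarrow>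
     \<not> crosses f g y \<longrightarrow> (x, f x) \<in> F - tau ` F \<longrightarrow> (y, f y) \<in> F - tau ` F \<longrightarrow> y < x)"

context proper_pseudolines
begin

text \<open>The pair \<open>f\<close>, \<open>w\<close> at the vertex occupies two adjacent
  positions before and after the step, and \<open>g\<close> has neither of them. Hence
  \<open>g\<close> stays on the same side of both, whether or not they exchange.\<close>

lemma position_order_step_other:
  assumes F: "vertex_filter S F" and F': "vertex_filter S (insert (x, f x) F)" and z: "(x, f x) \<notin> F"
    and fw: "f \<in> \<Phi>" "w \<in> \<Phi>" "f \<noteq> w" "f x = w x" and g: "g \<in> \<Phi>" "g x \<noteq> f x"
  shows "position \<Phi> (insert (x, f x) F) f < position \<Phi> (insert (x, f x) F) g \<longleftrightarrow>
      position \<Phi> F f < position \<Phi> F g"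
    and "position \<Phi> (insert (x, f x) F) g < position \<Phi> (insert (x, f x) F) f \<longleftrightarrow>
      position \<Phi> F g < position \<Phi> F f"
proof -
  have zw: "(x, f x) = (x, w x)" using fw by simp
  have pf: "position \<Phi> F f = lev \<Phi> f x + of_bool (right_below f w x)"
    "position \<Phi> (insert (x, f x) F) f = lev \<Phi> f x + of_bool (left_below f w x)"
    using position_step[OF F F' z fw] by auto
  have pw: "position \<Phi> F w = lev \<Phi> f x + of_bool (\<not> right_below f w x)"
    using position_step(1)[OF F F'[unfolded zw] z[unfolded zw] fw(2,1) fw(3)[symmetric] fw(4)[symmetric]]
      right_below_swap[OF fw(1-3)] lev_eq_at_meet[of f x w] fw(4) by simp
  have pg: "position \<Phi> (insert (x, f x) F) g = position \<Phi> F g"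
    using position_step_other[OF F F' g] .
  have "g \<noteq> f" "g \<noteq> w" using fw g by auto
  then have "position \<Phi> F g \<noteq> position \<Phi> F f" "position \<Phi> F g \<noteq> position \<Phi> F w"
    using inj_on_position[OF F] g fw by (auto dest: inj_onD)
  then have "position \<Phi> F g \<noteq> lev \<Phi> f x" "position \<Phi> F g \<noteq> Suc (lev \<Phi> f x)"
    using pf(1) pw by (cases "right_below f w x"; simp)+
  then show "position \<Phi> (insert (x, f x) F) f < position \<Phi> (insert (x, f x) F) g \<longleftrightarrow>
      position \<Phi> F f < position \<Phi> F g"
    "position \<Phi> (insert (x, f x) F) g < position \<Phi> (insert (x, f x) F) f \<longleftrightarrow>
      position \<Phi> F g < position \<Phi> F f"
    unfolding pg pf by (cases "right_below f w x"; cases "left_below f w x"; auto)+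
qed

lemma position_order_step:
  assumes F: "vertex_filter S F" and F': "vertex_filter S (insert (x, f x) F)" and z: "(x, f x) \<notin> F"
    and fg: "f \<in> \<Phi>" "g \<in> \<Phi>" "f \<noteq> g" "f x = g x"
  shows "position \<Phi> F f < position \<Phi> F g \<longleftrightarrow> \<not> right_below f g x"
    and "position \<Phi> (insert (x, f x) F) f < position \<Phi> (insert (x, f x) F) g \<longleftrightarrow> \<not> left_below f g x"
proof -
  have zg: "(x, f x) = (x, g x)" using fg by simp
  show "position \<Phi> F f < position \<Phi> F g \<longleftrightarrow> \<not> right_below f g x"
    using position_step(1)[OF F F' z fg]
      position_step(1)[OF F F'[unfolded zg] z[unfolded zg] fg(2,1) fg(3)[symmetric] fg(4)[symmetric]]
      right_below_swap[OF fg(1-3)] lev_eq_at_meet[of f x g] fg(4) by simp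
  show "position \<Phi> (insert (x, f x) F) f < position \<Phi> (insert (x, f x) F) g \<longleftrightarrow> \<not> left_below f g x"
    using position_step(2)[OF F F' z fg]
      position_step(2)[OF F F'[unfolded zg] z[unfolded zg] fg(2,1) fg(3)[symmetric] fg(4)[symmetric]]
      left_below_swap[OF fg] lev_eq_at_meet[of f x g] fg(4) by simp
qed

text \<open>The crossings of a pair form one orbit, and the vertices of a sweep contain one lift of
  each orbit, without repetition.\<close>

lemma crossing_swept_once:
  assumes sw: "sweep S F m Fs z" and F: "vertex_filter S F" and fg: "f \<in> \<Phi>" "g \<in> \<Phi>" "f \<noteq> g"
    and i: "i < m" "z i = (x, f x)" "crosses f g x" and t: "t < m" "z t = (y, f y)" "crosses f g y"
  shows "t = i"
proof -
  obtain k :: int where "y = x + of_int k * pi" using crosses_unique[OF fg i(3) t(3)] by blast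
  then have "mproj (z t) = mproj (z i)" using mproj_shift[OF fg(1)] i t by simp
  then have "z t = z i"
    using fundamental_domain_unique[OF F, of "z t" "z i"] sweep_points(1)[OF sw] i t by blast
  then show ?thesis using inj_onD[OF sweep_points(2)[OF sw], of t i] i(1) t(1) by simp
qed

text \<open>Only the crossing of this very pair changes its relative order, and it is swept at most
  once, so the existence of an earlier step that swept it records a single reversal.\<close>

lemma position_order:
  assumes sw: "sweep S F m Fs z" and F: "vertex_filter S F" and fg: "f \<in> \<Phi>" "g \<in> \<Phi>" "f \<noteq> g"
    and "i \<le> m"
  shows "position \<Phi> (Fs i) f < position \<Phi> (Fs i) g \<longleftrightarrow>
    (position \<Phi> (Fs 0) f < position \<Phi> (Fs 0) g \<longleftrightarrow> \<not> (\<exists>t<i. \<exists>x. z t = (x, f x) \<and> crosses f g x))"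
  using assms(6)
proof (induction i)
  case (Suc i)
  then have i: "i < m" by simp
  let ?X = "\<lambda>i. \<exists>t<i. \<exists>x. z t = (x, f x) \<and> crosses f g x"
  have Fi: "vertex_filter S (Fs i)" and Fi': "vertex_filter S (insert (z i) (Fs i))"
    using sweep_filter[OF sw] sweep_step(1)[OF sw i] i Suc.prems by (simp, metis)
  have zi: "z i \<notin> Fs i" and eq: "Fs (Suc i) = insert (z i) (Fs i)" using sweep_step[OF sw i] by auto
  have "z i \<in> vertices \<Phi>" using filter_vertices[OF Fi'] by simp
  then obtain u w x where u: "u \<in> \<Phi>" "w \<in> \<Phi>" "u \<noteq> w" "u x = w x" "z i = (x, u x)"
    using vertex_obtain by metis
  have X: "?X (Suc i) \<longleftrightarrow> ?X i \<or> (f x = u x \<and> crosses f g x)"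
    using u(5) by (auto simp: less_Suc_eq)
  have IH: "position \<Phi> (Fs i) f < position \<Phi> (Fs i) g \<longleftrightarrow>
      (position \<Phi> (Fs 0) f < position \<Phi> (Fs 0) g \<longleftrightarrow> \<not> ?X i)" using Suc by simp
  consider (both) "f x = u x" "g x = u x" | (left) "f x = u x" "g x \<noteq> u x"
    | (right) "f x \<noteq> u x" "g x = u x" | (none) "f x \<noteq> u x" "g x \<noteq> u x" by blast
  then show ?case
  proof cases
    case both
    then have zf: "z i = (x, f x)" and fgx: "f x = g x" using u by auto
    \<comment> \<open>Otherwise the crossing would be swept at two different steps. So the reversal
      at this step is the first one.\<close>
    have "\<not> ?X i" if "crosses f g x"
      using crossing_swept_once[OF sw F fg i zf that] i by (metis less_irrefl less_trans)
    then show ?thesis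
      using position_order_step[OF Fi Fi'[unfolded zf] zi[unfolded zf] fg fgx] IH X both(1)
        crosses_iff[OF fg, of x] fgx eq zf by auto
  next
    case left
    obtain v where v: "v \<in> \<Phi>" "f \<noteq> v" "f x = v x" using u left by metis
    have zf: "z i = (x, f x)" using u left by simp
    have "?X (Suc i) \<longleftrightarrow> ?X i" using X left by (auto simp: crosses_def)
    then show ?thesis
      using position_order_step_other(1)[OF Fi Fi'[unfolded zf] zi[unfolded zf] fg(1) v fg(2)] left IH eq zf
      by simp
  next
    case right
    obtain v where v: "v \<in> \<Phi>" "g \<noteq> v" "g x = v x" using u right by metis
    have zg: "z i = (x, g x)" using u right by simp
    have "?X (Suc i) \<longleftrightarrow> ?X i" using X right by auto
    then show ?thesis
      using position_order_step_other(2)[OF Fi Fi'[unfolded zg] zi[unfolded zg] fg(2) v fg(1)] right IH eq zg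
      by simp
  next
    case none
    have "?X (Suc i) \<longleftrightarrow> ?X i" using X none by auto
    then show ?thesis
      using position_step_other[OF Fi Fi'[unfolded u(5)] fg(1) none(1)]
        position_step_other[OF Fi Fi'[unfolded u(5)] fg(2) none(2)] IH eq u(5) by simp
  qed
qed simp

lemma sweep_vertex_obtain:
  assumes sw: "sweep S F m Fs z" and i: "i < m"
  obtains f g x where "f \<in> \<Phi>" "g \<in> \<Phi>" "f \<noteq> g" "f x = g x" "z i = (x, f x)" "\<not> right_below f g x"
    "sweep_index (card \<Phi>) S Fs z i = position \<Phi> (Fs i) f"
    "position \<Phi> (Fs i) g = Suc (position \<Phi> (Fs i) f)"
proof -
  have Fi: "vertex_filter S (Fs i)" and Fi': "vertex_filter S (insert (z i) (Fs i))"
    using sweep_filter[OF sw] sweep_step(1)[OF sw i] i by (simp, metis Suc_leI)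
  have "z i \<in> vertices \<Phi>" using filter_vertices[OF Fi'] by simp
  then obtain u w x where u: "u \<in> \<Phi>" "w \<in> \<Phi>" "u \<noteq> w" "u x = w x" "z i = (x, u x)"
    using vertex_obtain by metis
  obtain f g where fg: "f \<in> \<Phi>" "g \<in> \<Phi>" "f \<noteq> g" "f x = g x" "z i = (x, f x)" "\<not> right_below f g x"
  proof (cases "right_below u w x")
    case True
    then show ?thesis using that[of w u] u right_below_swap[OF u(1-3), of x] by auto
  qed (use that[of u w] u in auto)
  then show ?thesis
    using that[OF fg] sweep_index_eq[where Fs = Fs and z = z and i = i, OF Fi Fi' sweep_step(2)[OF sw i] fg]
    by blast
qed

text \<open>With \<open>f\<close> above \<open>g\<close> before the step, the index of
  \<open>g\<close> is the smaller one exactly as long as their crossing has not been swept. Under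
  \<open>contacts_first\<close> this happens only when the current vertex is the crossing itself, so
  the two positions are exchanged precisely when sorting requires it.\<close>

lemma sorted_if_contacts_first:
  assumes sw: "sweep S F m Fs z" and F: "vertex_filter S F" and cf: "contacts_first \<Phi> F"
    and i: "i < m" and j: "j \<in> {1..card \<Phi>}"
  shows "sweep_perm (card \<Phi>) S (pseudoline_of ` \<Phi>) Fs (i + 1) j =
    sort_entries (sweep_index (card \<Phi>) S Fs z i) (sweep_perm (card \<Phi>) S (pseudoline_of ` \<Phi>) Fs i) j"
proof -
  let ?\<sigma> = "sweep_perm (card \<Phi>) S (pseudoline_of ` \<Phi>) Fs"
  have F0: "vertex_filter S (Fs 0)" and Fi: "vertex_filter S (Fs i)" and FSi: "vertex_filter S (Fs (Suc i))"
    using sweep_filter[OF sw] i by auto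
  have eq: "Fs (Suc i) = insert (z i) (Fs i)" and zi: "z i \<notin> Fs i" using sweep_step[OF sw i] by auto
  obtain f g x where fg: "f \<in> \<Phi>" "g \<in> \<Phi>" "f \<noteq> g" "f x = g x" and z: "z i = (x, f x)"
    and above: "\<not> right_below f g x"
    and q: "sweep_index (card \<Phi>) S Fs z i = position \<Phi> (Fs i) f"
      "position \<Phi> (Fs i) g = Suc (position \<Phi> (Fs i) f)"
    using sweep_vertex_obtain[OF sw i] .
  let ?q = "position \<Phi> (Fs i) f"
  let ?idx = "\<lambda>h. card \<Phi> + 1 - position \<Phi> (Fs 0) h"
  have \<sigma>i: "?\<sigma> i (position \<Phi> (Fs i) h) = ?idx h" and \<sigma>Si: "?\<sigma> (Suc i) (position \<Phi> (Fs (Suc i)) h) = ?idx h"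
    if "h \<in> \<Phi>" for h
    using sweep_perm_position[where Fs = Fs, OF F0 Fi that]
      sweep_perm_position[where Fs = Fs, OF F0 FSi that] by auto
  have Fi': "vertex_filter S (insert (x, f x) (Fs i))" using FSi eq z by simp
  have step: "position \<Phi> (Fs (Suc i)) f = lev \<Phi> f x + of_bool (left_below f g x)" "?q = lev \<Phi> f x"
    using position_step[OF Fi Fi' _ fg] zi z eq above by auto
  have zg: "z i = (x, g x)" using z fg(4) by simp
  have Fig: "vertex_filter S (insert (x, g x) (Fs i))" using FSi eq zg by simp
  have stepg: "position \<Phi> (Fs (Suc i)) g = lev \<Phi> f x + of_bool (\<not> left_below f g x)"
    using position_step(2)[OF Fi Fig _ fg(2,1) fg(3)[symmetric] fg(4)[symmetric]] zi zg eq
      left_below_swap[OF fg] lev_eq_at_meet[of f x g] fg(4) by simp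
  have order: "position \<Phi> (Fs 0) f < position \<Phi> (Fs 0) g \<longleftrightarrow>
      \<not> (\<exists>t<i. \<exists>x. z t = (x, f x) \<and> crosses f g x)"
    using position_order[OF sw F fg(1-3), of i] i q(2) by simp
  have idx_less: "?idx h < ?idx h' \<longleftrightarrow> position \<Phi> (Fs 0) h' < position \<Phi> (Fs 0) h"
    if "h \<in> \<Phi>" "h' \<in> \<Phi>" for h h'
    using position_range[OF F0 that(1)] position_range[OF F0 that(2)] by auto
  have pne: "position \<Phi> (Fs 0) f \<noteq> position \<Phi> (Fs 0) g"
    using inj_on_position[OF F0] fg by (auto dest: inj_onD)
  have sorted: "?idx g < ?idx f \<longleftrightarrow> crosses f g x"
  proof
    assume c: "crosses f g x"
    have "\<not> (\<exists>t<i. \<exists>x. z t = (x, f x) \<and> crosses f g x)"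
      using crossing_swept_once[OF sw F fg(1-3) i z c] i by (metis less_irrefl less_trans)
    then show "?idx g < ?idx f" using order idx_less fg by blast
  next
    assume a: "?idx g < ?idx f"
    show "crosses f g x"
    proof (rule ccontr)
      assume nc: "\<not> crosses f g x"
      obtain y0 where y0: "crosses f g y0" using ex_crosses fg by blast
      then have "y0 \<in> meets \<Phi> f" using fg by (force simp: crosses_def meets_def)
      then have "(y0, f y0) \<in> vertices \<Phi>" using fg by (auto simp: vertices_def)
      then obtain p where p: "p \<in> F - tau ` F" "mproj p = mproj (y0, f y0)"
        using fundamental_domain_ex[OF F] by blast
      then obtain k :: int where k: "p = (y0 + of_int k * pi, f (y0 + of_int k * pi))"
        using mproj_eq_graph_iff[OF pfun[OF fg(1)]] by metis
      \<comment> \<open>The lift of the crossing in the fundamental domain, because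
        \<open>contacts_first\<close> compares lifts in that domain and the sweep runs through
        exactly these.\<close>
      define y where "y = y0 + of_int k * pi"
      have y: "p = (y, f y)" "crosses f g y"
        using k crosses_shift[OF pfun pfun y0] fg by (auto simp: y_def)
      obtain t where t: "t < m" "z t = (y, f y)"
        using p(1) y(1) unfolding sweep_points(1)[OF sw, symmetric] by auto
      have "x < y"
      proof -
        have "(x, f x) \<in> F - tau ` F" using z i sweep_points(1)[OF sw] by (metis imageI lessThan_iff)
        then show ?thesis using cf fg(1-4) y nc p(1) unfolding contacts_first_def by blast
      qed
      \<comment> \<open>The crossing lies to the right of the contact on \<open>f\<close>, so every
        filter containing the contact already contains it. It must have been swept earlier, which
        contradicts the order of the indices.\<close>
      have "t < i"
      proof (rule ccontr)
        assume "\<not> t < i"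
        then have "i < t" using t z \<open>x < y\<close> by (cases "t = i") auto
        then have sub: "Fs (Suc i) \<subseteq> Fs t"
          using sweep_filters_eq[OF sw, of "Suc i"] sweep_filters_eq[OF sw, of t] t(1) by auto
        have m: "x \<in> meets \<Phi> f" "y \<in> meets \<Phi> f" using fg y(2) unfolding crosses_def meets_def by force+
        have "(y, f y) \<in> Fs (Suc i)"
          using filter_up_along[OF FSi fg(1) m] \<open>x < y\<close> eq z by simp
        then show False using sub sweep_step(2)[OF sw t(1)] t(2) by auto
      qed
      then show False using order t y(2) a idx_less[OF fg(2,1)] by blast
    qed
  qed
  have cl: "crosses f g x \<longleftrightarrow> left_below f g x" using crosses_iff[OF fg(1-3)] fg(4) above by blast
  obtain h where h: "h \<in> \<Phi>" "position \<Phi> (Fs (Suc i)) h = j"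
    using bij_betw_position[OF FSi] j unfolding bij_betw_def by (metis imageE)
  have L: "?\<sigma> (i + 1) j = ?idx h" using \<sigma>Si[OF h(1)] h(2) by simp
  have \<sigma>q: "?\<sigma> i ?q = ?idx f" "?\<sigma> i (?q + 1) = ?idx g" using \<sigma>i[OF fg(1)] \<sigma>i[OF fg(2)] q(2) by auto
  have ine: "?idx f \<noteq> ?idx g" using pne position_range[OF F0 fg(1)] position_range[OF F0 fg(2)] by auto
  show ?thesis
  proof (cases "h = f \<or> h = g")
    case True
    then show ?thesis
      unfolding q(1) sort_entries_def L \<sigma>q using sorted cl step stepg h(2) ine
      by (cases "left_below f g x") (auto simp: min_def max_def)
  next
    case False
    then have "h x \<noteq> f x" using simple[of f g h x] fg h by auto
    then have pj: "position \<Phi> (Fs i) h = j"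
      using position_step_other[OF Fi Fi' h(1)] h(2) eq z by simp
    then have "j \<noteq> ?q" "j \<noteq> ?q + 1"
      using inj_onD[OF inj_on_position[OF Fi], of h f] inj_onD[OF inj_on_position[OF Fi], of h g]
        False fg(1,2) h(1) q(2) by auto
    then have "sort_entries ?q (?\<sigma> i) j = ?\<sigma> i j" by (simp add: sort_entries_def)
    then show ?thesis unfolding q(1) L using \<sigma>i[OF h(1)] pj by simp
  qed
qed

lemma sweep_perm_initial:
  assumes sw: "sweep S F m Fs z" and j: "j \<in> {1..card \<Phi>}"
  shows "sweep_perm (card \<Phi>) S (pseudoline_of ` \<Phi>) Fs 0 j = card \<Phi> + 1 - j"
proof -
  have F0: "vertex_filter S (Fs 0)" using sweep_filter[OF sw] by simp
  obtain h where "h \<in> \<Phi>" "position \<Phi> (Fs 0) h = j"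
    using bij_betw_position[OF F0] j unfolding bij_betw_def by (metis imageE)
  then show ?thesis using sweep_perm_position[where Fs = Fs, OF F0 F0] by blast
qed

section \<open>Reconstructing an arrangement from its permutations\<close>

lemma eventually_not_meets:
  assumes "f \<in> \<Phi>"
  shows "\<forall>\<^sub>F t in at x. t \<notin> meets \<Phi> f"
proof -
  have "\<forall>\<^sub>F t in at x. \<forall>g\<in>\<Phi>-{f}. g t \<noteq> f t"
    using finite assms meet_isolated by (intro eventually_ball_finite) auto
  then show ?thesis by eventually_elim (auto simp: meets_def)
qed

end

text \<open>Up to translation, every edge is cut just before its left end is swept, and the
  permutation at that cut tells which pseudoline contains it. So \<open>f\<close> and the function
  of \<Psi> with the same initial position share all edges; continuity takes care of the
  vertices.\<close>

lemma sweep_perm_determines: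
  assumes "proper_pseudolines \<Phi> S" "proper_pseudolines \<Psi> S" and card: "card \<Psi> = card \<Phi>"
    and sw: "sweep S F m Fs z" and F: "vertex_filter S F"
    and perm: "\<And>i j. i \<le> m \<Longrightarrow> j \<in> {1..card \<Phi>} \<Longrightarrow>
      sweep_perm (card \<Phi>) S (pseudoline_of ` \<Phi>) Fs i j = sweep_perm (card \<Phi>) S (pseudoline_of ` \<Psi>) Fs i j"
  shows "\<Phi> \<subseteq> \<Psi>"
proof
  interpret A: proper_pseudolines \<Phi> S by fact
  interpret B: proper_pseudolines \<Psi> S by fact
  have F0: "vertex_filter S (Fs 0)" using sweep_filter[OF sw] by simp
  fix f assume f: "f \<in> \<Phi>"
  obtain g where g: "g \<in> \<Psi>" "position \<Psi> (Fs 0) g = position \<Phi> (Fs 0) f"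
    using B.bij_betw_position[OF F0] A.position_range[OF F0 f] card unfolding bij_betw_def by (metis imageE)
  have same: "f x = g x" if x: "x \<notin> meets \<Phi> f" for x
  proof -
    obtain a b where ab: "consecutive \<Phi> f a b" "a < x" "x < b" using A.ex_consecutive_around f x by blast
    then have "(a, f a) \<in> vertices \<Phi>" using f by (auto simp: consecutive_def vertices_def)
    then obtain p where p: "p \<in> F - tau ` F" "mproj p = mproj (a, f a)"
      using A.fundamental_domain_ex[OF F] by blast
    then obtain k :: int where k: "p = (a + of_int k * pi, f (a + of_int k * pi))"
      using mproj_eq_graph_iff[OF A.pfun[OF f]] by metis
    let ?c = "of_int k * pi"
    have c: "consecutive \<Phi> f (a + ?c) (b + ?c)" using A.consecutive_shift[OF f ab(1)] .
    \<comment> \<open>The step that sweeps the lifted left end of the edge around \<open>x\<close>.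
      In \<open>Fs i\<close> this vertex is still missing, so the edge to its right is cut.\<close>
    obtain i where i: "i < m" "z i = (a + ?c, f (a + ?c))"
      using p(1) k unfolding sweep_points(1)[OF sw, symmetric] by auto
    have Fi: "vertex_filter S (Fs i)" using sweep_filter[OF sw] i by simp
    have Fi': "vertex_filter S (insert (a + ?c, f (a + ?c)) (Fs i))"
      using sweep_filter[OF sw, of "Suc i"] sweep_step(1)[OF sw i(1)] i by simp
    have "a + ?c \<in> meets \<Phi> f" using c by (simp add: consecutive_def)
    then have cp: "cut_pair \<Phi> (Fs i) f (a + ?c) (b + ?c)"
      using A.cut_pair_step(1)[OF Fi Fi' _ f] sweep_step(2)[OF sw i(1)] i(2) c by simp
    let ?j = "position \<Phi> (Fs i) f"
    have edge: "cut_edge S (Fs i) ?j = strand f (a + ?c) (b + ?c)" using A.cut_edge_eq[OF Fi f cp] .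
    have j: "?j \<in> {1..card \<Phi>}" using A.position_range[OF Fi f] .
    then obtain h where h: "h \<in> \<Psi>" "position \<Psi> (Fs i) h = ?j"
      using B.bij_betw_position[OF Fi] card unfolding bij_betw_def by (metis imageE)
    have "card \<Phi> + 1 - position \<Phi> (Fs 0) f = card \<Phi> + 1 - position \<Psi> (Fs 0) h"
      using A.sweep_perm_position[where Fs = Fs, OF F0 Fi f]
        B.sweep_perm_position[where Fs = Fs, OF F0 Fi h(1)] h(2) card
        perm[of i ?j] i(1) j by simp
    then have "position \<Psi> (Fs 0) h = position \<Psi> (Fs 0) g"
      using g(2) A.position_range[OF F0 f] B.position_range[OF F0 h(1)] card by auto
    then have "h = g" using inj_onD[OF B.inj_on_position[OF F0], of h g] h(1) g(1) by simp
    then have "mproj ` strand f (a + ?c) (b + ?c) \<subseteq> pseudoline_of g"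
      using B.mproj_cut_edge_subset[OF Fi h(1) g(1)] h(2) edge by simp
    then have "mproj (x + ?c, f (x + ?c)) \<in> pseudoline_of g" using ab by (auto simp: strand_def)
    then have "mproj (x, f x) \<in> pseudoline_of g" using A.mproj_shift[OF f] by simp
    then show ?thesis using mproj_mem_pseudoline_of[OF B.pfun[OF g(1)]] by simp
  qed
  have "f x = g x" for x
  proof -
    have "\<forall>\<^sub>F t in at x. f t - g t = 0"
      using A.eventually_not_meets[OF f, of x] by eventually_elim (simp add: same)
    then have "((\<lambda>t. f t - g t) \<longlongrightarrow> 0) (at x)" by (rule tendsto_eventually)
    moreover have "isCont (\<lambda>t. f t - g t) x"
      using f g A.pfun B.pfun by (intro continuous_diff pseudoline_fun_isCont) auto
    then have "((\<lambda>t. f t - g t) \<longlongrightarrow> f x - g x) (at x)" by (simp add: isCont_def)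
    ultimately have "f x - g x = 0" using tendsto_unique[OF at_neq_bot] by metis
    then show ?thesis by simp
  qed
  then have "f = g" by auto
  then show "f \<in> \<Psi>" using g by simp
qed

text \<open>The initial permutation is fixed and \<open>sweep_index\<close> depends on the support
  only, so sorting at each step determines all permutations recursively.\<close>

lemma sorted_unique:
  assumes A: "proper_pseudolines \<Phi> S" and B: "proper_pseudolines \<Psi> S"
    and sw: "sweep S F m Fs z" and F: "vertex_filter S F"
    and sA: "\<And>i j. i < m \<Longrightarrow> j \<in> {1..card \<Phi>} \<Longrightarrow> sweep_perm (card \<Phi>) S (pseudoline_of ` \<Phi>) Fs (i + 1) j =
      sort_entries (sweep_index (card \<Phi>) S Fs z i) (sweep_perm (card \<Phi>) S (pseudoline_of ` \<Phi>) Fs i) j"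
    and sB: "\<And>i j. i < m \<Longrightarrow> j \<in> {1..card \<Phi>} \<Longrightarrow> sweep_perm (card \<Phi>) S (pseudoline_of ` \<Psi>) Fs (i + 1) j =
      sort_entries (sweep_index (card \<Phi>) S Fs z i) (sweep_perm (card \<Phi>) S (pseudoline_of ` \<Psi>) Fs i) j"
  shows "\<Phi> = \<Psi>"
proof -
  interpret A: proper_pseudolines \<Phi> S by fact
  interpret B: proper_pseudolines \<Psi> S by fact
  have card: "card \<Psi> = card \<Phi>" using A.card_unique B.pseudolines_axioms by blast
  have perm: "sweep_perm (card \<Phi>) S (pseudoline_of ` \<Phi>) Fs i j =
      sweep_perm (card \<Phi>) S (pseudoline_of ` \<Psi>) Fs i j" if "i \<le> m" "j \<in> {1..card \<Phi>}" for i j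
    using that
  proof (induction i arbitrary: j)
    case 0
    then show ?case
      using A.sweep_perm_initial[OF sw] B.sweep_perm_initial[OF sw] card by simp
  next
    case (Suc i)
    then have i: "i < m" by simp
    obtain f g where fg: "f \<in> \<Phi>" "g \<in> \<Phi>" "sweep_index (card \<Phi>) S Fs z i = position \<Phi> (Fs i) f"
      "position \<Phi> (Fs i) g = Suc (position \<Phi> (Fs i) f)"
      using A.sweep_vertex_obtain[OF sw i] by metis
    have "vertex_filter S (Fs i)" using sweep_filter[OF sw] i by simp
    \<comment> \<open>Permutations are compared only on \<open>{1..card \<Phi>}\<close>, so both
      entries that are sorted must lie in this range for the induction hypothesis to apply.\<close>
    then have q: "sweep_index (card \<Phi>) S Fs z i \<in> {1..card \<Phi>}"
      "sweep_index (card \<Phi>) S Fs z i + 1 \<in> {1..card \<Phi>}"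
      using A.position_range fg by (simp, metis Suc_eq_plus1)
    show ?case
      using sA[OF i Suc.prems(2)] sB[OF i Suc.prems(2)] Suc.IH[OF less_imp_le[OF i] q(1)]
        Suc.IH[OF less_imp_le[OF i] q(2)] Suc.IH[OF less_imp_le[OF i] Suc.prems(2)]
      by (simp add: sort_entries_def)
  qed
  show ?thesis
  proof (rule subset_antisym)
    show "\<Phi> \<subseteq> \<Psi>" by (rule sweep_perm_determines[OF A B card sw F perm])
    show "\<Psi> \<subseteq> \<Phi>" by (rule sweep_perm_determines[OF B A card[symmetric] sw F]) (simp add: card perm)
  qed
qed

subsection \<open>Flips\<close>

lemma crosses_cong:
  assumes "\<forall>\<^sub>F t in nhds x. f t = f' t" "\<forall>\<^sub>F t in nhds x. g t = g' t" "crosses f g x"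
  shows "crosses f' g' x"
proof -
  have "\<forall>\<^sub>F t in nhds x. f t = f' t \<and> g t = g' t" using assms(1,2) by (rule eventually_conj)
  then obtain d where d: "d > 0" "\<And>t. dist t x < d \<Longrightarrow> f t = f' t \<and> g t = g' t"
    unfolding eventually_nhds_metric by blast
  obtain e where e: "e > 0"
    "\<And>s t. s \<in> {x-e<..<x} \<Longrightarrow> t \<in> {x<..<x+e} \<Longrightarrow> (f s - g s) * (f t - g t) < 0"
    using assms(3) unfolding crosses_def by blast
  have "(f' s - g' s) * (f' t - g' t) < 0"
    if "s \<in> {x-min d e<..<x}" "t \<in> {x<..<x+min d e}" for s t
    using that d(2)[of s] d(2)[of t] e(2)[of s t] by (auto simp: dist_real_def)
  moreover have "f' x = g' x" using d(2)[of x] d(1) assms(3) by (auto simp: crosses_def)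
  ultimately show ?thesis unfolding crosses_def using d(1) e(1) by (intro conjI exI[of _ "min d e"]) auto
qed

text \<open>The difference of two pseudolines is antiperiodic, so it changes sign within a period.\<close>

lemma ex_crosses_if_isolated:
  assumes p: "pseudoline_fun p" and q: "pseudoline_fun q"
    and iso: "\<And>x. \<forall>\<^sub>F t in at x. p t \<noteq> q t"
  shows "\<exists>x. crosses p q x"
proof -
  define h where "h x = p x - q x" for x
  have cont: "continuous_on A h" for A
    unfolding h_def using pseudoline_fun_continuous p q by (intro continuous_on_diff) auto
  have anti: "h (x + pi) = - h x" for x using p q by (simp add: h_def pseudoline_fun_def)
  obtain x1 where "h x1 \<noteq> 0"
    using eventually_happens'[OF at_neq_bot iso[of 0]] by (auto simp: h_def)
  then obtain a where a: "h a > 0" using anti[of x1] by (metis linorder_neqE_linordered_idom neg_0_less_iff_less)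
  define b where "b = a + pi"
  have b: "h b < 0" "a < b" using a anti[of a] by (auto simp: b_def)
  let ?T = "{x\<in>{a..b}. h x > 0}"
  \<comment> \<open>The last point in the interval that is a limit of positive values. Beyond it
    \<open>h\<close> is nonpositive up to \<open>b\<close>, and isolated zeros make both signs
    strict near \<open>s\<close>.\<close>
  define s where "s = Sup ?T"
  have "a \<in> ?T" using a b by simp
  then have T: "?T \<noteq> {}" "bdd_above ?T" by (blast, auto intro: bdd_aboveI[of _ b])
  have up: "x \<le> s" if "x \<in> ?T" for x unfolding s_def using T that by (intro cSup_upper) auto
  have sb: "s \<le> b" unfolding s_def using T by (intro cSup_least) auto
  have as: "a \<le> s" using up[of a] a b by auto
  have near: "\<exists>x\<in>?T. y < x" if "y < s" for y using less_cSupD[OF T(1), of y] that by (auto simp: s_def)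
  have lim: "(h \<longlongrightarrow> h s) (nhds s)"
    using cont[of UNIV] by (simp add: continuous_on_eq_continuous_at isCont_def tendsto_nhds_iff)
  have hs: "h s = 0"
  proof (rule ccontr)
    assume "h s \<noteq> 0"
    then consider "h s > 0" | "h s < 0" by linarith
    then show False
    proof cases
      case 1
      then obtain e where e: "e > 0" "\<And>t. dist t s < e \<Longrightarrow> h t > 0"
        using order_tendstoD(1)[OF lim] unfolding eventually_nhds_metric by blast
      have "s < b" using 1 b(1) sb by (cases "s = b") auto
      define t where "t = s + min e (b - s) / 2"
      have "0 < min e (b - s)" using e \<open>s < b\<close> by simp
      then have "s < t" "dist t s < e" "t \<le> b" unfolding t_def by (auto simp: dist_real_def min_def field_simps)
      then have "t \<in> ?T" using e(2)[of t] as by auto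
      then show False using up[of t] \<open>s < t\<close> by simp
    next
      case 2
      then obtain e where e: "e > 0" "\<And>t. dist t s < e \<Longrightarrow> h t < 0"
        using order_tendstoD(2)[OF lim] unfolding eventually_nhds_metric by blast
      obtain x where x: "x \<in> ?T" "s - e < x" using near[of "s - e"] e(1) by auto
      then show False using up[OF x(1)] e(2)[of x] by (auto simp: dist_real_def)
    qed
  qed
  have sb': "s < b" using hs b(1) sb by (cases "s = b") auto
  obtain e0 where e0: "e0 > 0" "\<And>t. t \<noteq> s \<Longrightarrow> dist t s < e0 \<Longrightarrow> h t \<noteq> 0"
    using iso[of s] unfolding eventually_at h_def by auto
  define e where "e = min e0 (b - s)"
  have e: "e > 0" using e0 sb' by (simp add: e_def)
  have ne: "h t \<noteq> 0" if "t \<noteq> s" "s - e < t" "t < s + e" for t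
    using e0(2)[of t] that by (auto simp: e_def dist_real_def)
  have right: "h t < 0" if t: "s < t" "t < s + e" for t
  proof -
    have "t \<notin> ?T" using up[of t] t by auto
    moreover have "t \<in> {a..b}" using t as by (auto simp: e_def)
    ultimately show ?thesis using ne[of t] t e by force
  qed
  have left: "h t > 0" if t: "s - e < t" "t < s" for t
  proof -
    obtain x where x: "x \<in> ?T" "s - e < x" using near[of "s - e"] e by auto
    have "x < s" using x(1) up[OF x(1)] hs by (cases "x = s") auto
    have "0 < h t \<longleftrightarrow> 0 < h x"
      using t x \<open>x < s\<close> ne e
      by (intro sign_constant_between_meets[of "s - e" s "\<lambda>_. 0" h]) (auto simp: cont dest: sym)
    then show ?thesis using x by simp
  qed
  have "crosses p q s"
    unfolding crosses_def using hs e left right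
    by (auto simp: h_def mult_less_0_iff intro!: exI[of _ e])
  then show ?thesis by blast
qed

section \<open>Exchanging two pseudolines between a crossing and a contact\<close>

definition in_flip :: "real \<Rightarrow> real \<Rightarrow> real \<Rightarrow> bool" where
  "in_flip c d x \<longleftrightarrow> (\<exists>k::int. c + of_int k * pi \<le> x \<and> x < d + of_int k * pi)"

definition flip_border :: "real \<Rightarrow> real \<Rightarrow> real set" where
  "flip_border c d = {x. \<exists>k::int. x = c + of_int k * pi \<or> x = d + of_int k * pi}"

text \<open>The exchange is repeated in every period to preserve antiperiodicity. Assigning the left
  end of each interval to the exchanged part is a mere convention, since in
  \<open>contact_flip\<close> the two functions agree at both ends.\<close>

definition swap :: "real \<Rightarrow> real \<Rightarrow> (real \<Rightarrow> real) \<Rightarrow> (real \<Rightarrow> real) \<Rightarrow> real \<Rightarrow> real" where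
  "swap c d f g x = (if in_flip c d x then g x else f x)"

lemma in_flip_shift: "in_flip c d (x + pi) \<longleftrightarrow> in_flip c d x"
proof -
  have "c + of_int (k + 1) * pi \<le> x + pi \<and> x + pi < d + of_int (k + 1) * pi \<longleftrightarrow>
      c + of_int k * pi \<le> x \<and> x < d + of_int k * pi" for k :: int
    by (simp add: algebra_simps)
  then show ?thesis unfolding in_flip_def by (metis diff_add_cancel)
qed

text \<open>As \<open>d < c + pi\<close>, the translated intervals are disjoint, and only the one
  starting in the period of \<open>x\<close> can contain \<open>x\<close>.\<close>

lemma in_flip_iff:
  assumes "d < c + pi" "c + of_int k * pi \<le> x" "x < c + of_int k * pi + pi"
  shows "in_flip c d x \<longleftrightarrow> x < d + of_int k * pi"
proof
  assume "in_flip c d x"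
  then obtain l :: int where l: "c + of_int l * pi \<le> x" "x < d + of_int l * pi"
    by (auto simp: in_flip_def)
  have "of_int k * pi < of_int (l + 1) * pi" "of_int l * pi < of_int (k + 1) * pi"
    using l assms by (auto simp: algebra_simps)
  then have "k < l + 1" "l < k + 1" by (simp_all only: mult_less_cancel_right_pos[OF pi_gt_zero] of_int_less_iff)
  then show "x < d + of_int k * pi" using l by simp
qed (use assms in \<open>auto simp: in_flip_def\<close>)

lemma in_flip_locally_constant:
  assumes "c < d" "d < c + pi" "x \<notin> flip_border c d"
  shows "\<forall>\<^sub>F t in nhds x. in_flip c d t = in_flip c d x"
proof -
  obtain k :: int where "c \<le> x + of_int k * pi" "x + of_int k * pi < c + pi"
    using shift_into_period by blast
  then have k: "c + of_int (-k) * pi \<le> x" "x < c + of_int (-k) * pi + pi" by auto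
  have ne: "x \<noteq> c + of_int (-k) * pi" "x \<noteq> d + of_int (-k) * pi"
    using assms(3) unfolding flip_border_def by blast+
  let ?W = "{c + of_int (-k) * pi<..<c + of_int (-k) * pi + pi} \<inter>
      (if x < d + of_int (-k) * pi then {..<d + of_int (-k) * pi} else {d + of_int (-k) * pi<..})"
  have "open ?W" by auto
  moreover have "x \<in> ?W" using k ne by auto
  ultimately have "\<forall>\<^sub>F t in nhds x. t \<in> ?W" by (rule eventually_nhds_in_open)
  then show ?thesis
  proof eventually_elim
    fix t assume "t \<in> ?W"
    then show "in_flip c d t = in_flip c d x"
      using in_flip_iff[OF assms(2), of "-k" t] in_flip_iff[OF assms(2) k] by (auto split: if_splits)
  qed
qed

lemma in_flip_border:
  assumes cd: "c < d" "d < c + pi" and x: "x \<in> flip_border c d"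
  shows "\<exists>e>0. \<forall>s\<in>{x-e<..<x}. \<forall>t\<in>{x<..<x+e}. in_flip c d s \<noteq> in_flip c d t"
proof -
  obtain k :: int where "x = c + of_int k * pi \<or> x = d + of_int k * pi"
    using x by (auto simp: flip_border_def)
  then show ?thesis
  proof
    assume x: "x = c + of_int k * pi"
    \<comment> \<open>The smaller of the length of an interval and the length of the gap to the next
      one, so that no other border comes within this distance.\<close>
    let ?e = "min (d - c) (c + pi - d)"
    have "in_flip c d s \<noteq> in_flip c d t" if "s \<in> {x-?e<..<x}" "t \<in> {x<..<x+?e}" for s t
    proof -
      have "\<not> in_flip c d s"
        using in_flip_iff[OF cd(2), of "k - 1" s] that x cd
        by (auto simp: algebra_simps min_def split: if_splits)
      moreover have "in_flip c d t"
        using in_flip_iff[OF cd(2), of k t] that x cd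
        by (auto simp: algebra_simps min_def split: if_splits)
      ultimately show ?thesis by simp
    qed
    then show ?thesis using cd by (intro exI[of _ ?e]) auto
  next
    assume x: "x = d + of_int k * pi"
    let ?e = "min (d - c) (c + pi - d)"
    have "in_flip c d s \<noteq> in_flip c d t" if "s \<in> {x-?e<..<x}" "t \<in> {x<..<x+?e}" for s t
    proof -
      have "in_flip c d s"
        using in_flip_iff[OF cd(2), of k s] that x cd
        by (auto simp: algebra_simps min_def split: if_splits)
      moreover have "\<not> in_flip c d t"
        using in_flip_iff[OF cd(2), of k t] that x cd
        by (auto simp: algebra_simps min_def split: if_splits)
      ultimately show ?thesis by simp
    qed
    then show ?thesis using cd by (intro exI[of _ ?e]) auto
  qed
qed

text \<open>A contact \<open>d\<close> to the right of the crossing \<open>c\<close>, less than a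
  period away. The exchange turns \<open>c\<close> into a contact and \<open>d\<close> into a
  crossing, so the flip that undoes it moves from left to right.\<close>

locale contact_flip = pseudolines +
  fixes f g c d
  assumes f: "f \<in> \<Phi>" and g: "g \<in> \<Phi>" and fg: "f \<noteq> g"
    and cross: "crosses f g c" and meet: "f d = g d" and contact: "\<not> crosses f g d"
    and cd: "c < d" "d < c + pi"
begin

abbreviation "f' \<equiv> swap c d f g"
abbreviation "g' \<equiv> swap c d g f"

text \<open>The situation is symmetric in \<open>f\<close> and \<open>g\<close>, which transfers
  every result about \<open>f'\<close> to \<open>g'\<close>.\<close>

lemma flipped: "contact_flip \<Phi> S g f c d"
  using f g fg cross meet contact cd crosses_sym[of f g] by unfold_locales auto

lemma border_meet: "x \<in> flip_border c d \<Longrightarrow> f x = g x"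
  using pseudoline_fun_shift[OF pfun[OF f], of c] pseudoline_fun_shift[OF pfun[OF g], of c]
    pseudoline_fun_shift[OF pfun[OF f], of d] pseudoline_fun_shift[OF pfun[OF g], of d] cross meet
  by (auto simp: flip_border_def crosses_def)

text \<open>At a border point both branches have the same limit; elsewhere the choice of branch is
  locally constant.\<close>

lemma pseudoline_fun_swap: "pseudoline_fun f'"
  unfolding pseudoline_fun_def
proof
  have "isCont f' x" for x
  proof (cases "x \<in> flip_border c d")
    case True
    then have eq: "f x = g x" by (rule border_meet)
    have "(f \<longlongrightarrow> f' x) (at x)" "(g \<longlongrightarrow> f' x) (at x)"
      using pseudoline_fun_isCont[OF pfun[OF f], of x] pseudoline_fun_isCont[OF pfun[OF g], of x] eq
      by (auto simp: isCont_def swap_def)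
    then have "((\<lambda>t. if in_flip c d t then g t else f t) \<longlongrightarrow> f' x) (at x)"
      unfolding tendsto_def
    proof (intro allI impI)
      fix T assume "\<forall>T. open T \<longrightarrow> f' x \<in> T \<longrightarrow> (\<forall>\<^sub>F t in at x. f t \<in> T)"
        "\<forall>T. open T \<longrightarrow> f' x \<in> T \<longrightarrow> (\<forall>\<^sub>F t in at x. g t \<in> T)" "open T" "f' x \<in> T"
      then have "\<forall>\<^sub>F t in at x. f t \<in> T" "\<forall>\<^sub>F t in at x. g t \<in> T" by auto
      then show "\<forall>\<^sub>F t in at x. (if in_flip c d t then g t else f t) \<in> T" by eventually_elim simp
    qed
    then show ?thesis unfolding isCont_def swap_def .
  next
    case False
    have ev: "\<forall>\<^sub>F t in nhds x. in_flip c d t = in_flip c d x" using in_flip_locally_constant[OF cd False] .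
    show ?thesis
    proof (cases "in_flip c d x")
      case True
      have "\<forall>\<^sub>F t in nhds x. f' t = g t" using ev by eventually_elim (simp add: swap_def True)
      then show ?thesis using isCont_cong[of f' g x] pseudoline_fun_isCont[OF pfun[OF g]] by simp
    next
      case False
      have "\<forall>\<^sub>F t in nhds x. f' t = f t" using ev by eventually_elim (simp add: swap_def False)
      then show ?thesis using isCont_cong[of f' f x] pseudoline_fun_isCont[OF pfun[OF f]] by simp
    qed
  qed
  then show "continuous_on UNIV f'" by (simp add: continuous_on_eq_continuous_at)
  show "\<forall>x. f' (x + pi) = - f' x"
    using pfun[OF f] pfun[OF g] by (simp add: swap_def in_flip_shift pseudoline_fun_def)
qed

lemma swap_locally:
  assumes "x \<notin> flip_border c d"
  shows "\<forall>\<^sub>F t in nhds x. f' t = (if in_flip c d x then g else f) t"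
  using in_flip_locally_constant[OF cd assms] by eventually_elim (simp add: swap_def)

lemma crosses_swap_other:
  assumes "x \<notin> flip_border c d"
  shows "crosses f' h x \<longleftrightarrow> crosses (if in_flip c d x then g else f) h x"
proof -
  have ev: "\<forall>\<^sub>F t in nhds x. (if in_flip c d x then g else f) t = f' t"
    using swap_locally[OF assms] by eventually_elim simp
  show ?thesis
    using crosses_cong[OF swap_locally[OF assms], of h h] crosses_cong[OF ev, of h h] by auto
qed

lemma crosses_swap_inner:
  assumes x: "x \<notin> flip_border c d"
  shows "crosses f' g' x \<longleftrightarrow> crosses f g x"
proof -
  have 1: "crosses f' g' x \<longleftrightarrow> crosses (if in_flip c d x then g else f) g' x"
    by (rule crosses_swap_other[OF x])
  have "crosses g' h x \<longleftrightarrow> crosses (if in_flip c d x then f else g) h x" for h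
    by (rule contact_flip.crosses_swap_other[OF flipped x])
  then show ?thesis using 1 crosses_sym by (auto split: if_splits)
qed

text \<open>The pair is exchanged on exactly one side of a border point. So the product of the
  differences on the two sides changes its sign, and crossing and contact trade places.\<close>

lemma crosses_swap_border:
  assumes x: "x \<in> flip_border c d"
  shows "crosses f' g' x \<longleftrightarrow> \<not> crosses f g x"
proof -
  have eq: "f x = g x" using border_meet[OF x] .
  obtain e0 where e0: "e0 > 0" "\<And>s t. s \<in> {x-e0<..<x} \<Longrightarrow> t \<in> {x<..<x+e0} \<Longrightarrow> in_flip c d s \<noteq> in_flip c d t"
    using in_flip_border[OF cd x] by blast
  have neg: "(f' s - g' s) * (f' t - g' t) = - ((f s - g s) * (f t - g t))"
    if "s \<in> {x-e0<..<x}" "t \<in> {x<..<x+e0}" for s t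
    using e0(2)[OF that] by (auto simp: swap_def algebra_simps)
  show ?thesis
  proof
    assume "crosses f' g' x"
    then obtain e1 where e1: "e1 > 0"
      "\<And>s t. s \<in> {x-e1<..<x} \<Longrightarrow> t \<in> {x<..<x+e1} \<Longrightarrow> (f' s - g' s) * (f' t - g' t) < 0"
      unfolding crosses_def by blast
    show "\<not> crosses f g x"
    proof
      assume "crosses f g x"
      then obtain e2 where e2: "e2 > 0"
        "\<And>s t. s \<in> {x-e2<..<x} \<Longrightarrow> t \<in> {x<..<x+e2} \<Longrightarrow> (f s - g s) * (f t - g t) < 0"
        unfolding crosses_def by blast
      define r where "r = min e0 (min e1 e2) / 2"
      have r: "0 < r" "r < e0" "r < e1" "r < e2" using e0(1) e1(1) e2(1) by (auto simp: r_def min_def)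
      show False using neg[of "x - r" "x + r"] e1(2)[of "x - r" "x + r"] e2(2)[of "x - r" "x + r"] r by auto
    qed
  next
    assume "\<not> crosses f g x"
    then have LR: "left_below f g x \<longleftrightarrow> right_below f g x" using crosses_iff[OF f g fg] eq by blast
    obtain e1 where e1: "e1 > 0" "\<And>t. x < t \<Longrightarrow> t < x + e1 \<Longrightarrow> f t \<noteq> g t \<and> (f t < g t \<longleftrightarrow> right_below f g x)"
      "\<And>t. x - e1 < t \<Longrightarrow> t < x \<Longrightarrow> f t \<noteq> g t \<and> (f t < g t \<longleftrightarrow> left_below f g x)"
      using ex_sided_neighbourhood[OF f g fg, of x] by auto
    have "(f' s - g' s) * (f' t - g' t) < 0"
      if st: "s \<in> {x - min e0 e1<..<x}" "t \<in> {x<..<x + min e0 e1}" for s t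
    proof -
      have "x - e1 < s" "s < x" "x < t" "t < x + e1" using st by (auto simp: min_def split: if_splits)
      then have "f s \<noteq> g s" "f t \<noteq> g t" "f s < g s \<longleftrightarrow> f t < g t"
        using e1(2)[of t] e1(3)[of s] LR by auto
      then have "0 < (f s - g s) * (f t - g t)" by (auto simp: zero_less_mult_iff)
      then show ?thesis using neg[of s t] st by auto
    qed
    moreover have "f' x = g' x" using eq by (simp add: swap_def)
    ultimately show "crosses f' g' x" unfolding crosses_def using e0(1) e1(1)
      by (intro conjI exI[of _ "min e0 e1"]) auto
  qed
qed

lemma border_no_other:
  assumes "x \<in> flip_border c d" "h \<in> \<Phi> - {f, g}"
  shows "f' x \<noteq> h x"
  using simple[OF f g _ fg, of h x] border_meet[OF assms(1)] assms(2) by (auto simp: swap_def)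

lemma finite_meet_swap:
  assumes "h \<in> \<Phi> - {f, g}"
  shows "finite ({x. f' x = h x} \<inter> {a..b})"
proof -
  have "{x. f' x = h x} \<inter> {a..b} \<subseteq> {x. f x = h x} \<inter> {a..b} \<union> {x. g x = h x} \<inter> {a..b}"
    by (auto simp: swap_def)
  moreover have "finite ({x. f x = h x} \<inter> {a..b} \<union> {x. g x = h x} \<inter> {a..b})"
    using finite_meet[OF f, of h a b] finite_meet[OF g, of h a b] assms by auto
  ultimately show ?thesis by (rule finite_subset)
qed

lemma swap_ne_other:
  assumes "h \<in> \<Phi> - {f, g}"
  shows "f' \<noteq> h"
proof
  have "infinite {0..1::real}" by (rule infinite_Icc) simp
  moreover assume "f' = h"
  then have "{x. f' x = h x} \<inter> {0..1} = {0..1}" by auto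
  ultimately show False using finite_meet_swap[OF assms, of 0 1] by metis
qed

lemma ex_crosses_swap:
  assumes h: "h \<in> \<Phi> - {f, g}"
  shows "\<exists>x. crosses f' h x"
proof (rule ex_crosses_if_isolated)
  show "pseudoline_fun f'" by (rule pseudoline_fun_swap)
  show "pseudoline_fun h" using h pfun by simp
  fix x
  have "\<forall>\<^sub>F t in at x. f t \<noteq> h t" "\<forall>\<^sub>F t in at x. g t \<noteq> h t"
    using h f g by (auto intro!: meet_isolated)
  then show "\<forall>\<^sub>F t in at x. f' t \<noteq> h t" by eventually_elim (simp add: swap_def)
qed

lemma crosses_swap_cases:
  assumes h: "h \<in> \<Phi> - {f, g}" and x: "crosses f' h x"
  shows "crosses f h x \<or> crosses g h x"
proof -
  have "x \<notin> flip_border c d" using border_no_other[OF _ h, of x] x by (auto simp: crosses_def)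
  then show ?thesis using crosses_swap_other[of x h] x by (auto split: if_splits)
qed

lemma crosses_swap_disjoint:
  assumes h: "h \<in> \<Phi> - {f, g}" and x: "crosses f' h x"
  shows "\<not> crosses g' h x"
proof
  assume "crosses g' h x"
  then have "f x = h x" "g x = h x" using x by (auto simp: crosses_def swap_def split: if_splits)
  then show False using simple[OF f g _ fg, of h x] h by auto
qed

text \<open>The two crossings of \<open>h\<close> with the old pair are distributed over the new pair, and each new
  pseudoline receives at least one.\<close>

lemma crosses_swap_unique:
  assumes h: "h \<in> \<Phi> - {f, g}" and x: "crosses f' h x" and y: "crosses f' h y"
  shows "\<exists>k::int. y = x + of_int k * pi"
proof (rule ccontr)
  assume no: "\<not> ?thesis"
  have h\<Phi>: "h \<in> \<Phi>" "f \<noteq> h" "g \<noteq> h" using h by auto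
  interpret G: contact_flip \<Phi> S g f c d by (rule flipped)
  have h': "h \<in> \<Phi> - {g, f}" using h by auto
  obtain u where u: "crosses g' h u" using G.ex_crosses_swap[OF h'] by blast
  have trans: "\<exists>k::int. b = a + of_int k * pi"
    if "crosses f h a \<and> crosses f h b \<or> crosses g h a \<and> crosses g h b" for a b
    using that crosses_unique[OF f h\<Phi>(1,2), of a b] crosses_unique[OF g h\<Phi>(1,3), of a b] by blast
  \<comment> \<open>If \<open>x\<close> and \<open>y\<close> are on different orbits, one is an old
    crossing with \<open>f\<close> and the other with \<open>g\<close>, which uses up both old
    orbits. The crossing \<open>u\<close> of \<open>g'\<close> must then fall on one of them, and
    simplicity forbids \<open>f'\<close> and \<open>g'\<close> to meet \<open>h\<close> at the same
    abscissa.\<close>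
  have "(\<exists>k::int. x = u + of_int k * pi) \<or> (\<exists>k::int. y = u + of_int k * pi)"
    using crosses_swap_cases[OF h x] crosses_swap_cases[OF h y] G.crosses_swap_cases[OF h' u] no trans
    by blast
  then have "crosses g' h x \<or> crosses g' h y"
    using crosses_shift[OF G.pseudoline_fun_swap pfun[OF h\<Phi>(1)] u] by auto
  then show False using crosses_swap_disjoint[OF h] x y by blast
qed

lemma swap_ne: "f' \<noteq> g'"
proof
  assume "f' = g'"
  then have "f x = g x" for x by (metis swap_def)
  then show False using fg by auto
qed

text \<open>Away from the border nothing changes, and all old crossings of the pair are on the orbit
  of \<open>c\<close>, hence on the border. There the orbit of \<open>c\<close> turns into contacts
  and that of \<open>d\<close> into crossings.\<close>

lemma crosses_swap_inner_iff:
  "crosses f' g' x \<longleftrightarrow> (\<exists>k::int. x = d + of_int k * pi)"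
proof
  assume a: "crosses f' g' x"
  have "x \<in> flip_border c d"
  proof (rule ccontr)
    assume b: "x \<notin> flip_border c d"
    then have "crosses f g x" using a crosses_swap_inner by blast
    then have "\<exists>k::int. x = c + of_int k * pi" using crosses_unique[OF f g fg cross] by blast
    then show False using b by (auto simp: flip_border_def)
  qed
  moreover have "\<not> crosses f g x" using a crosses_swap_border calculation by blast
  moreover have "crosses f g (c + of_int k * pi)" for k
    using crosses_shift[OF pfun[OF f] pfun[OF g] cross] .
  ultimately show "\<exists>k::int. x = d + of_int k * pi" by (auto simp: flip_border_def)
next
  assume "\<exists>k::int. x = d + of_int k * pi"
  then obtain k :: int where k: "x = d + of_int k * pi" by blast
  have "\<not> crosses f g x"
    using crosses_shift[OF pfun[OF f] pfun[OF g], of x "-k"] contact k by auto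
  moreover have "x \<in> flip_border c d" using k by (auto simp: flip_border_def)
  ultimately show "crosses f' g' x" using crosses_swap_border by blast
qed

definition "\<Phi>' = (\<Phi> - {f, g}) \<union> {f', g'}"

lemma pseudolines_swap: "pseudolines \<Phi>' S"
proof
  interpret G: contact_flip \<Phi> S g f c d by (rule flipped)
  have sym: "\<Phi> - {g, f} = \<Phi> - {f, g}" by auto
  note Gs = G.finite_meet_swap[unfolded sym] G.ex_crosses_swap[unfolded sym] G.crosses_swap_unique[unfolded sym]
  show "finite \<Phi>'" using finite by (simp add: \<Phi>'_def)
  show "pseudoline_fun p" if "p \<in> \<Phi>'" for p
    using that pfun pseudoline_fun_swap G.pseudoline_fun_swap by (auto simp: \<Phi>'_def)
  have meetfg: "{x. f' x = g' x} = {x. f x = g x}" by (auto simp: swap_def)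
  fix p q assume pq: "p \<in> \<Phi>'" "q \<in> \<Phi>'" "p \<noteq> q"
  then consider (old) "p \<in> \<Phi> - {f, g}" "q \<in> \<Phi> - {f, g}" | (fh) "p = f'" "q \<in> \<Phi> - {f, g}"
    | (gh) "p = g'" "q \<in> \<Phi> - {f, g}" | (hf) "q = f'" "p \<in> \<Phi> - {f, g}"
    | (hg) "q = g'" "p \<in> \<Phi> - {f, g}" | (new) "p = f'" "q = g'" | (new') "p = g'" "q = f'"
    by (auto simp: \<Phi>'_def)
  note cases = this
  have comm: "{x. p x = q x} = {x. q x = p x}" by auto
  show "finite ({x. p x = q x} \<inter> {a..b})" for a b
  proof (cases rule: cases)
    case old then show ?thesis using finite_meet pq by auto
  next
    case fh then show ?thesis using finite_meet_swap by simp
  next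
    case gh then show ?thesis using Gs(1) by simp
  next
    case hf then show ?thesis using finite_meet_swap unfolding comm by simp
  next
    case hg then show ?thesis using Gs(1) unfolding comm by simp
  next
    case new then show ?thesis using meetfg finite_meet[OF f g] fg by simp
  next
    case new' then show ?thesis using meetfg finite_meet[OF f g] fg unfolding comm by simp
  qed
  have symc: "crosses p q = crosses q p" using crosses_sym by auto
  show "\<exists>x. crosses p q x"
  proof (cases rule: cases)
    case old then show ?thesis using ex_crosses pq by auto
  next
    case fh then show ?thesis using ex_crosses_swap by simp
  next
    case gh then show ?thesis using Gs(2) by simp
  next
    case hf then show ?thesis using ex_crosses_swap unfolding symc by simp
  next
    case hg then show ?thesis using Gs(2) unfolding symc by simp
  next
    case new then show ?thesis using crosses_swap_inner_iff by auto
  next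
    case new' then show ?thesis using crosses_swap_inner_iff unfolding symc by auto
  qed
  show "\<exists>k::int. y = x + of_int k * pi" if xy: "crosses p q x" "crosses p q y" for x y
  proof (cases rule: cases)
    case old then show ?thesis using crosses_unique pq xy by auto
  next
    case fh then show ?thesis using crosses_swap_unique xy by simp
  next
    case gh then show ?thesis using Gs(3) xy by simp
  next
    case hf then show ?thesis using crosses_swap_unique xy unfolding symc by simp
  next
    case hg then show ?thesis using Gs(3) xy unfolding symc by simp
  next
    case new
    then obtain k l :: int where "x = d + of_int k * pi" "y = d + of_int l * pi"
      using xy crosses_swap_inner_iff by blast
    then show ?thesis by (intro exI[of _ "l - k"]) (simp add: algebra_simps)
  next
    case new'
    then obtain k l :: int where "x = d + of_int k * pi" "y = d + of_int l * pi"
      using xy crosses_swap_inner_iff unfolding symc by blast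
    then show ?thesis by (intro exI[of _ "l - k"]) (simp add: algebra_simps)
  qed
  show "r x \<noteq> p x" if r: "r \<in> \<Phi>'" "p \<noteq> r" "q \<noteq> r" "p x = q x" for r x
  proof
    assume "r x = p x"
    \<comment> \<open>At each abscissa the exchange only permutes the values of \<open>f\<close> and
      \<open>g\<close>. Assigning to every new function the old one it follows at \<open>x\<close>
      is injective, so a triple point would already exist in \<Phi>.\<close>
    have ex: "\<exists>u\<in>\<Phi>. u x = s x \<and> (s \<in> \<Phi> - {f, g} \<longrightarrow> u = s) \<and>
        (s = f' \<longrightarrow> u = (if in_flip c d x then g else f)) \<and> (s = g' \<longrightarrow> u = (if in_flip c d x then f else g))"
      if s: "s \<in> \<Phi>'" for s
    proof -
      have n: "f' \<notin> \<Phi> - {f, g}" "g' \<notin> \<Phi> - {f, g}"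
        using swap_ne_other G.swap_ne_other[unfolded sym] by blast+
      have "s \<in> \<Phi> - {f, g} \<or> s = f' \<or> s = g'" using s unfolding \<Phi>'_def by blast
      then consider "s \<in> \<Phi> - {f, g}" "s \<noteq> f'" "s \<noteq> g'" | "s = f'" "s \<notin> \<Phi> - {f, g}" "s \<noteq> g'"
        | "s = g'" "s \<notin> \<Phi> - {f, g}" "s \<noteq> f'"
        using n swap_ne by metis
      then show ?thesis
      proof cases
        case 1
        then show ?thesis by (intro bexI[of _ s]) simp_all
      next
        case 2
        moreover have "(if in_flip c d x then g else f) x = s x" using 2(1) by (simp add: swap_def)
        ultimately show ?thesis using f g by (intro bexI[of _ "if in_flip c d x then g else f"]) auto
      next
        case 3
        moreover have "(if in_flip c d x then f else g) x = s x" using 3(1) by (simp add: swap_def)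
        ultimately show ?thesis using f g by (intro bexI[of _ "if in_flip c d x then f else g"]) auto
      qed
    qed
    obtain u where u: "u \<in> \<Phi>" "u x = p x" "p \<in> \<Phi> - {f, g} \<longrightarrow> u = p"
      "p = f' \<longrightarrow> u = (if in_flip c d x then g else f)" "p = g' \<longrightarrow> u = (if in_flip c d x then f else g)"
      using ex[OF pq(1)] by blast
    obtain v where v: "v \<in> \<Phi>" "v x = q x" "q \<in> \<Phi> - {f, g} \<longrightarrow> v = q"
      "q = f' \<longrightarrow> v = (if in_flip c d x then g else f)" "q = g' \<longrightarrow> v = (if in_flip c d x then f else g)"
      using ex[OF pq(2)] by blast
    obtain w where w: "w \<in> \<Phi>" "w x = r x" "r \<in> \<Phi> - {f, g} \<longrightarrow> w = r"
      "r = f' \<longrightarrow> w = (if in_flip c d x then g else f)" "r = g' \<longrightarrow> w = (if in_flip c d x then f else g)"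
      using ex[OF r(1)] by blast
    have "u \<noteq> v" using u v pq fg by (auto simp: \<Phi>'_def split: if_splits)
    moreover have "u \<noteq> w" using u w pq r fg by (auto simp: \<Phi>'_def split: if_splits)
    moreover have "v \<noteq> w" using v w pq r fg by (auto simp: \<Phi>'_def split: if_splits)
    ultimately show False using simple[OF u(1) v(1) w(1), of x] u(2) v(2) w(2) r(4) \<open>r x = p x\<close> by simp
  qed
next
  have "pseudoline_of f' \<union> pseudoline_of g' = pseudoline_of f \<union> pseudoline_of g"
  proof -
    have e: "pseudoline_of h = range (\<lambda>x. mproj (x, h x))" for h by (auto simp: pseudoline_of_def)
    have "mproj (x, f' x) \<in> {mproj (x, f x), mproj (x, g x)}" "mproj (x, g' x) \<in> {mproj (x, f x), mproj (x, g x)}"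
      "mproj (x, f x) \<in> {mproj (x, f' x), mproj (x, g' x)}" "mproj (x, g x) \<in> {mproj (x, f' x), mproj (x, g' x)}"
      for x by (auto simp: swap_def)
    then show ?thesis unfolding e by (intro equalityI subsetI) blast+
  qed
  moreover have "\<Phi> = (\<Phi> - {f, g}) \<union> {f, g}" using f g by auto
  then have "S = \<Union> (pseudoline_of ` (\<Phi> - {f, g})) \<union> (pseudoline_of f \<union> pseudoline_of g)"
    using support by (metis SUP_union UN_insert UN_empty Un_empty_right)
  ultimately show "S = \<Union> (pseudoline_of ` \<Phi>')" by (auto simp: \<Phi>'_def)
qed

end

section \<open>Contact points before and after the exchange\<close>

context pseudolines
begin

lemma crossing_point_at:
  assumes "f \<in> \<Phi>" "g \<in> \<Phi>"
  shows "crossing_point (pseudoline_of f) (pseudoline_of g) (mproj (x, f x)) \<longleftrightarrow> crosses f g x"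
proof
  assume "crossing_point (pseudoline_of f) (pseudoline_of g) (mproj (x, f x))"
  then obtain y where y: "crosses f g y" "mproj (y, f y) = mproj (x, f x)"
    using crossing_point_iff pfun assms by metis
  then obtain k :: int where "x = y + of_int k * pi" using mproj_eq_graphD pfun assms by blast
  then show "crosses f g x" using crosses_shift[OF pfun pfun y(1)] assms by blast
qed (use assms crossing_point_iff pfun in blast)

lemma contact_point_at:
  assumes "f \<in> \<Phi>" "g \<in> \<Phi>" "f x = g x"
  shows "contact_point (pseudoline_of f) (pseudoline_of g) (mproj (x, f x)) \<longleftrightarrow> \<not> crosses f g x"
  unfolding contact_point_def crossing_point_at[OF assms(1,2)]
  using mproj_mem_pseudoline_of[OF pfun[OF assms(1)], of x "f x"]
    mproj_mem_pseudoline_of[OF pfun[OF assms(2)], of x "f x"] assms(3) by auto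

lemma contact_points_subset: "contact_points (pseudoline_of ` \<Phi>) \<subseteq> mproj ` vertices \<Phi>"
  unfolding intersection_points_eq[symmetric]
  by (auto simp: contact_points_def intersection_points_def contact_point_def)

text \<open>By simplicity no other pair passes through the point, so this pair alone decides whether
  it is a contact point.\<close>

lemma contact_points_at:
  assumes fg: "f \<in> \<Phi>" "g \<in> \<Phi>" "f \<noteq> g" "f x = g x"
  shows "mproj (x, f x) \<in> contact_points (pseudoline_of ` \<Phi>) \<longleftrightarrow> \<not> crosses f g x"
proof
  assume "mproj (x, f x) \<in> contact_points (pseudoline_of ` \<Phi>)"
  then obtain h k where hk: "h \<in> \<Phi>" "k \<in> \<Phi>" "h \<noteq> k"
    "contact_point (pseudoline_of h) (pseudoline_of k) (mproj (x, f x))"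
    unfolding contact_points_def by auto
  then have "f x = h x" "f x = k x"
    using mproj_mem_pseudoline_of pfun by (auto simp: contact_point_def)
  then have "h = f \<and> k = g \<or> h = g \<and> k = f"
    using simple[of f g h x] simple[of f g k x] fg hk by metis
  moreover have "\<not> crosses h k x"
    using contact_point_at[OF hk(1,2), of x] hk(4) \<open>f x = h x\<close> \<open>f x = k x\<close> by simp
  ultimately show "\<not> crosses f g x" using crosses_sym by auto
next
  assume "\<not> crosses f g x"
  then have "contact_point (pseudoline_of f) (pseudoline_of g) (mproj (x, f x))"
    using contact_point_at fg by blast
  moreover have "pseudoline_of f \<noteq> pseudoline_of g"
    using pseudoline_of_inject[OF pfun[OF fg(1)] pfun[OF fg(2)]] fg(3) by simp
  ultimately show "mproj (x, f x) \<in> contact_points (pseudoline_of ` \<Phi>)"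
    unfolding contact_points_def using fg(1,2) by blast
qed

end

context contact_flip
begin

lemma contact_points_swap_at:
  assumes pq: "p \<in> \<Phi>" "q \<in> \<Phi>" "p \<noteq> q" "p x = q x"
  shows "mproj (x, p x) \<in> contact_points (pseudoline_of ` \<Phi>') \<longleftrightarrow>
    (mproj (x, p x) \<in> contact_points (pseudoline_of ` \<Phi>)) \<noteq> (x \<in> flip_border c d \<and> p x = f x)"
proof -
  interpret N: pseudolines \<Phi>' S by (rule pseudolines_swap)
  interpret G: contact_flip \<Phi> S g f c d by (rule flipped)
  have mem: "f' \<in> \<Phi>'" "g' \<in> \<Phi>'" "\<Phi> - {f, g} \<subseteq> \<Phi>'" by (auto simp: \<Phi>'_def)
  have mixed_pair: ?thesis if ah: "{p, q} = {a, h}" "a \<in> {f, g}" "h \<in> \<Phi> - {f, g}" for a h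
  proof -
    have a\<Phi>: "a \<in> \<Phi>" "a \<noteq> h" using ah f g by auto
    have eq: "p x = a x" "h x = a x" using ah(1) pq(4) by (auto simp: doubleton_eq_iff)
    have nb: "x \<notin> flip_border c d"
    proof
      assume "x \<in> flip_border c d"
      then have "f x = g x" by (rule border_meet)
      then show False using simple[OF f g _ fg, of h x] eq ah by auto
    qed
    \<comment> \<open>The new function that runs along \<open>a\<close> near \<open>x\<close>;
      \<open>x\<close> is not on the border, so the crossing behaviour with \<open>h\<close> is
      inherited from \<open>a\<close>.\<close>
    define s where "s = (if in_flip c d x = (a = f) then g' else f')"
    have sx: "s x = a x" using ah(2) by (auto simp: s_def swap_def)
    have "s \<noteq> h"
      using swap_ne_other[OF ah(3)] G.swap_ne_other[of h] ah(3) by (auto simp: s_def)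
    moreover have "s \<in> \<Phi>'" "h \<in> \<Phi>'" using mem ah(3) by (auto simp: s_def)
    ultimately have "mproj (x, s x) \<in> contact_points (pseudoline_of ` \<Phi>') \<longleftrightarrow> \<not> crosses s h x"
      using N.contact_points_at[of s h x] sx eq by simp
    moreover have "crosses s h x \<longleftrightarrow> crosses a h x"
      using crosses_swap_other[OF nb, of h] G.crosses_swap_other[OF nb, of h] ah(2) fg
      by (auto simp: s_def split: if_splits)
    moreover have "mproj (x, a x) \<in> contact_points (pseudoline_of ` \<Phi>) \<longleftrightarrow> \<not> crosses a h x"
      using contact_points_at[of a h x] a\<Phi> ah(3) eq by simp
    ultimately show ?thesis using nb sx eq by simp
  qed
  consider (inner) "{p, q} = {f, g}" | (outer) "p \<in> \<Phi> - {f, g}" "q \<in> \<Phi> - {f, g}"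
    | (mixed) "p \<in> {f, g}" "q \<in> \<Phi> - {f, g}" | (mixed') "q \<in> {f, g}" "p \<in> \<Phi> - {f, g}"
    using pq by auto
  then show ?thesis
  proof cases
    case inner
    then have eq: "f x = g x" "p x = f x" using pq(4) by (auto simp: doubleton_eq_iff)
    then have sx: "f' x = f x" "g' x = f x" by (auto simp: swap_def)
    have "mproj (x, f x) \<in> contact_points (pseudoline_of ` \<Phi>') \<longleftrightarrow> \<not> crosses f' g' x"
      using N.contact_points_at[of f' g' x] mem swap_ne sx by simp
    moreover have "mproj (x, f x) \<in> contact_points (pseudoline_of ` \<Phi>) \<longleftrightarrow> \<not> crosses f g x"
      using contact_points_at[OF f g fg eq(1)] .
    ultimately show ?thesis
      using crosses_swap_border[of x] crosses_swap_inner[of x] eq(2)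
      by (cases "x \<in> flip_border c d") simp_all
  next
    case outer
    have "\<not> (x \<in> flip_border c d \<and> p x = f x)"
    proof
      assume "x \<in> flip_border c d \<and> p x = f x"
      then show False using simple[OF f g _ fg, of p x] border_meet[of x] outer by auto
    qed
    moreover have "p \<in> \<Phi>'" "q \<in> \<Phi>'" using outer mem by auto
    ultimately show ?thesis using contact_points_at[OF pq] N.contact_points_at[of p q x] pq by simp
  next
    case mixed
    then show ?thesis using mixed_pair[of p q] by blast
  next
    case mixed'
    then show ?thesis using mixed_pair[of q p] by blast
  qed
qed

lemma contact_points_swap:
  "contact_points (pseudoline_of ` \<Phi>) =
    contact_points (pseudoline_of ` \<Phi>') - {mproj (c, f c)} \<union> {mproj (d, f d)}"
proof -
  interpret N: pseudolines \<Phi>' S by (rule pseudolines_swap)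
  let ?v = "mproj (c, f c)" and ?w = "mproj (d, f d)"
  let ?C = "contact_points (pseudoline_of ` \<Phi>)" and ?C' = "contact_points (pseudoline_of ` \<Phi>')"
  have fc: "f c = g c" using cross by (simp add: crosses_def)
  have v: "?v \<notin> ?C" using contact_points_at[OF f g fg fc] cross by simp
  have w: "?w \<in> ?C" using contact_points_at[OF f g fg meet] contact by simp
  have status: "u \<in> ?C' \<longleftrightarrow> (u \<in> ?C) \<noteq> (u \<in> {?v, ?w})" if u: "u \<in> mproj ` vertices \<Phi>" for u
  proof -
    obtain p q x where pq: "p \<in> \<Phi>" "q \<in> \<Phi>" "q \<noteq> p" "q x = p x" "u = mproj (x, p x)"
      using u by (auto simp: vertices_def meets_def)
    have "u \<in> {?v, ?w} \<longleftrightarrow> x \<in> flip_border c d \<and> p x = f x"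
    proof
      assume "u \<in> {?v, ?w}"
      then have "mproj (c, f c) = mproj (x, p x) \<or> mproj (d, f d) = mproj (x, p x)" using pq(5) by auto
      then show "x \<in> flip_border c d \<and> p x = f x"
        unfolding mproj_eq_graph_iff[OF pfun[OF f]] flip_border_def by auto
    next
      assume x: "x \<in> flip_border c d \<and> p x = f x"
      then obtain k :: int where "x = c + of_int k * pi \<or> x = d + of_int k * pi"
        by (auto simp: flip_border_def)
      then have "mproj (c, f c) = mproj (x, f x) \<or> mproj (d, f d) = mproj (x, f x)"
        unfolding mproj_eq_graph_iff[OF pfun[OF f]] by auto
      then show "u \<in> {?v, ?w}" using pq(5) x by auto
    qed
    then show ?thesis
      using contact_points_swap_at[OF pq(1,2) pq(3)[symmetric] pq(4)[symmetric]] pq(5) by simp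
  qed
  have sub: "?C \<subseteq> mproj ` vertices \<Phi>" "?C' \<subseteq> mproj ` vertices \<Phi>"
    using contact_points_subset N.contact_points_subset vertices_unique[OF pseudolines_swap] by auto

  show ?thesis
  proof (intro set_eqI iffI)
    fix u assume "u \<in> ?C"
    then show "u \<in> ?C' - {?v} \<union> {?w}" using status[of u] sub v by auto
  next
    fix u assume "u \<in> ?C' - {?v} \<union> {?w}"
    then show "u \<in> ?C" using status[of u] sub w by auto
  qed
qed

text \<open>The flip leads from the exchanged arrangement back to the given one, from the contact at
  \<open>c\<close> to the crossing at \<open>d\<close>. This is the incoming arc that a source must
  not have.\<close>

lemma flip_swap:
  "flip (pseudoline_of ` \<Phi>') (mproj (c, f c)) (mproj (d, f d)) (pseudoline_of ` \<Phi>)"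
proof -
  interpret N: pseudolines \<Phi>' S by (rule pseudolines_swap)
  have mem: "f' \<in> \<Phi>'" "g' \<in> \<Phi>'" by (auto simp: \<Phi>'_def)
  have eq: "f' c = f c" "g' c = f c" "f' d = f d" "g' d = f d"
    using cross meet by (auto simp: swap_def crosses_def)
  have "c + of_int 0 * pi = c" "d + of_int 0 * pi = d" by simp_all
  then have border: "c \<in> flip_border c d" "d \<in> flip_border c d"
    unfolding flip_border_def by (metis (mono_tags, lifting) CollectI)+
  have "contact_point (pseudoline_of f') (pseudoline_of g') (mproj (c, f c))"
    using N.contact_point_at[OF mem, of c] eq crosses_swap_border[OF border(1)] cross by simp
  moreover have "crossing_point (pseudoline_of f') (pseudoline_of g') (mproj (d, f d))"
    using N.crossing_point_at[OF mem, of d] eq crosses_swap_border[OF border(2)] contact by simp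
  moreover have "pseudoline_of f' \<noteq> pseudoline_of g'"
    using pseudoline_of_inject[OF N.pfun[OF mem(1)] N.pfun[OF mem(2)]] swap_ne by simp
  moreover have "supported_by (pseudoline_of ` \<Phi>) (\<Union> (pseudoline_of ` \<Phi>'))"
    using supported_by N.support by simp
  ultimately show ?thesis
    unfolding flip_def using contact_points_swap mem by (intro conjI) (blast, simp_all)
qed

end

subsection \<open>Sources\<close>

lemma is_source_iff:
  "is_source (flip_graph S F) \<Lambda> \<longleftrightarrow> supported_by \<Lambda> S \<and>
    \<not> (\<exists>\<Lambda>' v w. supported_by \<Lambda>' S \<and> flip \<Lambda>' v w \<Lambda> \<and> cut_le S F v w \<and> v \<noteq> w)"
  unfolding is_source_def flip_graph_def in_arcs_def by auto

context proper_pseudolines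
begin

lemma contacts_first_if_source:
  assumes F: "vertex_filter S F" and src: "is_source (flip_graph S F) (pseudoline_of ` \<Phi>)"
  shows "contacts_first \<Phi> F"
  unfolding contacts_first_def
proof (intro ballI allI impI)
  fix f g x y
  assume f: "f \<in> \<Phi>" and g: "g \<in> \<Phi>" and fg: "f \<noteq> g" and cr: "crosses f g x" and eq: "f y = g y"
    and nc: "\<not> crosses f g y" and x: "(x, f x) \<in> F - tau ` F" and y: "(y, f y) \<in> F - tau ` F"
  have xm: "x \<in> meets \<Phi> f" and ym: "y \<in> meets \<Phi> f"
    using f g fg cr eq unfolding crosses_def meets_def by force+
  show "y < x"
  proof (rule ccontr)
    assume "\<not> y < x"
    then have "x < y" using cr nc by (cases "x = y") auto
    \<comment> \<open>Otherwise the translate of the contact by \<open>- pi\<close> would lie on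
      \<open>f\<close> at or to the right of the crossing, hence in the filter, and the contact
      would belong to the translated filter.\<close>
    have "y < x + pi"
    proof (rule ccontr)
      assume "\<not> y < x + pi"
      then have "(y - pi, f (y - pi)) \<in> F"
        using filter_up_along[OF F f xm meets_shift_pi(2)[OF f ym]] x by simp
      then show False using y mem_tau_image[OF f, of y] by simp
    qed
    interpret C: contact_flip \<Phi> S f g x y
      using f g fg cr eq nc \<open>x < y\<close> \<open>y < x + pi\<close> by unfold_locales auto
    have "cut_le S F (mproj (x, f x)) (mproj (y, f y))"
      unfolding cut_le_def cut_lift_mproj[OF F x] cut_lift_mproj[OF F y]
      using cover_le_along[OF f xm ym] \<open>x < y\<close> by simp
    moreover have "mproj (x, f x) \<noteq> mproj (y, f y)"
      using fundamental_domain_unique[OF F x y] \<open>x < y\<close> by auto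
    moreover have "supported_by (pseudoline_of ` C.\<Phi>') S"
      using pseudolines.supported_by[OF C.pseudolines_swap] .
    ultimately show False using src C.flip_swap unfolding is_source_iff by blast
  qed
qed

lemma cut_le_fst_less:
  assumes F: "vertex_filter S F" and v: "v \<in> mproj ` vertices \<Phi>" "w \<in> mproj ` vertices \<Phi>"
    and "cut_le S F v w" "v \<noteq> w"
  shows "fst (cut_lift F v) < fst (cut_lift F w)"
  using cover_le_fst[of "cut_lift F v" "cut_lift F w"] cut_lift_mem(2)[OF F v(1)] cut_lift_mem(2)[OF F v(2)]
    assms(4,5) unfolding cut_le_def by metis

lemma ex_source:
  assumes F: "vertex_filter S F"
  shows "\<exists>\<Lambda>. is_source (flip_graph S F) \<Lambda>"
proof -
  let ?A = "{\<Lambda>. supported_by \<Lambda> S}"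
  let ?wt = "\<lambda>C. \<Sum>p\<in>C. fst (cut_lift F p)"
  have sub: "contact_points \<Lambda> \<subseteq> mproj ` vertices \<Phi>" if "supported_by \<Lambda> S" for \<Lambda>
    using supported_by_obtain[OF that] pseudolines.contact_points_subset vertices_unique by metis
  have "contact_points ` ?A \<subseteq> Pow (mproj ` vertices \<Phi>)" using sub by blast
  then have "finite (contact_points ` ?A)" using finite_mproj_vertices by (meson finite_Pow_iff finite_subset)
  moreover have "contact_points ` ?A \<noteq> {}" using supported_by by blast
  \<comment> \<open>A minimum, since a source has no incoming arcs and every arc raises the weight.
    It is taken over sets of contact points, whose finiteness follows from that of the vertices,
    rather than over arrangements.\<close>
  ultimately obtain C where C: "C \<in> contact_points ` ?A" "\<And>D. D \<in> contact_points ` ?A \<Longrightarrow> ?wt C \<le> ?wt D"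
    using arg_min_if_finite[of "contact_points ` ?A" ?wt] by (metis not_le)
  then obtain \<Lambda> where \<Lambda>: "supported_by \<Lambda> S" "C = contact_points \<Lambda>" by blast
  have False if arc: "supported_by \<Lambda>' S" "flip \<Lambda>' v w \<Lambda>" "cut_le S F v w" "v \<noteq> w" for \<Lambda>' v w
  proof -
    obtain \<Psi> where \<Psi>: "pseudolines \<Psi> S" "\<Lambda>' = pseudoline_of ` \<Psi>" using supported_by_obtain[OF arc(1)] .
    interpret P: pseudolines \<Psi> S by fact
    obtain f g where fg: "f \<in> \<Psi>" "g \<in> \<Psi>" "f \<noteq> g"
      "contact_point (pseudoline_of f) (pseudoline_of g) v" "crossing_point (pseudoline_of f) (pseudoline_of g) w"
      and C': "contact_points \<Lambda> = contact_points \<Lambda>' - {v} \<union> {w}"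
      using arc(2) unfolding flip_def \<Psi>(2) by blast
    obtain x where x: "crosses f g x" "w = mproj (x, f x)"
      using fg crossing_point_iff P.pfun by blast
    have w: "w \<notin> contact_points \<Lambda>'"
      using P.contact_points_at[OF fg(1-3), of x] x \<Psi>(2) by (auto simp: crosses_def)
    have "pseudoline_of f \<noteq> pseudoline_of g"
      using pseudoline_of_inject[OF P.pfun[OF fg(1)] P.pfun[OF fg(2)]] fg(3) by simp
    then have v: "v \<in> contact_points \<Lambda>'" unfolding contact_points_def \<Psi>(2) using fg by blast
    have fin: "finite (contact_points \<Lambda>')" using sub[OF arc(1)] finite_mproj_vertices finite_subset by blast
    have "w \<in> contact_points \<Lambda>" using C' by simp
    then have "fst (cut_lift F v) < fst (cut_lift F w)"
      using cut_le_fst_less[OF F _ _ arc(3,4)] sub[OF arc(1)] sub[OF \<Lambda>(1)] v by blast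
    moreover have "?wt C = ?wt (contact_points \<Lambda>' - {v}) + fst (cut_lift F w)"
      unfolding \<Lambda>(2) C' using w fin by simp
    moreover have "?wt (contact_points \<Lambda>') = ?wt (contact_points \<Lambda>' - {v}) + fst (cut_lift F v)"
      using sum.remove[OF fin v, of "\<lambda>p. fst (cut_lift F p)"] by simp
    moreover have "?wt C \<le> ?wt (contact_points \<Lambda>')" using C(2) arc(1) by blast
    ultimately show False by linarith
  qed
  then have "is_source (flip_graph S F) \<Lambda>" unfolding is_source_iff using \<Lambda>(1) by blast
  then show ?thesis ..
qed

end

theorem theorem7:
  fixes \<Lambda>\<^sub>0 :: "mpoint set set" and S :: "mpoint set" and n m :: nat
    and F :: "(real \<times> real) set"
  assumes "supported_by \<Lambda>\<^sub>0 S"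
    and "card \<Lambda>\<^sub>0 = n"
    and "card (intersection_points \<Lambda>\<^sub>0) = m"
    and "vertex_filter S F"
  shows "\<exists>\<Gamma>. (\<forall>\<Lambda>. is_source (flip_graph S F) \<Lambda> \<longleftrightarrow> \<Lambda> = \<Gamma>) \<and>
    (\<forall>Fs z. sweep S F m Fs z \<longrightarrow>
      (\<forall>\<Lambda>. supported_by \<Lambda> S \<longrightarrow>
        (\<Lambda> = \<Gamma> \<longleftrightarrow>
          (\<forall>i<m. \<forall>j\<in>{1..n}.
             sweep_perm n S \<Lambda> Fs (i + 1) j =
             sort_entries (sweep_index n S Fs z i) (sweep_perm n S \<Lambda> Fs i) j))))"
proof -
  obtain \<Phi>\<^sub>0 where \<Phi>\<^sub>0: "pseudolines \<Phi>\<^sub>0 S" "\<Lambda>\<^sub>0 = pseudoline_of ` \<Phi>\<^sub>0"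
    using supported_by_obtain[OF assms(1)] .
  interpret P: pseudolines \<Phi>\<^sub>0 S by fact
  have F: "vertex_filter S F" by fact
  have "inj_on pseudoline_of \<Phi>\<^sub>0" using P.pfun by (intro inj_onI) (simp add: pseudoline_of_inject)
  then have n: "card \<Phi>\<^sub>0 = n" using assms(2) \<Phi>\<^sub>0(2) by (simp add: card_image)
  have m: "card (mproj ` vertices \<Phi>\<^sub>0) = m"
    using assms(3) \<Phi>\<^sub>0(2) P.intersection_points_eq by simp
  \<comment> \<open>A filter is nonempty, so a vertex exists and with it two different pseudolines;
    this rules out the cases \<open>n < 2\<close>.\<close>
  have "vertices \<Phi>\<^sub>0 \<noteq> {}" using F by (auto simp: vertex_filter_def P.cover_vertices_eq)
  then obtain f g where "f \<in> \<Phi>\<^sub>0" "g \<in> \<Phi>\<^sub>0" "f \<noteq> g" by (auto simp: vertices_def meets_def)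
  then have two: "2 \<le> card \<Phi>\<^sub>0" using card_mono[OF P.finite, of "{f, g}"] by simp
  have proper: "proper_pseudolines \<Phi> S" if "pseudolines \<Phi> S" for \<Phi>
    using that two P.card_unique[OF that] by (simp add: proper_pseudolines_def proper_pseudolines_axioms_def)
  interpret P: proper_pseudolines \<Phi>\<^sub>0 S using proper[OF \<Phi>\<^sub>0(1)] .
  define sorting where "sorting \<Lambda> Fs z \<longleftrightarrow> (\<forall>i<m. \<forall>j\<in>{1..n}. sweep_perm n S \<Lambda> Fs (i + 1) j =
      sort_entries (sweep_index n S Fs z i) (sweep_perm n S \<Lambda> Fs i) j)" for \<Lambda> Fs z
  have src_sorting: "sorting \<Lambda> Fs z"
    if src: "is_source (flip_graph S F) \<Lambda>" and sw: "sweep S F m Fs z" for \<Lambda> Fs z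
  proof -
    have "supported_by \<Lambda> S" using src by (simp add: is_source_iff)
    then obtain \<Phi> where \<Phi>: "pseudolines \<Phi> S" "\<Lambda> = pseudoline_of ` \<Phi>" using supported_by_obtain by blast
    interpret Q: proper_pseudolines \<Phi> S using proper[OF \<Phi>(1)] .
    have "card \<Phi> = n" using P.card_unique[OF \<Phi>(1)] n by simp
    then show ?thesis
      unfolding sorting_def \<Phi>(2)
      using Q.sorted_if_contacts_first[OF sw F Q.contacts_first_if_source[OF F src[unfolded \<Phi>(2)]]] by blast
  qed
  have sorting_unique: "\<Lambda> = \<Lambda>'"
    if s: "supported_by \<Lambda> S" "supported_by \<Lambda>' S" and sw: "sweep S F m Fs z"
      and so: "sorting \<Lambda> Fs z" "sorting \<Lambda>' Fs z" for \<Lambda> \<Lambda>' Fs z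
  proof -
    obtain \<Phi> where \<Phi>: "pseudolines \<Phi> S" "\<Lambda> = pseudoline_of ` \<Phi>" using supported_by_obtain[OF s(1)] .
    obtain \<Psi> where \<Psi>: "pseudolines \<Psi> S" "\<Lambda>' = pseudoline_of ` \<Psi>" using supported_by_obtain[OF s(2)] .
    have "card \<Phi> = n" using P.card_unique[OF \<Phi>(1)] n by simp
    then have "\<Phi> = \<Psi>"
      using sorted_unique[OF proper[OF \<Phi>(1)] proper[OF \<Psi>(1)] sw F] so
      unfolding sorting_def \<Phi>(2) \<Psi>(2) by simp
    then show ?thesis using \<Phi>(2) \<Psi>(2) by simp
  qed
  obtain \<Gamma> where \<Gamma>: "is_source (flip_graph S F) \<Gamma>" using P.ex_source[OF F] by blast
  \<comment> \<open>A single sweep suffices for uniqueness of the source: any two sources sort along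
    it and therefore coincide.\<close>
  obtain Fs z where sw: "sweep S F m Fs z" using P.ex_sweep[OF F] m by auto
  have sup: "supported_by \<Lambda> S" if "is_source (flip_graph S F) \<Lambda>" for \<Lambda>
    using that by (simp add: is_source_iff)
  have unique_source: "is_source (flip_graph S F) \<Lambda> \<longleftrightarrow> \<Lambda> = \<Gamma>" for \<Lambda>
    using sorting_unique[OF sup sup sw src_sorting[OF _ sw] src_sorting[OF _ sw]] \<Gamma> by blast
  have source_iff_sorting: "\<Lambda> = \<Gamma> \<longleftrightarrow> sorting \<Lambda> Fs z"
    if "sweep S F m Fs z" "supported_by \<Lambda> S" for \<Lambda> Fs z
    using sorting_unique[OF that(2) sup[OF \<Gamma>] that(1) _ src_sorting[OF \<Gamma> that(1)]]
      src_sorting[OF \<Gamma> that(1)] by blast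
  show ?thesis
    by (intro exI[of _ \<Gamma>] conjI allI impI unique_source source_iff_sorting[unfolded sorting_def])
qed

end
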